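(* Let $\{\psi_{j\,k}^e\}_{j\in\mathbb{Z},\,k\in\mathbb{Z}^d,\,e\in E}$ be an $r$-regular orthonormal wavelet basis of $L^2(\mathbb{R}^d)$. Let $1\leq p\leq 2$ and let $\gamma<r$ satisfy $\frac{d}{2}<\gamma\leq d\left(1-\frac{1}{p}\right)+1$ (if $p=2$, $\frac d2\le\gamma\le\frac d2+1$ is allowed). Let $(\eta_{j\,k\,e})_{j\,k\,e}$ be a sequence of independent identically distributed symmetric $p$-stable random variables, and let $\{Y_\gamma(x)\}_{x\in\mathbb{R}^d}$ be (a measurable version of) the process $$Y_{\gamma}(x)=\sum_{j\in\mathbb{Z}}\sum_{k\in\mathbb{Z}^d}\sum_{e\in E}\eta_{j\,k\,e}\,\mathcal{K}_{\gamma}\psi_{j\,k}^e(x),\qquad x\in\mathbb{R}^d .$$ Let $\mathcal{G}\subset\mathbb{R}^{d+1}$ be the graph of $x\mapsto Y_\gamma(x)$. Then, almost surely, $$\frac{3d}{2}-\gamma+1\leq \dim_H(\mathcal{G}).$$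
   Context: $d\ge 1$ is an integer. $\dim_H$ denotes Hausdorff dimension. Wavelets: $E=\{0,1\}^d\setminus\{(0,\dots,0)\}$. An $r$-regular orthonormal wavelet basis ($r$ a positive integer) is an orthonormal basis $\{\psi_{j\,k}^e\}$ of $L^2(\mathbb{R}^d)$, $\psi_{j\,k}^e(x)=2^{dj/2}\psi^e(2^jx-k)$, arising from an $r$-regular multiresolution approximation of $L^2(\mathbb{R}^d)$ in the sense of Meyer: the scaling function and all the $\psi^e$ have derivatives up to order $r$ satisfying $|\partial^\alpha\psi^e(x)|\le C_m(1+|x|)^{-m}$ for all $m\in\mathbb{N}$ and $|\alpha|\le r$. Modified fractional integral: let $k_\gamma(x)=\frac{1}{C_\gamma}|x|^{-(d-\gamma)}$ with $C_\gamma=\frac{\pi^{d/2}2^{\gamma}\Gamma(\gamma/2)}{\Gamma(d/2-\gamma/2)}$, $K_\gamma(x,y)=k_\gamma(x-y)-k_\gamma(y)$, and $\mathcal{K}_\gamma f(x)=\int_{\mathbb{R}^d}K_\gamma(x,y)f(y)\,dy$. With $\widehat f(\lambda)=\int_{\mathbb{R}^d} f(y)e^{-2\pi i\lambda\cdot y}dy$, the kernel $K_\gamma(x,\cdot)$ has Fourier transform $\lambda\mapsto(2\pi)^{-\gamma}\frac{e^{-2\pi i\lambda\cdot x}-1}{|\lambda|^{\gamma}}$; for $\gamma=d$, where the formula for $k_\gamma$ is undefined, $K_\gamma(x,\cdot)$ is understood through this Fourier transform. Stable variables: for $p\in(0,2]$, a random variable $\eta$ is symmetric $p$-stable ($\eta\sim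 SpS$) with parameter $\sigma>0$ if $\mathbf{E}(e^{i\xi\eta})=e^{-\sigma^p|\xi|^p}$ for all $\xi\in\mathbb{R}$. ($p=2$ is the Gaussian case.) For each $x$ the series is the almost sure limit of the partial sums over $|j|\le N$, $|k|\le M$, $e\in E$ as $N,M\to\infty$. A measurable version is a process $\{\widetilde Y(x)\}_{x\in\mathbb{R}^d}$, jointly measurable in $(x,\omega)$, with $\mathbf{P}(\widetilde Y(x)=Y_\gamma(x))=1$ for each $x$. *)

theory Defs
  imports "HOL-Probability.Probability"
begin

section \<open>Hausdorff dimension\<close>

text \<open>\<open>diameter\<close> is \<open>0\<close> on unbounded sets and \<open>0 powr 0 = 0\<close>; hence the boundedness condition on
  coverings and the explicit convention \<open>diam(U)\<^sup>0 = 1\<close> for nonempty \<open>U\<close>.\<close>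

definition diam_power :: "real \<Rightarrow> 'a::metric_space set \<Rightarrow> real" where
  "diam_power s U = (if U = {} then 0 else if s = 0 then 1 else diameter U powr s)"

definition delta_covers :: "real \<Rightarrow> 'a::metric_space set \<Rightarrow> (nat \<Rightarrow> 'a set) set" where
  "delta_covers \<delta> A =
     {U. A \<subseteq> (\<Union>i. U i) \<and> (\<forall>i. bounded (U i) \<and> diameter (U i) \<le> \<delta>)}"

definition hausdorff_measure :: "real \<Rightarrow> 'a::metric_space set \<Rightarrow> ennreal" where
  "hausdorff_measure s A =
     (SUP \<delta>\<in>{0<..}. INF U\<in>delta_covers \<delta> A. \<Sum>i. ennreal (diam_power s (U i)))"

definition hausdorff_dim :: "'a::metric_space set \<Rightarrow> ereal" where
  "hausdorff_dim A = Inf (ereal ` {s. 0 \<le> s \<and> hausdorff_measure s A = 0})"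

section \<open>The real Hilbert space of square integrable functions\<close>

text \<open>Elements are represented by functions rather than by classes modulo null sets. Sets satisfying
  \<open>L2_closed_subspace\<close> are automatically stable under almost everywhere equality of members of
  \<open>L2\<close>.\<close>

definition L2 :: "(real^'n \<Rightarrow> real) set" where
  "L2 = {f \<in> borel_measurable lborel. integrable lborel (\<lambda>x. (f x)\<^sup>2)}"

definition L2_inner :: "(real^'n \<Rightarrow> real) \<Rightarrow> (real^'n \<Rightarrow> real) \<Rightarrow> real" where
  "L2_inner f g = (LINT x|lborel. f x * g x)"

definition L2_norm :: "(real^'n \<Rightarrow> real) \<Rightarrow> real" where
  "L2_norm f = sqrt (L2_inner f f)"

definition L2_closed_subspace :: "(real^'n \<Rightarrow> real) set \<Rightarrow> bool" where
  "L2_closed_subspace V \<longleftrightarrow>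
     V \<subseteq> L2 \<and> (\<lambda>_. 0) \<in> V \<and>
     (\<forall>f\<in>V. \<forall>g\<in>V. (\<lambda>x. f x + g x) \<in> V) \<and>
     (\<forall>c. \<forall>f\<in>V. (\<lambda>x. c * f x) \<in> V) \<and>
     (\<forall>F. \<forall>f\<in>L2. (\<forall>n::nat. F n \<in> V) \<longrightarrow> (\<lambda>n. L2_norm (\<lambda>x. F n x - f x)) \<longlonglongrightarrow> 0 \<longrightarrow> f \<in> V)"

definition total_in :: "(real^'n \<Rightarrow> real) set \<Rightarrow> 'i set \<Rightarrow> ('i \<Rightarrow> real^'n \<Rightarrow> real) \<Rightarrow> bool" where
  "total_in V I u \<longleftrightarrow>
     (\<forall>i\<in>I. u i \<in> V) \<and>
     (\<forall>f\<in>V. \<forall>\<epsilon>>0. \<exists>F c. finite F \<and> F \<subseteq> I \<and> L2_norm (\<lambda>x. f x - (\<Sum>i\<in>F. c i * u i x)) < \<epsilon>)"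

definition orthonormal_basis_of ::
    "(real^'n \<Rightarrow> real) set \<Rightarrow> 'i set \<Rightarrow> ('i \<Rightarrow> real^'n \<Rightarrow> real) \<Rightarrow> bool" where
  "orthonormal_basis_of V I u \<longleftrightarrow>
     total_in V I u \<and> (\<forall>i\<in>I. \<forall>j\<in>I. L2_inner (u i) (u j) = (if i = j then 1 else 0))"

definition riesz_basis_of ::
    "(real^'n \<Rightarrow> real) set \<Rightarrow> 'i set \<Rightarrow> ('i \<Rightarrow> real^'n \<Rightarrow> real) \<Rightarrow> bool" where
  "riesz_basis_of V I u \<longleftrightarrow>
     total_in V I u \<and>
     (\<exists>A>0. \<exists>B. \<forall>F c. finite F \<longrightarrow> F \<subseteq> I \<longrightarrow>
        A * (\<Sum>i\<in>F. (c i)\<^sup>2) \<le> (L2_norm (\<lambda>x. \<Sum>i\<in>F. c i * u i x))\<^sup>2 \<and>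
        (L2_norm (\<lambda>x. \<Sum>i\<in>F. c i * u i x))\<^sup>2 \<le> B * (\<Sum>i\<in>F. (c i)\<^sup>2))"

section \<open>Regular wavelet bases\<close>

definition real_vec :: "int^'n \<Rightarrow> real^'n" where
  "real_vec k = (\<chi> i. real_of_int (k $ i))"

definition wavelet_types :: "(int^'n) set" where
  "wavelet_types = {e. \<forall>i. e $ i \<in> {0, 1}} - {0}"

text \<open>\<open>D \<alpha>\<close> is the partial derivative of \<open>f\<close> with multi-index \<open>\<alpha>\<close>.\<close>

definition regular :: "nat \<Rightarrow> (real^'n \<Rightarrow> real) \<Rightarrow> bool" where
  "regular r f \<longleftrightarrow>
     (\<exists>D :: ('n \<Rightarrow> nat) \<Rightarrow> real^'n \<Rightarrow> real.
        D (\<lambda>_. 0) = f \<and>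
        (\<forall>\<alpha> i x. (\<Sum>l\<in>UNIV. \<alpha> l) < r \<longrightarrow>
           ((\<lambda>t. D \<alpha> (x + t *\<^sub>R axis i 1)) has_real_derivative D (\<alpha>(i := Suc (\<alpha> i))) x) (at 0)) \<and>
        (\<forall>\<alpha>. (\<Sum>l\<in>UNIV. \<alpha> l) \<le> r \<longrightarrow>
           (\<forall>m::nat. \<exists>C. \<forall>x. \<bar>D \<alpha> x\<bar> \<le> C / (1 + norm x) ^ m)))"

text \<open>Meyer's multiresolution approximations; the Riesz basis of \<open>V 0\<close> is required to be generated
  by a function of the prescribed regularity.\<close>

definition regular_multiresolution :: "nat \<Rightarrow> (int \<Rightarrow> (real^'n \<Rightarrow> real) set) \<Rightarrow> bool" where
  "regular_multiresolution r V \<longleftrightarrow>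
     (\<forall>j. L2_closed_subspace (V j)) \<and>
     (\<forall>j. V j \<subseteq> V (j + 1)) \<and>
     (\<Inter>j. V j) = {f \<in> L2. AE x in lborel. f x = 0} \<and>
     (\<forall>f\<in>L2. \<forall>\<epsilon>>0. \<exists>j. \<exists>g\<in>V j. L2_norm (\<lambda>x. f x - g x) < \<epsilon>) \<and>
     (\<forall>j f. f \<in> V j \<longleftrightarrow> (\<lambda>x. f (2 *\<^sub>R x)) \<in> V (j + 1)) \<and>
     (\<forall>k f. f \<in> V 0 \<longleftrightarrow> (\<lambda>x. f (x - real_vec k)) \<in> V 0) \<and>
     (\<exists>g. regular r g \<and> riesz_basis_of (V 0) UNIV (\<lambda>k x. g (x - real_vec k)))"

definition wavelet ::
    "(int^'n \<Rightarrow> real^'n \<Rightarrow> real) \<Rightarrow> int \<Rightarrow> int^'n \<Rightarrow> int^'n \<Rightarrow> real^'n \<Rightarrow> real" where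
  "wavelet \<psi> j k e x =
     2 powr (real CARD('n) * real_of_int j / 2) * \<psi> e (2 powr real_of_int j *\<^sub>R x - real_vec k)"

definition regular_orthonormal_wavelet_basis ::
    "nat \<Rightarrow> (int^'n \<Rightarrow> real^'n \<Rightarrow> real) \<Rightarrow> bool" where
  "regular_orthonormal_wavelet_basis r \<psi> \<longleftrightarrow>
     orthonormal_basis_of L2 (UNIV \<times> UNIV \<times> wavelet_types) (\<lambda>(j, k, e). wavelet \<psi> j k e) \<and>
     (\<forall>e\<in>wavelet_types. regular r (\<psi> e)) \<and>
     (\<exists>V \<phi>. regular_multiresolution r V \<and>
        regular r \<phi> \<and>
        orthonormal_basis_of (V 0) UNIV (\<lambda>k x. \<phi> (x - real_vec k)) \<and>
        orthonormal_basis_of {f \<in> V 1. \<forall>g\<in>V 0. L2_inner f g = 0}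
          (UNIV \<times> wavelet_types) (\<lambda>(k, e) x. \<psi> e (x - real_vec k)))"

section \<open>The modified fractional integral\<close>

definition riesz_kernel :: "real \<Rightarrow> real^'n \<Rightarrow> real" where
  "riesz_kernel \<gamma> x =
     (let d = real CARD('n);
          C = pi powr (d / 2) * 2 powr \<gamma> * Gamma (\<gamma> / 2) / Gamma (d / 2 - \<gamma> / 2)
      in 1 / C * norm x powr (- (d - \<gamma>)))"

definition modified_kernel :: "real \<Rightarrow> real^'n \<Rightarrow> real^'n \<Rightarrow> real" where
  "modified_kernel \<gamma> x y = riesz_kernel \<gamma> (x - y) - riesz_kernel \<gamma> y"

definition modified_kernel_fourier :: "real \<Rightarrow> real^'n \<Rightarrow> real^'n \<Rightarrow> complex" where
  "modified_kernel_fourier \<gamma> x \<xi> =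
     of_real ((2 * pi) powr (- \<gamma>)) * (cis (- 2 * pi * (\<xi> \<bullet> x)) - 1) / of_real (norm \<xi> powr \<gamma>)"

definition inverse_fourier :: "(real^'n \<Rightarrow> real) \<Rightarrow> real^'n \<Rightarrow> complex" where
  "inverse_fourier f \<xi> = (CLINT y|lborel. of_real (f y) * cis (2 * pi * (\<xi> \<bullet> y)))"

text \<open>For \<open>\<gamma> = d\<close> the constant of the Riesz kernel has a pole of \<open>Gamma\<close> in its denominator. The
  kernel \<open>T\<close> is then the tempered distribution with the above Fourier transform \<open>m\<close>, and its pairing
  with \<open>f\<close> is \<open>T(f) = \<integral> m(\<xi>) F\<^bsup>-1\<^esup>f(\<xi>) d\<xi>\<close>, by the definition of the Fourier transform of a
  distribution. This number is real for real \<open>f\<close>, because \<open>m(-\<xi>)\<close> is the conjugate of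
  \<open>m(\<xi>)\<close>.\<close>

definition fractional_integral :: "real \<Rightarrow> (real^'n \<Rightarrow> real) \<Rightarrow> real^'n \<Rightarrow> real" where
  "fractional_integral \<gamma> f x =
     (if \<gamma> = real CARD('n)
      then Re (CLINT \<xi>|lborel. modified_kernel_fourier \<gamma> x \<xi> * inverse_fourier f \<xi>)
      else (LINT y|lborel. modified_kernel \<gamma> x y * f y))"

section \<open>Stable variables and the random series\<close>

definition symmetric_stable :: "'w measure \<Rightarrow> real \<Rightarrow> real \<Rightarrow> ('w \<Rightarrow> real) \<Rightarrow> bool" where
  "symmetric_stable M p \<sigma> X \<longleftrightarrow>
     0 < p \<and> p \<le> 2 \<and> 0 < \<sigma> \<and> X \<in> borel_measurable M \<and>
     (\<forall>\<xi>. (CLINT \<omega>|M. iexp (\<xi> * X \<omega>)) = of_real (exp (- (\<sigma> powr p * \<bar>\<xi>\<bar> powr p))))"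

definition wavelet_partial_sum ::
    "real \<Rightarrow> (int^'n \<Rightarrow> real^'n \<Rightarrow> real) \<Rightarrow> (int \<Rightarrow> int^'n \<Rightarrow> int^'n \<Rightarrow> 'w \<Rightarrow> real) \<Rightarrow>
      nat \<Rightarrow> nat \<Rightarrow> real^'n \<Rightarrow> 'w \<Rightarrow> real" where
  "wavelet_partial_sum \<gamma> \<psi> \<eta> N K x \<omega> =
     (\<Sum>j | \<bar>j\<bar> \<le> int N. \<Sum>k | norm (real_vec k) \<le> real K. \<Sum>e\<in>wavelet_types.
        \<eta> j k e \<omega> * fractional_integral \<gamma> (wavelet \<psi> j k e) x)"

end

(* Let d be the dimension and h = gamma - d/2, so that 0 <= h <= 1 and the bound to prove is d + 1 - h.

   For 0 < h < 1 the increment Y x - Y y is symmetric p-stable with scale a multiple of the l^p norm of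
   the wavelet coefficients of the kernel difference k(x - .) - k(y - .). Since p <= 2 this norm is at
   least the l^2 norm, which by completeness of the wavelets is the L2 norm of the kernel difference,
   and homogeneity bounds that below by a multiple of |x - y|^h. The resulting decay of the
   characteristic function bounds the small ball probabilities of Y x - Y y, so the expected t-energy
   of Lebesgue measure lifted to the graph is finite for 1 < t < d + 1 - h.

   For h = 1 the bound is d and follows by projecting the graph to the domain. For h = 0 the hypotheses are
   contradictory: a convergent Gaussian series has square summable coefficients for every x, but
   averages of the kernel over sets shrinking to a point have unbounded L2 norm, because |z|^(-d/2) is
   not square integrable at 0. For gamma = d (hence d = 1) the kernel is logarithmic, by Frullani's integral. *)
theory Submission
  imports Defs
begin

section \<open>Integrals of radial powers\<close>

text \<open>The hypothesis p \<ge> 1 serves to replace exp(-y^p) by a multiple of exp(-y): every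
  stable law is treated like a Cauchy law, whose characteristic function is integrable, and a
  Gaussian test function turns this integrability into a small ball bound that needs no density. An
  energy of order t > 1 then gains one power of the distance: the expected energy kernel is of order
  |x - y|^(1 - t - h), which is locally integrable exactly when t < d + 1 - h.

  In the critical case the bound on the sums of squares depends on the point x, and the kernel
  difference of two points is not in L2. Covering the unit ball by countably many sublevel sets
  makes the bound uniform on a set of positive measure; averages over small pieces of that set,
  minus the average over all of it, are L2 functions to which Parseval applies.

  At gamma = d the integral is defined on the frequency side. Absolute convergence there needs one
  integration by parts, for which r > gamma = 1 provides a continuous derivative.\<close>

lemma dyadic_scale_exists:
  fixes a D :: real
  assumes "0 < a" "a \<le> D"
  obtains i :: nat where "2 ^ i * a \<le> D" "D < 2 ^ Suc i * a"
proof -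
  have "\<exists>n. D < 2 ^ n * a"
    using real_arch_pow[of 2 "D / a"] assms by (auto simp: field_simps)
  define n where "n = (LEAST n. D < 2 ^ n * a)"
  have n: "D < 2 ^ n * a"
    unfolding n_def by (rule LeastI_ex) fact
  then have "n \<noteq> 0" using assms by (intro notI) simp
  then obtain i where i: "n = Suc i" by (cases n) auto
  then have "2 ^ i * a \<le> D"
    using not_less_Least[of i "\<lambda>n. D < 2 ^ n * a"] n_def by auto
  with n i show ?thesis by (intro that) auto
qed

lemma ball_in_sets_borel [measurable]: "ball c r \<in> sets borel"
  by simp

lemma nn_integral_affine:
  fixes f :: "'a::euclidean_space \<Rightarrow> ennreal"
  assumes [measurable]: "f \<in> borel_measurable borel" and c: "c \<noteq> 0"
  shows "(\<integral>\<^sup>+x. f x \<partial>lborel) = ennreal (\<bar>c\<bar> ^ DIM('a)) * (\<integral>\<^sup>+x. f (t + c *\<^sub>R x) \<partial>lborel)"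
  by (subst lborel_affine[OF c, of t])
     (simp add: nn_integral_density nn_integral_distr nn_integral_cmult ennreal_power)

lemma nn_integral_reflect:
  fixes f :: "'a::euclidean_space \<Rightarrow> ennreal"
  assumes "f \<in> borel_measurable borel"
  shows "(\<integral>\<^sup>+x. f (v - x) \<partial>lborel) = (\<integral>\<^sup>+x. f x \<partial>lborel)"
  using nn_integral_affine[OF assms, of "-1" v] by simp

text \<open>Shared skeleton for integrability near 0 and near infinity. Balls instead of annuli
  suffice as a majorant because the geometric decay absorbs their overlap; the origin is exempt
  because no dyadic shell reaches it.\<close>

lemma nn_integral_geometric_shells_finite:
  fixes f :: "'a::euclidean_space \<Rightarrow> ennreal" and q C :: real
  assumes q: "0 \<le> q" "q < 1" and C: "0 \<le> C"
    and r: "\<And>i. 0 \<le> r i" and w: "\<And>i. 0 \<le> w i"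
    and bound: "\<And>i. w i * r i ^ DIM('a) \<le> C * q ^ i"
    and f: "\<And>z. z \<noteq> 0 \<Longrightarrow> f z \<le> (\<Sum>i. ennreal (w i) * indicator (ball 0 (r i)) z)"
  shows "(\<integral>\<^sup>+z. f z \<partial>lborel) < \<infinity>"
proof -
  let ?v = "unit_ball_vol (real DIM('a))"
  have "AE z::'a in lborel. z \<noteq> 0"
    by (simp add: AE_lborel_singleton)
  then have "AE z in lborel. f z \<le> (\<Sum>i. ennreal (w i) * indicator (ball 0 (r i)) z)"
    by (rule eventually_mono) (rule f)
  then have "(\<integral>\<^sup>+z. f z \<partial>lborel) \<le> (\<integral>\<^sup>+z. (\<Sum>i. ennreal (w i) * indicator (ball 0 (r i)) z) \<partial>(lborel :: 'a measure))"
    by (rule nn_integral_mono_AE)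
  also have "\<dots> = (\<Sum>i. \<integral>\<^sup>+z. ennreal (w i) * indicator (ball 0 (r i)) z \<partial>(lborel :: 'a measure))"
    by (rule nn_integral_suminf) measurable
  also have "\<dots> = (\<Sum>i. ennreal (w i * (?v * r i ^ DIM('a))))"
    by (simp add: nn_integral_cmult_indicator emeasure_ball r w ennreal_mult)
  also have "\<dots> \<le> (\<Sum>i. ennreal (?v * C * q ^ i))"
  proof (intro suminf_le ennreal_leI)
    fix i
    have "?v * (w i * r i ^ DIM('a)) \<le> ?v * (C * q ^ i)"
      by (intro mult_left_mono bound) auto
    then show "w i * (?v * r i ^ DIM('a)) \<le> ?v * C * q ^ i"
      by (simp add: algebra_simps)
  qed auto
  also have "\<dots> = ennreal (\<Sum>i. ?v * C * q ^ i)"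
    using q C by (intro suminf_ennreal2 summable_mult summable_geometric) auto
  also have "\<dots> < \<infinity>"
    by simp
  finally show ?thesis .
qed

lemma indicator_le_suminf_ennreal:
  fixes g :: "nat \<Rightarrow> ennreal"
  assumes "x \<le> g i" shows "x \<le> (\<Sum>i. g i)"
  using assms sum_le_suminf[of g "{i}"] by (auto intro: order_trans)

lemma nn_integral_powr_ball_finite:
  fixes a R :: real
  assumes a: "0 \<le> a" "a < real DIM('a::euclidean_space)" and R: "0 < R"
  shows "(\<integral>\<^sup>+z. ennreal (norm z powr - a) * indicator (ball 0 R) z \<partial>(lborel :: 'a measure)) < \<infinity>"
proof (rule nn_integral_geometric_shells_finite)
  let ?d = "DIM('a)"
  \<comment> \<open>The ratio of consecutive shells: halving the radius multiplies the volume by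
    \<open>2 powr (- d)\<close> and the weight, which is the power taken at the inner radius, by
    \<open>2 powr a\<close>.\<close>
  show "0 \<le> 2 powr (a - real ?d)" "2 powr (a - real ?d) < 1"
    using a by (auto simp: powr_less_one)
  show "0 \<le> (R / 2) powr - a * R ^ ?d" using R by simp
  show "0 \<le> R * (1/2) ^ i" for i :: nat using R by simp
  show "0 \<le> (R * (1/2) ^ Suc i) powr - a" for i :: nat by simp
  show "(R * (1/2) ^ Suc i) powr - a * (R * (1/2) ^ i) ^ ?d
      \<le> (R / 2) powr - a * R ^ ?d * (2 powr (a - real ?d)) ^ i" for i
  proof -
    have "(R * (1/2) ^ Suc i) powr - a = (R/2) powr - a * ((1/2) ^ i) powr - a"
      using R by (subst powr_mult[symmetric]) (auto simp: field_simps)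
    also have "((1/2::real) ^ i) powr - a = 2 powr (a * real i)"
      by (simp add: powr_realpow[symmetric] powr_powr powr_divide powr_minus field_simps)
    finally have 1: "(R * (1/2) ^ Suc i) powr - a = (R/2) powr - a * 2 powr (a * real i)" .
    have 2: "(R * (1/2) ^ i) ^ ?d = R ^ ?d * 2 powr (- real ?d * real i)"
      by (simp add: power_mult_distrib powr_realpow[symmetric] powr_powr powr_divide powr_minus field_simps
            flip: power_mult)
    have 3: "(2 powr (a - real ?d)) ^ i = 2 powr (a * real i) * 2 powr (- real ?d * real i)"
      by (simp add: powr_realpow[symmetric] powr_powr powr_add[symmetric] algebra_simps)
    show ?thesis unfolding 1 2 3 by simp
  qed
  fix z :: 'a assume z: "z \<noteq> 0"
  show "ennreal (norm z powr - a) * indicator (ball 0 R) z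
      \<le> (\<Sum>i. ennreal ((R * (1/2) ^ Suc i) powr - a) * indicator (ball 0 (R * (1/2) ^ i)) z)"
  proof (cases "norm z < R")
    case True
    have "\<exists>n. R * (1/2) ^ n < norm z"
      using real_arch_pow_inv[of "norm z / R" "1/2"] z R by (auto simp: field_simps)
    define n where "n = (LEAST n. R * (1/2) ^ n \<le> norm z)"
    have n: "R * (1/2) ^ n \<le> norm z"
      unfolding n_def by (rule LeastI_ex) (use \<open>\<exists>n. _\<close> in \<open>auto intro: less_imp_le\<close>)
    have "n \<noteq> 0" using n True by (intro notI) simp
    then obtain i where i: "n = Suc i" by (cases n) auto
    have "\<not> R * (1/2) ^ i \<le> norm z"
      using not_less_Least[of i "\<lambda>n. R * (1/2) ^ n \<le> norm z"] i n_def by auto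
    moreover have "norm z powr - a \<le> (R * (1/2) ^ Suc i) powr - a"
      using n i R a by (intro powr_mono2') auto
    ultimately show ?thesis
      using True by (intro indicator_le_suminf_ennreal[where i = i]) (auto intro!: ennreal_leI)
  qed auto
qed

lemma nn_integral_powr_outside_ball_finite:
  fixes a R :: real
  assumes a: "real DIM('a::euclidean_space) < a" and R: "0 < R"
  shows "(\<integral>\<^sup>+z. ennreal (norm z powr - a) * indicator (- ball 0 R) z \<partial>(lborel :: 'a measure)) < \<infinity>"
proof (rule nn_integral_geometric_shells_finite)
  let ?d = "DIM('a)"
  show "0 \<le> 2 powr (real ?d - a)" "2 powr (real ?d - a) < 1"
    using a by (auto simp: powr_less_one)
  show "0 \<le> R powr - a * (2 * R) ^ ?d" using R by simp
  show "0 \<le> 2 * R * 2 ^ i" for i :: nat using R by simp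
  show "0 \<le> (R * 2 ^ i) powr - a" for i :: nat by simp
  show "(R * 2 ^ i) powr - a * (2 * R * 2 ^ i) ^ ?d
      \<le> R powr - a * (2 * R) ^ ?d * (2 powr (real ?d - a)) ^ i" for i
  proof -
    have 1: "(R * 2 ^ i) powr - a = R powr - a * 2 powr (- a * real i)"
      using R by (simp add: powr_mult powr_realpow[symmetric] powr_powr algebra_simps)
    have 2: "(2 * R * 2 ^ i) ^ ?d = (2 * R) ^ ?d * 2 powr (real ?d * real i)"
      by (simp add: power_mult_distrib powr_realpow[symmetric] powr_powr algebra_simps flip: power_mult)
    have 3: "(2 powr (real ?d - a)) ^ i = 2 powr (- a * real i) * 2 powr (real ?d * real i)"
      by (simp add: powr_realpow[symmetric] powr_powr powr_add[symmetric] algebra_simps)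
    show ?thesis unfolding 1 2 3 by simp
  qed
  fix z :: 'a assume z: "z \<noteq> 0"
  show "ennreal (norm z powr - a) * indicator (- ball 0 R) z
      \<le> (\<Sum>i. ennreal ((R * 2 ^ i) powr - a) * indicator (ball 0 (2 * R * 2 ^ i)) z)"
  proof (cases "R \<le> norm z")
    case True
    obtain i where "2 ^ i * R \<le> norm z" "norm z < 2 ^ Suc i * R"
      using dyadic_scale_exists[OF R True] by blast
    then have i: "R * 2 ^ i \<le> norm z" "norm z < 2 * R * 2 ^ i"
      by (simp_all add: ac_simps)
    have "norm z powr - a \<le> (R * 2 ^ i) powr - a"
      using i R a by (intro powr_mono2') auto
    with i True show ?thesis
      by (intro indicator_le_suminf_ennreal[where i = i]) (auto intro!: ennreal_leI)
  qed auto
qed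

section \<open>Energy and Hausdorff measure\<close>

text \<open>Coverings by sets of diameter at most 1 let an energy of order \<open>t\<close> control
  every smaller order \<open>s\<close>. The case \<open>s = 0\<close> relies on the weight 1 of a
  nonempty set, and a set of diameter 0 on \<open>0 powr t = 0\<close>.\<close>

lemma powr_diameter_le_diam_power:
  fixes U :: "'a::metric_space set"
  assumes "U \<noteq> {}" "diameter U \<le> 1" "bounded U" "0 \<le> s" "s \<le> t" "0 < t"
  shows "diameter U powr t \<le> diam_power s U"
proof -
  have "0 \<le> diameter U"
    using assms by (intro diameter_ge_0) auto
  then show ?thesis
    using assms by (cases "diameter U = 0") (auto simp: diam_power_def powr_le1 intro!: powr_mono')
qed

text \<open>The energy method for the image under \<open>G\<close> of Lebesgue measure on
  \<open>B\<close>. Its potential is finite almost everywhere on \<open>B\<close>, hence at most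
  some \<open>m\<close> on a set \<open>A m\<close> of positive measure, and a covering set of
  diameter \<delta> then carries at most the mass \<open>m * \<delta> powr t\<close> of
  \<open>A m\<close>. Injectivity confines distance 0 to the diagonal, which is null; elsewhere
  \<open>0 powr (- t) = 0\<close> would hide a concentration of mass.\<close>

lemma hausdorff_measure_nonzero_if_finite_energy:
  fixes G :: "'a::euclidean_space \<Rightarrow> 'b::{metric_space, second_countable_topology}"
  assumes G [measurable]: "G \<in> borel \<rightarrow>\<^sub>M borel" and "inj G"
    and B [measurable]: "B \<in> sets borel" and pos: "emeasure lborel B \<noteq> 0"
    and energy: "(\<integral>\<^sup>+x. (\<integral>\<^sup>+y. ennreal (dist (G x) (G y) powr - t) * indicator B y \<partial>lborel)
                     * indicator B x \<partial>lborel) < \<infinity>"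
    and s: "0 \<le> s" "s \<le> t" "0 < t"
  shows "hausdorff_measure s (range G) \<noteq> 0"
proof
  assume zero: "hausdorff_measure s (range G) = 0"
  define \<phi> where "\<phi> x = (\<integral>\<^sup>+y. ennreal (dist (G x) (G y) powr - t) * indicator B y \<partial>lborel)" for x
  have [measurable]: "\<phi> \<in> borel_measurable borel"
    unfolding \<phi>_def by measurable
  define A where "A m = {x \<in> B. \<phi> x \<le> of_nat m}" for m :: nat
  have [measurable]: "A m \<in> sets borel" for m
    unfolding A_def by measurable
  obtain m where m: "emeasure lborel (A m) \<noteq> 0"
  proof (rule ccontr)
    assume "\<not> thesis"
    then have "A m \<in> null_sets lborel" for m
      using that by (auto simp: null_sets_def)
    then have "(\<Union>m. A m) \<in> null_sets lborel" by auto
    then have 1: "AE x in lborel. x \<notin> (\<Union>m. A m)"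
      by (rule AE_not_in)
    have "AE x in lborel. \<phi> x * indicator B x \<noteq> \<infinity>"
      using energy by (intro nn_integral_noteq_infinite) (auto simp: \<phi>_def)
    with 1 have "AE x in lborel. x \<notin> B"
    proof eventually_elim
      case (elim x)
      show "x \<notin> B"
      proof
        assume "x \<in> B"
        with elim have "\<phi> x \<noteq> \<infinity>" by auto
        then obtain m where "\<phi> x \<le> of_nat m"
          using ennreal_Ex_less_of_nat[of "\<phi> x"] by (auto simp: less_top intro: less_imp_le)
        with elim \<open>x \<in> B\<close> show False by (auto simp: A_def)
      qed
    qed
    then have "B \<in> null_sets lborel"
      by (subst (asm) AE_iff_null_sets[symmetric]) auto
    with pos show False by auto
  qed
  have key: "emeasure lborel (A m) \<le> of_nat m * (\<Sum>i. ennreal (diam_power s (U i)))"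
    if U: "U \<in> delta_covers 1 (range G)" for U
  proof -
    define X where "X i = {x \<in> A m. G x \<in> U i}" for i
    \<comment> \<open>The sets \<open>U i\<close> need not be measurable. The closed ball about one
      chosen point of \<open>U i\<close> with radius the diameter contains \<open>U i\<close>, and
      \<open>S i\<close> is its measurable preimage in \<open>A m\<close>.\<close>
    define S where "S i = (if X i = {} then {} else
        {y \<in> A m. dist (G (SOME x. x \<in> X i)) (G y) \<le> diameter (U i)})" for i
    have [measurable]: "S i \<in> sets borel" for i
      by (cases "X i = {}") (simp_all add: S_def)
    have sub: "A m \<subseteq> (\<Union>i. S i)"
    proof
      fix y assume y: "y \<in> A m"
      with U obtain i where i: "G y \<in> U i" by (auto simp: delta_covers_def)
      with y have ne: "X i \<noteq> {}" by (auto simp: X_def)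
      then have "(SOME x. x \<in> X i) \<in> X i" by (simp add: some_in_eq)
      then have "dist (G (SOME x. x \<in> X i)) (G y) \<le> diameter (U i)"
        using i U by (intro diameter_bounded_bound) (auto simp: X_def delta_covers_def)
      with y ne show "y \<in> (\<Union>i. S i)" by (auto simp: S_def)
    qed
    have each: "emeasure lborel (S i) \<le> of_nat m * ennreal (diam_power s (U i))" for i
    proof (cases "X i = {}")
      case False
      define x where "x = (SOME x. x \<in> X i)"
      define \<delta> where "\<delta> = diameter (U i)"
      have x: "x \<in> A m" "G x \<in> U i"
        using False some_in_eq[of "X i"] by (auto simp: x_def X_def)
      have "\<delta> powr t \<le> diam_power s (U i)"
        unfolding \<delta>_def using U x s by (intro powr_diameter_le_diam_power) (auto simp: delta_covers_def)
      have "emeasure lborel (S i) = (\<integral>\<^sup>+y. indicator (S i) y \<partial>lborel)"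
        by simp
      also have "\<dots> \<le> (\<integral>\<^sup>+y. ennreal (\<delta> powr t) * (ennreal (dist (G x) (G y) powr - t) * indicator B y) \<partial>lborel)"
      proof (rule nn_integral_mono_AE)
        have "AE y in lborel. y \<noteq> x" by (simp add: AE_lborel_singleton)
        then show "AE y in lborel. indicator (S i) y
            \<le> ennreal (\<delta> powr t) * (ennreal (dist (G x) (G y) powr - t) * indicator B y)"
        proof eventually_elim
          case (elim y)
          show ?case
          proof (cases "y \<in> S i")
            case True
            then have y: "dist (G x) (G y) \<le> \<delta>" "y \<in> B"
              using False by (auto simp: S_def x_def \<delta>_def A_def split: if_splits)
            have "0 < dist (G x) (G y)"
              using elim \<open>inj G\<close> by (auto dest: injD)
            then have "1 \<le> \<delta> powr t * dist (G x) (G y) powr - t"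
              using y s by (simp add: powr_minus field_simps powr_mono2)
            then show ?thesis
              using True y by (simp add: ennreal_mult[symmetric])
          qed auto
        qed
      qed
      also have "\<dots> = ennreal (\<delta> powr t) * \<phi> x"
        unfolding \<phi>_def by (rule nn_integral_cmult) measurable
      also have "\<dots> \<le> ennreal (diam_power s (U i)) * of_nat m"
        using x \<open>\<delta> powr t \<le> _\<close> by (intro mult_mono) (auto simp: A_def intro: ennreal_leI)
      finally show ?thesis by (simp add: mult.commute)
    qed (simp add: S_def)
    have "emeasure lborel (A m) \<le> emeasure lborel (\<Union>i. S i)"
      using sub by (intro emeasure_mono) auto
    also have "\<dots> \<le> (\<Sum>i. emeasure lborel (S i))"
      by (intro emeasure_subadditive_countably) auto
    also have "\<dots> \<le> (\<Sum>i. of_nat m * ennreal (diam_power s (U i)))"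
      by (intro suminf_le each) auto
    finally show ?thesis by simp
  qed
  have "(INF U\<in>delta_covers 1 (range G). \<Sum>i. ennreal (diam_power s (U i))) \<le> hausdorff_measure s (range G)"
    unfolding hausdorff_measure_def by (rule SUP_upper) auto
  then have inf0: "(INF U\<in>delta_covers 1 (range G). \<Sum>i. ennreal (diam_power s (U i))) = 0"
    using zero by simp
  \<comment> \<open>\<open>Suc m\<close> instead of \<open>m\<close> avoids a division by 0.\<close>
  have "emeasure lborel (A m) / of_nat (Suc m) > 0"
    using m by (simp add: ennreal_zero_less_divide zero_less_iff_neq_zero)
  then have "(INF U\<in>delta_covers 1 (range G). \<Sum>i. ennreal (diam_power s (U i)))
      < emeasure lborel (A m) / of_nat (Suc m)"
    unfolding inf0 .
  then obtain U where U: "U \<in> delta_covers 1 (range G)"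
    and less: "(\<Sum>i. ennreal (diam_power s (U i))) < emeasure lborel (A m) / of_nat (Suc m)"
    unfolding INF_less_iff by blast
  have "emeasure lborel (A m) \<le> of_nat (Suc m) * (\<Sum>i. ennreal (diam_power s (U i)))"
    by (rule order_trans[OF key[OF U]]) (intro mult_right_mono, auto)
  also have "\<dots> < of_nat (Suc m) * (emeasure lborel (A m) / of_nat (Suc m))"
    using less by (intro ennreal_mult_strict_left_mono) (auto simp: less_top[symmetric] add_pos_nonneg)
  also have "\<dots> = emeasure lborel (A m)"
    using ennreal_mult_divide_eq[of "of_nat (Suc m)" "emeasure lborel (A m)"]
    by (simp add: ennreal_times_divide mult.commute del: of_nat_Suc)
  finally show False by simp
qed

lemma hausdorff_dim_ge:
  assumes "\<And>s. 0 \<le> s \<Longrightarrow> s < \<beta> \<Longrightarrow> hausdorff_measure s A \<noteq> 0"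
  shows "ereal \<beta> \<le> hausdorff_dim A"
  unfolding hausdorff_dim_def using assms by (force intro!: Inf_greatest)

section \<open>Parseval lower bound\<close>

lemma L2_imp_measurable [measurable_dest]: "f \<in> L2 \<Longrightarrow> f \<in> borel_measurable borel"
  by (simp add: L2_def)

lemma L2_imp_integrable_mult:
  assumes "f \<in> L2" "g \<in> L2"
  shows "integrable lborel (\<lambda>x. f x * g x)"
proof (rule Bochner_Integration.integrable_bound)
  show "integrable lborel (\<lambda>x. (f x)\<^sup>2 + (g x)\<^sup>2)"
    using assms by (auto simp: L2_def)
  show "(\<lambda>x. f x * g x) \<in> borel_measurable lborel"
    using assms by (auto simp: L2_def)
  have "\<bar>f x * g x\<bar> \<le> (f x)\<^sup>2 + (g x)\<^sup>2" for x
  proof -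
    have "0 \<le> (\<bar>f x\<bar> - \<bar>g x\<bar>)\<^sup>2"
      by simp
    then have "2 * (\<bar>f x\<bar> * \<bar>g x\<bar>) \<le> (f x)\<^sup>2 + (g x)\<^sup>2"
      by (simp add: power2_diff algebra_simps)
    moreover have "0 \<le> \<bar>f x\<bar> * \<bar>g x\<bar>"
      by simp
    ultimately show ?thesis
      unfolding abs_mult by linarith
  qed
  then show "AE x in lborel. norm (f x * g x) \<le> norm ((f x)\<^sup>2 + (g x)\<^sup>2)"
    by auto
qed

text \<open>\<open>total_in\<close> only supplies some combination close to \<open>f\<close>.
  Completing the square shows that its squared error is the energy missed by the coefficients on
  \<open>F\<close> plus a nonnegative term, whatever the \<open>c i\<close> are.\<close>

lemma parseval_lower_bound:
  fixes u :: "'i \<Rightarrow> real^'n \<Rightarrow> real"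
  assumes basis: "orthonormal_basis_of L2 I u" and f: "f \<in> L2" and \<epsilon>: "0 < \<epsilon>"
  obtains F where "finite F" "F \<subseteq> I" "L2_inner f f - \<epsilon> < (\<Sum>i\<in>F. (L2_inner f (u i))\<^sup>2)"
proof -
  have u: "u i \<in> L2" if "i \<in> I" for i
    using basis that by (auto simp: orthonormal_basis_of_def total_in_def)
  have ortho: "L2_inner (u i) (u j) = (if i = j then 1 else 0)" if "i \<in> I" "j \<in> I" for i j
    using basis that by (auto simp: orthonormal_basis_of_def)
  obtain F c where F: "finite F" "F \<subseteq> I"
    and less: "L2_norm (\<lambda>x. f x - (\<Sum>i\<in>F. c i * u i x)) < sqrt \<epsilon>"
    using basis f \<epsilon> unfolding orthonormal_basis_of_def total_in_def
    by (meson real_sqrt_gt_zero)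
  let ?s = "\<lambda>x. \<Sum>i\<in>F. c i * u i x"
  let ?b = "\<lambda>i. L2_inner f (u i)"
  have iff: "integrable lborel (\<lambda>x. f x * f x)"
    by (intro L2_imp_integrable_mult f)
  have ifu: "integrable lborel (\<lambda>x. c i * (f x * u i x))" if "i \<in> F" for i
    using that F f u by (intro integrable_mult_right L2_imp_integrable_mult) auto
  have iuu: "integrable lborel (\<lambda>x. c i * c j * (u i x * u j x))" if "i \<in> F" "j \<in> F" for i j
    using that F u by (intro integrable_mult_right L2_imp_integrable_mult) auto
  have "L2_inner (\<lambda>x. f x - ?s x) (\<lambda>x. f x - ?s x)
      = (LINT x|lborel. f x * f x - 2 * (\<Sum>i\<in>F. c i * (f x * u i x))
          + (\<Sum>i\<in>F. \<Sum>j\<in>F. c i * c j * (u i x * u j x)))"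
    unfolding L2_inner_def
  proof (rule Bochner_Integration.integral_cong[OF refl])
    fix x
    have 1: "?s x * ?s x = (\<Sum>i\<in>F. \<Sum>j\<in>F. c i * c j * (u i x * u j x))"
      by (simp add: sum_product algebra_simps)
    have 2: "f x * ?s x = (\<Sum>i\<in>F. c i * (f x * u i x))"
      by (simp add: sum_distrib_left algebra_simps)
    show "(f x - ?s x) * (f x - ?s x) = f x * f x - 2 * (\<Sum>i\<in>F. c i * (f x * u i x))
          + (\<Sum>i\<in>F. \<Sum>j\<in>F. c i * c j * (u i x * u j x))"
      unfolding 1[symmetric] 2[symmetric] by (simp add: algebra_simps)
  qed
  also have "\<dots> = L2_inner f f - 2 * (\<Sum>i\<in>F. c i * ?b i) + (\<Sum>i\<in>F. \<Sum>j\<in>F. c i * c j * L2_inner (u i) (u j))"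
    using iff ifu iuu unfolding L2_inner_def by simp
  also have "(\<Sum>i\<in>F. \<Sum>j\<in>F. c i * c j * L2_inner (u i) (u j)) = (\<Sum>i\<in>F. (c i)\<^sup>2)"
    using F ortho by (intro sum.cong refl)
      (auto simp: subset_iff sum.delta power2_eq_square if_distrib[of "\<lambda>x. _ * x"] cong: if_cong)
  also have "L2_inner f f - 2 * (\<Sum>i\<in>F. c i * ?b i) + (\<Sum>i\<in>F. (c i)\<^sup>2)
      = L2_inner f f - (\<Sum>i\<in>F. (?b i)\<^sup>2) + (\<Sum>i\<in>F. (c i - ?b i)\<^sup>2)"
    by (simp add: power2_diff sum.distrib sum_subtractf sum_distrib_left algebra_simps)
  finally have eq: "L2_inner (\<lambda>x. f x - ?s x) (\<lambda>x. f x - ?s x)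
      = L2_inner f f - (\<Sum>i\<in>F. (?b i)\<^sup>2) + (\<Sum>i\<in>F. (c i - ?b i)\<^sup>2)" .
  have "L2_inner (\<lambda>x. f x - ?s x) (\<lambda>x. f x - ?s x) < \<epsilon>"
    using less \<epsilon> by (simp add: L2_norm_def)
  moreover have "0 \<le> (\<Sum>i\<in>F. (c i - ?b i)\<^sup>2)"
    by (intro sum_nonneg) auto
  ultimately have "L2_inner f f - \<epsilon> < (\<Sum>i\<in>F. (?b i)\<^sup>2)"
    using eq by linarith
  with F show ?thesis by (intro that)
qed

text \<open>After division by the sum of squares every term lies in [0, 1], where lowering the
  exponent from 1 to \<open>p / 2\<close> can only increase it; the normalised terms sum to
  1.\<close>

lemma sum_squares_powr_le_sum_abs_powr:
  fixes a :: "'i \<Rightarrow> real"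
  assumes "finite F" "0 < p" "p \<le> 2"
  shows "(\<Sum>i\<in>F. (a i)\<^sup>2) powr (p / 2) \<le> (\<Sum>i\<in>F. \<bar>a i\<bar> powr p)"
proof (cases "(\<Sum>i\<in>F. (a i)\<^sup>2) = 0")
  case False
  define S where "S = (\<Sum>i\<in>F. (a i)\<^sup>2)"
  have S: "0 < S"
    using False sum_nonneg[of F "\<lambda>i. (a i)\<^sup>2"] unfolding S_def by simp
  have le: "(a i)\<^sup>2 / S \<le> \<bar>a i\<bar> powr p / S powr (p / 2)" if "i \<in> F" for i
  proof (cases "a i = 0")
    case False
    have "(a i)\<^sup>2 \<le> S"
      unfolding S_def using that assms by (intro member_le_sum) auto
    then have "((a i)\<^sup>2 / S) powr 1 \<le> ((a i)\<^sup>2 / S) powr (p / 2)"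
      using S assms False by (intro powr_mono') auto
    also have "(a i)\<^sup>2 = \<bar>a i\<bar> powr 2"
      using False by simp
    also have "(\<bar>a i\<bar> powr 2 / S) powr (p / 2) = \<bar>a i\<bar> powr p / S powr (p / 2)"
      using S by (subst powr_divide) (simp_all add: powr_powr del: powr_numeral)
    finally show ?thesis using S False by simp
  qed auto
  have "1 = (\<Sum>i\<in>F. (a i)\<^sup>2 / S)"
    using S by (simp add: S_def sum_divide_distrib[symmetric])
  also have "\<dots> \<le> (\<Sum>i\<in>F. \<bar>a i\<bar> powr p / S powr (p / 2))"
    by (intro sum_mono le)
  finally show ?thesis
    using S by (simp add: S_def[symmetric] sum_divide_distrib[symmetric] field_simps)
qed (auto intro: sum_nonneg)

section \<open>Stable random series\<close>

lemma nn_integral_exp_abs_le: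
  fixes a :: real
  assumes "0 < a"
  shows "(\<integral>\<^sup>+\<xi>. ennreal (exp (- (a * \<bar>\<xi>\<bar>))) \<partial>lborel) \<le> ennreal (2 / a)"
proof -
  let ?e = "exponential_density a"
  interpret prob_space "density lborel ?e"
    using assms by (rule prob_space_exponential_density)
  have 1: "(\<integral>\<^sup>+\<xi>. ennreal (?e \<xi>) \<partial>lborel) = 1"
    using emeasure_space_1 by (simp add: emeasure_density)
  have 2: "(\<integral>\<^sup>+\<xi>. ennreal (?e (- \<xi>)) \<partial>lborel) = 1"
    using nn_integral_real_affine[of "\<lambda>x. ennreal (?e x)" "-1" 0] 1 by simp
  have "(\<integral>\<^sup>+\<xi>. ennreal (exp (- (a * \<bar>\<xi>\<bar>))) \<partial>lborel)
      \<le> (\<integral>\<^sup>+\<xi>. ennreal (1 / a) * (ennreal (?e \<xi>) + ennreal (?e (- \<xi>))) \<partial>lborel)"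
  proof (rule nn_integral_mono)
    fix \<xi> :: real
    have "exp (- (a * \<bar>\<xi>\<bar>)) \<le> 1 / a * (?e \<xi> + ?e (- \<xi>))"
      using assms by (auto simp: exponential_density_def algebra_simps abs_if)
    also have "ennreal \<dots> = ennreal (1 / a) * (ennreal (?e \<xi>) + ennreal (?e (- \<xi>)))"
      using assms by (simp add: ennreal_mult[symmetric] ennreal_plus[symmetric] exponential_density_nonneg del: ennreal_plus)
    finally show "ennreal (exp (- (a * \<bar>\<xi>\<bar>))) \<le> ennreal (1 / a) * (ennreal (?e \<xi>) + ennreal (?e (- \<xi>)))"
      by (simp add: ennreal_leI)
  qed
  also have "\<dots> = ennreal (1 / a) * (1 + 1)"
    by (simp add: nn_integral_cmult nn_integral_add 1 2)
  also have "\<dots> = ennreal (2 / a)"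
    using assms by (simp add: ennreal_mult[symmetric] flip: ennreal_numeral)
  finally show ?thesis .
qed

section \<open>Small ball estimates from decay of the characteristic function\<close>

context prob_space
begin

text \<open>A smooth substitute for the probability of
  \<open>\<bar>X\<bar> \<le> \<epsilon>\<close>. The Gaussian is the characteristic function of a
  standard normal variable at \<open>X \<omega> / \<epsilon>\<close>; exchanging the two
  expectations averages the characteristic function of \<open>X\<close> at
  \<open>\<xi> / \<epsilon>\<close>, and its decay yields the factor
  \<open>\<epsilon> / c\<close>.\<close>

lemma expectation_gaussian_le:
  assumes [measurable]: "X \<in> borel_measurable M" and c: "0 < c" and \<epsilon>: "0 < \<epsilon>"
    and char: "\<And>\<xi>. cmod (CLINT \<omega>|M. iexp (\<xi> * X \<omega>)) \<le> exp 1 * exp (- (c * \<bar>\<xi>\<bar>))"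
  shows "(\<integral>\<^sup>+\<omega>. ennreal (exp (- (X \<omega> / \<epsilon>)\<^sup>2 / 2)) \<partial>M) \<le> ennreal (2 * exp 1 * \<epsilon> / c)"
proof -
  let ?N = "std_normal_distribution"
  interpret N: real_distribution ?N by (rule real_dist_normal_dist)
  interpret P: pair_prob_space M ?N ..
  have char_normal: "complex_of_real (exp (- t\<^sup>2 / 2)) = (CLINT \<xi>|?N. iexp (t * \<xi>))" for t
    using char_std_normal_distribution by (simp add: char_def fun_eq_iff)
  have int: "integrable (M \<Otimes>\<^sub>M ?N) (\<lambda>(\<omega>, \<xi>). iexp (X \<omega> / \<epsilon> * \<xi>))"
    by (rule P.integrable_const_bound[where B = 1]) (auto simp: split_beta)
  have intE: "integrable M (\<lambda>\<omega>. exp (- (X \<omega> / \<epsilon>)\<^sup>2 / 2))"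
    by (rule integrable_const_bound[where B = 1]) auto
  have "complex_of_real (LINT \<omega>|M. exp (- (X \<omega> / \<epsilon>)\<^sup>2 / 2))
      = (CLINT \<omega>|M. (CLINT \<xi>|?N. iexp (X \<omega> / \<epsilon> * \<xi>)))"
    unfolding integral_complex_of_real[symmetric] char_normal ..
  also have "\<dots> = (CLINT \<xi>|?N. (CLINT \<omega>|M. iexp (X \<omega> / \<epsilon> * \<xi>)))"
    by (rule P.Fubini_integral[symmetric]) (use int in simp)
  also have "\<dots> = (CLINT \<xi>|?N. (CLINT \<omega>|M. iexp ((\<xi> / \<epsilon>) * X \<omega>)))"
    by (simp add: field_simps)
  finally have eq: "complex_of_real (LINT \<omega>|M. exp (- (X \<omega> / \<epsilon>)\<^sup>2 / 2))
      = (CLINT \<xi>|?N. (CLINT \<omega>|M. iexp ((\<xi> / \<epsilon>) * X \<omega>)))" .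
  have "(\<integral>\<^sup>+\<omega>. ennreal (exp (- (X \<omega> / \<epsilon>)\<^sup>2 / 2)) \<partial>M)
      = ennreal (LINT \<omega>|M. exp (- (X \<omega> / \<epsilon>)\<^sup>2 / 2))"
    using intE by (intro nn_integral_eq_integral) auto
  also have "\<dots> \<le> ennreal (cmod (complex_of_real (LINT \<omega>|M. exp (- (X \<omega> / \<epsilon>)\<^sup>2 / 2))))"
    by (intro ennreal_leI) simp
  also have "\<dots> \<le> (\<integral>\<^sup>+\<xi>. ennreal (cmod (CLINT \<omega>|M. iexp ((\<xi> / \<epsilon>) * X \<omega>))) \<partial>?N)"
    unfolding eq by (rule integral_norm_bound_ennreal) (use P.integrable_snd[OF int] in \<open>simp add: field_simps\<close>)
  also have "\<dots> \<le> (\<integral>\<^sup>+\<xi>. ennreal (exp 1 * exp (- (c / \<epsilon> * \<bar>\<xi>\<bar>))) \<partial>?N)"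
    using char[of "\<xi> / \<epsilon>" for \<xi>] \<epsilon> by (intro nn_integral_mono ennreal_leI) (auto simp: abs_divide)
  also have "\<dots> = (\<integral>\<^sup>+\<xi>. ennreal (std_normal_density \<xi>) * ennreal (exp 1 * exp (- (c / \<epsilon> * \<bar>\<xi>\<bar>))) \<partial>lborel)"
    by (subst nn_integral_density) auto
  also have "\<dots> \<le> (\<integral>\<^sup>+\<xi>. ennreal (exp 1) * ennreal (exp (- (c / \<epsilon> * \<bar>\<xi>\<bar>))) \<partial>lborel)"
  proof (rule nn_integral_mono)
    fix \<xi> :: real
    have "1 \<le> sqrt (2 * pi)" using pi_gt3 by (simp add: real_le_rsqrt)
    moreover have "exp (- \<xi>\<^sup>2 / 2) \<le> 1" by simp
    ultimately have "exp (- \<xi>\<^sup>2 / 2) \<le> sqrt (2 * pi)" by linarith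
    then have "std_normal_density \<xi> \<le> 1"
      unfolding std_normal_density_def by (simp add: divide_le_eq_1)
    then have "std_normal_density \<xi> * (exp 1 * exp (- (c / \<epsilon> * \<bar>\<xi>\<bar>))) \<le> 1 * (exp 1 * exp (- (c / \<epsilon> * \<bar>\<xi>\<bar>)))"
      by (intro mult_right_mono) auto
    then show "ennreal (std_normal_density \<xi>) * ennreal (exp 1 * exp (- (c / \<epsilon> * \<bar>\<xi>\<bar>)))
        \<le> ennreal (exp 1) * ennreal (exp (- (c / \<epsilon> * \<bar>\<xi>\<bar>)))"
      by (simp add: ennreal_mult[symmetric] ennreal_leI)
  qed
  also have "\<dots> = ennreal (exp 1) * (\<integral>\<^sup>+\<xi>. ennreal (exp (- (c / \<epsilon> * \<bar>\<xi>\<bar>))) \<partial>lborel)"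
    by (rule nn_integral_cmult) auto
  also have "\<dots> \<le> ennreal (exp 1) * ennreal (2 / (c / \<epsilon>))"
    using c \<epsilon> by (intro mult_left_mono nn_integral_exp_abs_le) auto
  also have "\<dots> = ennreal (2 * exp 1 * \<epsilon> / c)"
    using c \<epsilon> by (simp add: ennreal_mult[symmetric] field_simps)
  finally show ?thesis .
qed

text \<open>Meant for \<open>D\<close> the distance of two graph points, \<open>a\<close> their
  horizontal distance and \<open>X\<close> the increment. On the event that \<open>D\<close> is
  about \<open>2 ^ i * a\<close> the increment is at most of that size, which has probability of
  order \<open>2 ^ i * a / c\<close>; weighted by \<open>(2 ^ i * a) powr (- t)\<close> these
  contributions form a geometric series because \<open>1 < t\<close>.\<close>

lemma nn_integral_powr_distance_le:
  assumes [measurable]: "X \<in> borel_measurable M" and c: "0 < c" and a: "0 < a" and t: "1 < t"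
    and char: "\<And>\<xi>. cmod (CLINT \<omega>|M. iexp (\<xi> * X \<omega>)) \<le> exp 1 * exp (- (c * \<bar>\<xi>\<bar>))"
    and D: "\<And>\<omega>. a \<le> D \<omega>" "\<And>\<omega>. \<bar>X \<omega>\<bar> \<le> D \<omega>"
  shows "(\<integral>\<^sup>+\<omega>. ennreal (D \<omega> powr - t) \<partial>M)
    \<le> ennreal (2 * exp 3 / (1 - 2 powr (1 - t)) * a powr (1 - t) / c)"
proof -
  \<comment> \<open>On the i-th dyadic scale \<open>X \<omega> / (2 ^ i * a)\<close> is at most 2 in
    absolute value, so \<open>exp 2\<close> times the Gaussian is at least 1 there.\<close>
  let ?w = "\<lambda>i. exp 2 * (2 ^ i * a) powr - t"
  have "(\<integral>\<^sup>+\<omega>. ennreal (D \<omega> powr - t) \<partial>M)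
      \<le> (\<integral>\<^sup>+\<omega>. (\<Sum>i. ennreal (?w i) * ennreal (exp (- (X \<omega> / (2 ^ i * a))\<^sup>2 / 2))) \<partial>M)"
  proof (rule nn_integral_mono)
    fix \<omega>
    obtain i :: nat where i: "2 ^ i * a \<le> D \<omega>" "D \<omega> < 2 ^ Suc i * a"
      using dyadic_scale_exists[OF a D(1)] by blast
    have "\<bar>X \<omega> / (2 ^ i * a)\<bar> \<le> 2"
      using i D(2)[of \<omega>] a by (auto simp: abs_divide abs_mult field_simps)
    then have "(X \<omega> / (2 ^ i * a))\<^sup>2 \<le> 2\<^sup>2"
      using abs_le_square_iff by fastforce
    then have "1 \<le> exp 2 * exp (- (X \<omega> / (2 ^ i * a))\<^sup>2 / 2)"
      by (simp add: exp_add[symmetric])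
    moreover have "D \<omega> powr - t \<le> (2 ^ i * a) powr - t"
      using i a t by (intro powr_mono2') auto
    ultimately have "D \<omega> powr - t * 1 \<le> (2 ^ i * a) powr - t * (exp 2 * exp (- (X \<omega> / (2 ^ i * a))\<^sup>2 / 2))"
      by (intro mult_mono) auto
    then have "ennreal (D \<omega> powr - t) \<le> ennreal (?w i) * ennreal (exp (- (X \<omega> / (2 ^ i * a))\<^sup>2 / 2))"
      by (simp add: ennreal_mult[symmetric] algebra_simps)
    then show "ennreal (D \<omega> powr - t) \<le> (\<Sum>i. ennreal (?w i) * ennreal (exp (- (X \<omega> / (2 ^ i * a))\<^sup>2 / 2)))"
      using sum_le_suminf[of "\<lambda>i. ennreal (?w i) * ennreal (exp (- (X \<omega> / (2 ^ i * a))\<^sup>2 / 2))" "{i}"]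
      by (auto intro: order_trans)
  qed
  also have "\<dots> = (\<Sum>i. \<integral>\<^sup>+\<omega>. ennreal (?w i) * ennreal (exp (- (X \<omega> / (2 ^ i * a))\<^sup>2 / 2)) \<partial>M)"
    by (rule nn_integral_suminf) measurable
  also have "\<dots> = (\<Sum>i. ennreal (?w i) * (\<integral>\<^sup>+\<omega>. ennreal (exp (- (X \<omega> / (2 ^ i * a))\<^sup>2 / 2)) \<partial>M))"
    by (intro suminf_cong nn_integral_cmult) measurable
  also have "\<dots> \<le> (\<Sum>i. ennreal (?w i) * ennreal (2 * exp 1 * (2 ^ i * a) / c))"
    using a by (intro suminf_le mult_left_mono expectation_gaussian_le c char) auto
  also have "\<dots> = (\<Sum>i. ennreal (2 * exp 3 * a powr (1 - t) / c * (2 powr (1 - t)) ^ i))"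
  proof (intro suminf_cong)
    fix i
    have "(2 ^ i * a) powr - t * (2 ^ i * a) = (2 ^ i * a) powr (1 - t)"
      using a by (simp add: powr_diff powr_minus field_simps)
    also have "\<dots> = a powr (1 - t) * (2 powr (1 - t)) ^ i"
      using a by (simp add: powr_mult powr_realpow[symmetric] powr_powr mult.commute)
    finally have 1: "(2 ^ i * a) powr - t * (2 ^ i * a) = a powr (1 - t) * (2 powr (1 - t)) ^ i" .
    have "?w i * (2 * exp 1 * (2 ^ i * a) / c) = 2 * (exp 2 * exp 1) * ((2 ^ i * a) powr - t * (2 ^ i * a)) / c"
      by (simp add: algebra_simps)
    also have "\<dots> = 2 * exp 3 * a powr (1 - t) / c * (2 powr (1 - t)) ^ i"
      unfolding 1 by (simp add: exp_add[symmetric])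
    finally show "ennreal (?w i) * ennreal (2 * exp 1 * (2 ^ i * a) / c)
        = ennreal (2 * exp 3 * a powr (1 - t) / c * (2 powr (1 - t)) ^ i)"
      using a c by (simp add: ennreal_mult[symmetric])
  qed
  also have "\<dots> = ennreal (\<Sum>i. 2 * exp 3 * a powr (1 - t) / c * (2 powr (1 - t)) ^ i)"
    using a c t by (intro suminf_ennreal2 summable_mult summable_geometric) (auto simp: powr_less_one)
  also have "(\<Sum>i. 2 * exp 3 * a powr (1 - t) / c * (2 powr (1 - t)) ^ i)
      = 2 * exp 3 * a powr (1 - t) / c * (1 / (1 - 2 powr (1 - t)))"
    using t by (subst suminf_mult) (auto simp: powr_less_one suminf_geometric intro: summable_geometric)
  finally show ?thesis by (simp add: field_simps)
qed

section \<open>Characteristic functions and coefficients of stable series\<close>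

lemma charfun_stable_sum:
  assumes F: "finite F" "F \<subseteq> I" and indep: "indep_vars (\<lambda>_. borel) \<eta> I"
    and stable: "\<And>i. i \<in> I \<Longrightarrow> symmetric_stable M p \<sigma> (\<eta> i)"
  shows "(CLINT \<omega>|M. iexp (\<xi> * (\<Sum>i\<in>F. \<eta> i \<omega> * b i)))
    = of_real (exp (- (\<sigma> powr p * \<bar>\<xi>\<bar> powr p * (\<Sum>i\<in>F. \<bar>b i\<bar> powr p))))"
proof -
  have \<eta>[measurable]: "\<eta> i \<in> borel_measurable M" if "i \<in> F" for i
    using that stable F by (auto simp: symmetric_stable_def)
  have "indep_vars (\<lambda>_. borel) (\<lambda>i \<omega>. \<eta> i \<omega> * b i) F"
    by (rule indep_vars_compose2[OF indep_vars_subset[OF indep F(2)]]) auto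
  from char_distr_sum[OF this, of \<xi>]
  have "(CLINT \<omega>|M. iexp (\<xi> * (\<Sum>i\<in>F. \<eta> i \<omega> * b i))) = (\<Prod>i\<in>F. char (distr M borel (\<lambda>\<omega>. \<eta> i \<omega> * b i)) \<xi>)"
    by (simp add: char_def integral_distr)
  also have "\<dots> = (\<Prod>i\<in>F. of_real (exp (- (\<sigma> powr p * \<bar>\<xi>\<bar> powr p * \<bar>b i\<bar> powr p))))"
  proof (rule prod.cong[OF refl])
    fix i assume i: "i \<in> F"
    have "char (distr M borel (\<lambda>\<omega>. \<eta> i \<omega> * b i)) \<xi> = (CLINT \<omega>|M. iexp ((\<xi> * b i) * \<eta> i \<omega>))"
      using i by (simp add: char_def integral_distr algebra_simps)
    also have "\<dots> = of_real (exp (- (\<sigma> powr p * \<bar>\<xi> * b i\<bar> powr p)))"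
      using i F stable by (auto simp: symmetric_stable_def simp del: of_real_mult)
    finally show "char (distr M borel (\<lambda>\<omega>. \<eta> i \<omega> * b i)) \<xi>
        = of_real (exp (- (\<sigma> powr p * \<bar>\<xi>\<bar> powr p * \<bar>b i\<bar> powr p)))"
      by (simp add: abs_mult powr_mult mult.assoc)
  qed
  also have "\<dots> = of_real (exp (- (\<sigma> powr p * \<bar>\<xi>\<bar> powr p * (\<Sum>i\<in>F. \<bar>b i\<bar> powr p))))"
    unfolding of_real_prod[symmetric] using F
    by (subst exp_sum[symmetric]) (auto simp: sum_negf sum_distrib_left)
  finally show ?thesis .
qed

text \<open>Dominated convergence carries the characteristic function to the limit. A lower bound
  \<open>m\<close> that the partial sums eventually reach is enough, so the l^p norm of the whole
  coefficient sequence never has to be identified.\<close>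

lemma charfun_limit_le:
  assumes F: "\<And>n. finite (F n)" "\<And>n. F n \<subseteq> I" and indep: "indep_vars (\<lambda>_. borel) \<eta> I"
    and stable: "\<And>i. i \<in> I \<Longrightarrow> symmetric_stable M p \<sigma> (\<eta> i)"
    and X [measurable]: "X \<in> borel_measurable M"
    and lim: "AE \<omega> in M. (\<lambda>n. \<Sum>i\<in>F n. \<eta> i \<omega> * b i) \<longlonglongrightarrow> X \<omega>"
    and G: "\<forall>\<^sub>F n in sequentially. m \<le> (\<Sum>i\<in>F n. \<bar>b i\<bar> powr p)"
  shows "cmod (CLINT \<omega>|M. iexp (\<xi> * X \<omega>)) \<le> exp (- (\<sigma> powr p * \<bar>\<xi>\<bar> powr p * m))"
proof -
  have \<eta>[measurable]: "\<eta> i \<in> borel_measurable M" if "i \<in> F n" for i n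
    using that stable F by (auto simp: symmetric_stable_def)
  have "(\<lambda>n. CLINT \<omega>|M. iexp (\<xi> * (\<Sum>i\<in>F n. \<eta> i \<omega> * b i))) \<longlonglongrightarrow> (CLINT \<omega>|M. iexp (\<xi> * X \<omega>))"
  proof (rule integral_dominated_convergence[where w = "\<lambda>_. 1"])
    show "AE \<omega> in M. (\<lambda>n. iexp (\<xi> * (\<Sum>i\<in>F n. \<eta> i \<omega> * b i))) \<longlonglongrightarrow> iexp (\<xi> * X \<omega>)"
      using lim by eventually_elim (auto intro!: tendsto_intros simp del: of_real_mult)
  qed (auto simp del: of_real_mult of_real_sum)
  then have "(\<lambda>n. cmod (CLINT \<omega>|M. iexp (\<xi> * (\<Sum>i\<in>F n. \<eta> i \<omega> * b i)))) \<longlonglongrightarrow> cmod (CLINT \<omega>|M. iexp (\<xi> * X \<omega>))"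
    by (rule tendsto_norm)
  then show ?thesis
  proof (rule tendsto_upperbound)
    show "\<forall>\<^sub>F n in sequentially. cmod (CLINT \<omega>|M. iexp (\<xi> * (\<Sum>i\<in>F n. \<eta> i \<omega> * b i)))
        \<le> exp (- (\<sigma> powr p * \<bar>\<xi>\<bar> powr p * m))"
      using G by eventually_elim
        (auto simp del: of_real_mult of_real_sum simp add: charfun_stable_sum[OF F indep stable] mult_left_mono)
  qed simp
qed

text \<open>Continuity at 0 provides a nonzero \<xi> at which the characteristic function of the
  limit exceeds 1/2. There the exponential bound of \<open>charfun_limit_le\<close>, applied with
  each partial sum as lower bound, limits that sum to \<open>ln 2 / k\<close>.\<close>

lemma stable_series_coefficients_bounded:
  assumes F: "\<And>n. finite (F n)" "\<And>n. F n \<subseteq> I" "\<And>m n. m \<le> n \<Longrightarrow> F m \<subseteq> F n"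
    and indep: "indep_vars (\<lambda>_. borel) \<eta> I"
    and stable: "\<And>i. i \<in> I \<Longrightarrow> symmetric_stable M p \<sigma> (\<eta> i)" and \<sigma>: "0 < \<sigma>"
    and X [measurable]: "X \<in> borel_measurable M"
    and lim: "AE \<omega> in M. (\<lambda>n. \<Sum>i\<in>F n. \<eta> i \<omega> * b i) \<longlonglongrightarrow> X \<omega>"
  shows "\<exists>B. \<forall>n. (\<Sum>i\<in>F n. \<bar>b i\<bar> powr p) \<le> B"
proof -
  define D where "D = distr M borel X"
  interpret D: real_distribution D unfolding D_def by (rule real_distribution_distr) auto
  have char: "char D \<xi> = (CLINT \<omega>|M. iexp (\<xi> * X \<omega>))" for \<xi>
    by (simp add: char_def D_def integral_distr)
  have "(char D \<longlongrightarrow> char D 0) (at 0)"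
    using D.isCont_char[of 0] by (simp add: isCont_def)
  then have "((\<lambda>\<xi>. cmod (char D \<xi>)) \<longlongrightarrow> 1) (at 0)"
    using tendsto_norm by (fastforce simp: D.char_zero)
  then have "\<forall>\<^sub>F \<xi> in at 0. 1 / 2 < cmod (char D \<xi>)"
    by (rule order_tendstoD) simp
  then obtain \<xi> :: real where \<xi>: "\<xi> \<noteq> 0" "1 / 2 < cmod (char D \<xi>)"
    unfolding eventually_at by (metis dist_0_norm dist_commute field_lbound_gt_zero
        less_irrefl norm_zero real_norm_def abs_of_pos UNIV_I zero_less_one)
  define k where "k = \<sigma> powr p * \<bar>\<xi>\<bar> powr p"
  have k: "0 < k" using \<xi> \<sigma> by (simp add: k_def)
  have "(\<Sum>i\<in>F n. \<bar>b i\<bar> powr p) \<le> ln 2 / k" for n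
  proof -
    have "\<forall>\<^sub>F l in sequentially. (\<Sum>i\<in>F n. \<bar>b i\<bar> powr p) \<le> (\<Sum>i\<in>F l. \<bar>b i\<bar> powr p)"
      using F by (intro eventually_sequentiallyI[of n] sum_mono2) auto
    from charfun_limit_le[OF F(1,2) indep stable X lim this, of \<xi>]
    have "1 / 2 < exp (- (k * (\<Sum>i\<in>F n. \<bar>b i\<bar> powr p)))"
      using \<xi> by (simp add: char k_def)
    then have "ln (1 / 2) < - (k * (\<Sum>i\<in>F n. \<bar>b i\<bar> powr p))"
      by (metis exp_less_cancel_iff exp_ln half_gt_zero zero_less_one)
    then show ?thesis using k by (simp add: ln_div field_simps)
  qed
  then show ?thesis by blast
qed

end

text \<open>The exponent satisfies \<open>y - 1 \<le> y powr p\<close>: above 1 because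
  \<open>1 \<le> p\<close>, and up to 1 because the left side is not positive.\<close>

lemma exp_neg_powr_le:
  fixes y p :: real
  assumes "0 \<le> y" "1 \<le> p"
  shows "exp (- (y powr p)) \<le> exp 1 * exp (- y)"
proof -
  have "y - 1 \<le> y powr p"
  proof (cases "y \<le> 1")
    case False
    then have "y powr 1 \<le> y powr p" using assms by (intro powr_mono) auto
    with False show ?thesis by simp
  qed (use powr_ge_zero[of y p] in linarith)
  then show ?thesis by (simp add: exp_add[symmetric])
qed

section \<open>Differences of Riesz kernels\<close>

text \<open>Normalised so that the derivative is \<open>s powr (a - 1)\<close> also for \<open>a = 0\<close>; up to a constant factor
  this is the Riesz kernel with \<open>a = \<gamma> - d\<close>.\<close>

definition radial_primitive :: "real \<Rightarrow> real \<Rightarrow> real" where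
  "radial_primitive a s = (if a = 0 then ln s else s powr a / a)"

lemma radial_primitive_measurable [measurable]: "radial_primitive a \<in> borel_measurable borel"
  unfolding radial_primitive_def[abs_def] by (cases "a = 0") simp_all

lemma radial_primitive_0 [simp]: "radial_primitive a 0 = 0"
  by (simp add: radial_primitive_def)

lemma radial_primitive_has_derivative:
  assumes "0 < s"
  shows "(radial_primitive a has_real_derivative s powr (a - 1)) (at s)"
proof (cases "a = 0")
  case True
  then show ?thesis
    using assms by (auto simp: radial_primitive_def[abs_def] powr_minus_divide intro!: derivative_eq_intros)
next
  case False
  then show ?thesis
    using assms by (auto simp: radial_primitive_def[abs_def] intro!: derivative_eq_intros)
qed

lemma radial_primitive_less:
  assumes "0 < s" "s < t"
  shows "radial_primitive a s < radial_primitive a t"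
proof (rule DERIV_pos_imp_increasing[OF assms(2)])
  fix x assume "s \<le> x" "x \<le> t"
  then show "\<exists>y. (radial_primitive a has_real_derivative y) (at x) \<and> 0 < y"
    using assms by (intro exI[of _ "x powr (a - 1)"] conjI radial_primitive_has_derivative) auto
qed

lemma radial_primitive_le:
  assumes "0 < s" "s \<le> t"
  shows "radial_primitive a s \<le> radial_primitive a t"
  using radial_primitive_less[of s t a] assms by (cases "s = t") auto

text \<open>For \<open>a = 0\<close> the primitive itself is not homogeneous, but the summand
  \<open>ln l\<close> cancels in the difference. Power and logarithmic kernels thus share one
  scaling argument.\<close>

lemma radial_primitive_scale:
  assumes "0 < l" "0 < s" "0 < t"
  shows "radial_primitive a (l * s) - radial_primitive a (l * t)
    = l powr a * (radial_primitive a s - radial_primitive a t)"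
  using assms by (simp add: radial_primitive_def ln_mult powr_mult algebra_simps diff_divide_distrib)

lemma radial_primitive_lipschitz:
  assumes m: "0 < m" "m \<le> s" "m \<le> t" and a: "a \<le> 1"
  shows "\<bar>radial_primitive a s - radial_primitive a t\<bar> \<le> m powr (a - 1) * \<bar>s - t\<bar>"
proof -
  have *: "radial_primitive a v - radial_primitive a u \<le> m powr (a - 1) * (v - u)"
    if uv: "m \<le> u" "u < v" for u v
  proof -
    have "\<exists>z. u < z \<and> z < v \<and> radial_primitive a v - radial_primitive a u = (v - u) * z powr (a - 1)"
      using uv m by (intro MVT2 radial_primitive_has_derivative) auto
    then obtain z where z: "u < z" "radial_primitive a v - radial_primitive a u = (v - u) * z powr (a - 1)"
      by blast
    have "z powr (a - 1) \<le> m powr (a - 1)"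
      using z uv m a by (intro powr_mono2') auto
    then show ?thesis
      using z uv by (simp add: mult.commute mult_left_mono)
  qed
  consider "s = t" | "s < t" | "t < s" by linarith
  then show ?thesis
  proof cases
    case 2
    then show ?thesis
      using *[of s t] radial_primitive_less[of s t a] m by (simp add: abs_if)
  next
    case 3
    then show ?thesis
      using *[of t s] radial_primitive_less[of t s a] m by (simp add: abs_if)
  qed auto
qed

text \<open>Monotonicity bounds the primitive from above. From below it is compared with a multiple
  of \<open>radial_primitive (- b)\<close>, whose derivative is at least as large up to
  \<open>R\<close> because \<open>0 < a + b\<close>. One exponent \<open>b\<close> thus covers
  bounded, logarithmic and power behaviour at 0.\<close>

lemma radial_primitive_local_bound:
  assumes b: "0 < b" "0 < a + b" and R: "0 < R"
  obtains C where "0 \<le> C" "\<And>s. 0 \<le> s \<Longrightarrow> s \<le> R \<Longrightarrow> \<bar>radial_primitive a s\<bar> \<le> C * s powr - b"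
proof -
  define C where "C = \<bar>radial_primitive a R\<bar> * R powr b + R powr (a + b) / b"
  have "0 \<le> C"
    using b by (auto simp: C_def)
  moreover have "\<bar>radial_primitive a s\<bar> \<le> C * s powr - b" if s: "0 \<le> s" "s \<le> R" for s
  proof (cases "s = 0")
    case False
    define g where "g u = radial_primitive a u - R powr (a + b) * radial_primitive (- b) u" for u
    have "g R \<le> g s"
    proof (rule DERIV_nonpos_imp_nonincreasing[of s R g])
      show "s \<le> R" by fact
      fix u assume u: "s \<le> u" "u \<le> R"
      have "u powr (a + b) \<le> R powr (a + b)"
        using u s b by (intro powr_mono2) auto
      then have "u powr (a + b) * u powr (- b - 1) \<le> R powr (a + b) * u powr (- b - 1)"
        by (rule mult_right_mono) simp
      then have "u powr (a - 1) - R powr (a + b) * u powr (- b - 1) \<le> 0"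
        by (simp add: powr_add[symmetric])
      moreover have "(g has_real_derivative u powr (a - 1) - R powr (a + b) * u powr (- b - 1)) (at u)"
        unfolding g_def[abs_def] using u s False
        by (intro DERIV_diff DERIV_cmult radial_primitive_has_derivative) auto
      ultimately show "\<exists>y. (g has_real_derivative y) (at u) \<and> y \<le> 0"
        by blast
    qed
    then have "radial_primitive a R - radial_primitive a s
        \<le> R powr (a + b) * (radial_primitive (- b) R - radial_primitive (- b) s)"
      by (simp add: g_def algebra_simps)
    also have "\<dots> \<le> R powr (a + b) * (s powr - b / b)"
      using b by (intro mult_left_mono) (auto simp: radial_primitive_def)
    finally have "radial_primitive a R - radial_primitive a s \<le> R powr (a + b) / b * s powr - b"
      by simp
    moreover have "radial_primitive a s \<le> radial_primitive a R"
      using s False by (intro radial_primitive_le) auto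
    ultimately have "\<bar>radial_primitive a s\<bar> \<le> \<bar>radial_primitive a R\<bar> + R powr (a + b) / b * s powr - b"
      by linarith
    moreover have "\<bar>radial_primitive a R\<bar> * 1 \<le> \<bar>radial_primitive a R\<bar> * (R powr b * s powr - b)"
      using s b False by (intro mult_left_mono) (auto simp: powr_minus field_simps powr_mono2)
    moreover have "C * s powr - b = \<bar>radial_primitive a R\<bar> * (R powr b * s powr - b) + R powr (a + b) / b * s powr - b"
      by (simp add: C_def distrib_right)
    ultimately show ?thesis
      by linarith
  qed auto
  ultimately show ?thesis using that by blast
qed

definition kernel_diff :: "real \<Rightarrow> 'a::real_normed_vector \<Rightarrow> 'a \<Rightarrow> 'a \<Rightarrow> real" where
  "kernel_diff a x y z = radial_primitive a (norm (x - z)) - radial_primitive a (norm (y - z))"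

lemma kernel_diff_measurable [measurable]:
  "kernel_diff a x y \<in> borel_measurable (borel :: 'a::{real_normed_vector, second_countable_topology} measure)"
  unfolding kernel_diff_def[abs_def] by measurable

text \<open>Both distances are at least \<open>norm z / 2\<close>, so the Lipschitz bound applies
  there; the cancellation in the difference is what improves the exponent from \<open>a\<close> to
  \<open>a - 1\<close>.\<close>

lemma kernel_diff_far_bound:
  fixes x y z :: "'a::real_normed_vector"
  assumes R: "norm x \<le> R" "norm y \<le> R" "0 < R" and z: "2 * R \<le> norm z" and a: "a \<le> 1"
  shows "\<bar>kernel_diff a x y z\<bar> \<le> 2 * R * 2 powr (1 - a) * norm z powr (a - 1)"
proof -
  have x: "norm z / 2 \<le> norm (x - z)"
    using R z norm_triangle_ineq2[of z x] by (simp add: norm_minus_commute)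
  have y: "norm z / 2 \<le> norm (y - z)"
    using R z norm_triangle_ineq2[of z y] by (simp add: norm_minus_commute)
  have "\<bar>norm (x - z) - norm (y - z)\<bar> \<le> norm (x - y)"
    using norm_triangle_ineq3[of "x - z" "y - z"] by simp
  also have "\<dots> \<le> 2 * R"
    using R norm_triangle_ineq4[of x y] by simp
  finally have "\<bar>norm (x - z) - norm (y - z)\<bar> \<le> 2 * R" .
  then have "(norm z / 2) powr (a - 1) * \<bar>norm (x - z) - norm (y - z)\<bar> \<le> (norm z / 2) powr (a - 1) * (2 * R)"
    by (rule mult_left_mono) simp
  then have "\<bar>kernel_diff a x y z\<bar> \<le> (norm z / 2) powr (a - 1) * (2 * R)"
    if "\<bar>kernel_diff a x y z\<bar> \<le> (norm z / 2) powr (a - 1) * \<bar>norm (x - z) - norm (y - z)\<bar>"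
    using that by (rule order_trans[rotated])
  moreover have "\<bar>kernel_diff a x y z\<bar> \<le> (norm z / 2) powr (a - 1) * \<bar>norm (x - z) - norm (y - z)\<bar>"
    unfolding kernel_diff_def using x y R z a by (intro radial_primitive_lipschitz) auto
  moreover have "(norm z / 2) powr (a - 1) = 2 powr (1 - a) * norm z powr (a - 1)"
    by (simp add: powr_divide powr_diff field_simps)
  ultimately show ?thesis by (simp only: mult.commute mult.left_commute mult.assoc)
qed

text \<open>The witness is the midpoint between \<open>max (- a) 0\<close> and \<open>d / 2\<close>.
  The first two conditions are those of \<open>radial_primitive_local_bound\<close>, the last keeps
  the square of \<open>norm z powr (- b)\<close> integrable at 0.\<close>

lemma exists_between_exponent:
  fixes a d :: real
  assumes "0 < d" "- d / 2 < a"
  obtains b where "0 < b" "0 < a + b" "2 * b < d"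
proof
  define m where "m = max (- a) 0"
  have "- a \<le> m" "0 \<le> m" "m < d / 2"
    using assms by (auto simp: m_def)
  then show "2 * ((m + d / 2) / 2) < d"
    by simp
  show "0 < (m + d / 2) / 2"
    using \<open>0 \<le> m\<close> assms by simp
  have "0 < a + m / 2 + d / 4"
    using \<open>- a \<le> m\<close> \<open>m < d / 2\<close> by linarith
  then show "0 < a + (m + d / 2) / 2"
    by (simp add: add_divide_distrib)
qed

text \<open>The lower bound on \<open>a\<close> is square integrability at the singularities
  \<open>x\<close> and \<open>y\<close>; the upper bound is square integrability at infinity after
  the cancellation. For \<open>a = \<gamma> - d\<close> they say that h > 0 and h < 1.\<close>

lemma kernel_diff_square_nn_integral_finite:
  fixes x y :: "'a::euclidean_space"
  assumes a: "- real DIM('a) / 2 < a" "a < 1 - real DIM('a) / 2"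
  shows "(\<integral>\<^sup>+z. ennreal ((kernel_diff a x y z)\<^sup>2) \<partial>lborel) < \<infinity>"
proof -
  let ?d = "real DIM('a)"
  obtain b where b: "0 < b" "0 < a + b" "2 * b < ?d"
    using exists_between_exponent[of ?d a] a(1) by auto
  define R where "R = norm x + norm y + 1"
  have R: "norm x \<le> R" "norm y \<le> R" "0 < R"
    unfolding R_def by (auto intro: add_nonneg_pos)
  obtain C where C: "0 \<le> C"
    and near: "\<And>s. 0 \<le> s \<Longrightarrow> s \<le> 3 * R \<Longrightarrow> \<bar>radial_primitive a s\<bar> \<le> C * s powr - b"
    using radial_primitive_local_bound[of b a "3 * R"] b R by auto
  define K where "K = 2 * R * 2 powr (1 - a)"
  define f where "f w = ennreal (norm w powr - (2 * b)) * indicator (ball 0 (3 * R)) w" for w :: 'a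
  define g where "g w = ennreal (norm w powr - (2 * (1 - a))) * indicator (- ball 0 (2 * R)) w" for w :: 'a
  have [measurable]: "f \<in> borel_measurable borel" "g \<in> borel_measurable borel"
    unfolding f_def[abs_def] g_def[abs_def] by measurable
  have f_fin: "(\<integral>\<^sup>+w. f w \<partial>lborel) < \<infinity>"
    unfolding f_def using b R by (intro nn_integral_powr_ball_finite) auto
  have g_fin: "(\<integral>\<^sup>+w. g w \<partial>lborel) < \<infinity>"
    unfolding g_def using a R by (intro nn_integral_powr_outside_ball_finite) auto
  have "(\<integral>\<^sup>+z. ennreal ((kernel_diff a x y z)\<^sup>2) \<partial>lborel)
      \<le> (\<integral>\<^sup>+z. ennreal (2 * C\<^sup>2) * (f (x - z) + f (y - z)) + ennreal (K\<^sup>2) * g z \<partial>lborel)"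
  proof (rule nn_integral_mono)
    fix z :: 'a
    show "ennreal ((kernel_diff a x y z)\<^sup>2) \<le> ennreal (2 * C\<^sup>2) * (f (x - z) + f (y - z)) + ennreal (K\<^sup>2) * g z"
    proof (cases "2 * R \<le> norm z")
      case True
      have "(kernel_diff a x y z)\<^sup>2 \<le> (K * norm z powr (a - 1))\<^sup>2"
        using kernel_diff_far_bound[OF R True, of a] a R C
        by (intro abs_le_square_iff[THEN iffD1]) (auto simp: K_def abs_mult)
      also have "\<dots> = K\<^sup>2 * norm z powr - (2 * (1 - a))"
        by (simp add: power_mult_distrib power2_eq_square powr_add[symmetric])
      finally have "ennreal ((kernel_diff a x y z)\<^sup>2) \<le> ennreal (K\<^sup>2) * g z"
        using True by (auto simp: g_def ennreal_mult[symmetric] intro: ennreal_leI)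
      then show ?thesis
        by (simp add: add_increasing)
    next
      case False
      have in_ball: "norm (v - z) < 3 * R" if "norm v \<le> R" for v
        using False that norm_triangle_ineq4[of v z] by simp
      have sq: "(radial_primitive a (norm w))\<^sup>2 \<le> C\<^sup>2 * norm w powr - (2 * b)" if "norm w < 3 * R" for w :: 'a
      proof -
        have "(radial_primitive a (norm w))\<^sup>2 \<le> (C * norm w powr - b)\<^sup>2"
          using near[of "norm w"] that C by (intro abs_le_square_iff[THEN iffD1]) (auto simp: abs_mult)
        then show ?thesis
          by (simp add: power_mult_distrib power2_eq_square[of "_ powr _"] powr_add[symmetric])
      qed
      have "(kernel_diff a x y z)\<^sup>2 \<le> 2 * (radial_primitive a (norm (x - z)))\<^sup>2 + 2 * (radial_primitive a (norm (y - z)))\<^sup>2"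
        unfolding kernel_diff_def
        using zero_le_power2[of "radial_primitive a (norm (x - z)) + radial_primitive a (norm (y - z))"]
        by (simp add: power2_diff power2_sum)
      also have "\<dots> \<le> 2 * C\<^sup>2 * (norm (x - z) powr - (2 * b) + norm (y - z) powr - (2 * b))"
        using sq[OF in_ball[OF R(1)]] sq[OF in_ball[OF R(2)]] by (simp add: algebra_simps)
      finally have "ennreal ((kernel_diff a x y z)\<^sup>2)
          \<le> ennreal (2 * C\<^sup>2) * (f (x - z) + f (y - z))"
        using in_ball[OF R(1)] in_ball[OF R(2)]
        by (simp add: f_def ennreal_mult[symmetric] ennreal_plus[symmetric] ennreal_leI del: ennreal_plus)
      then show ?thesis
        by (simp add: add_increasing2)
    qed
  qed
  also have "\<dots> = ennreal (2 * C\<^sup>2) * ((\<integral>\<^sup>+w. f w \<partial>lborel) + (\<integral>\<^sup>+w. f w \<partial>lborel)) + ennreal (K\<^sup>2) * (\<integral>\<^sup>+w. g w \<partial>lborel)"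
    by (simp add: nn_integral_add nn_integral_cmult nn_integral_reflect)
  also have "\<dots> < \<infinity>"
    using f_fin g_fin by (simp add: ennreal_mult_less_top)
  finally show ?thesis .
qed

lemma kernel_diff_L2:
  fixes x y :: "real^'n"
  assumes "- real CARD('n) / 2 < a" "a < 1 - real CARD('n) / 2"
  shows "kernel_diff a x y \<in> L2"
  using kernel_diff_square_nn_integral_finite[of a x y] assms
  by (auto simp: L2_def integrable_iff_bounded)

lemma fractional_integral_eq_kernel_diff:
  assumes \<gamma>: "0 < \<gamma>" "\<gamma> < real CARD('n) + 1" and "\<gamma> \<noteq> real CARD('n)"
  obtains c where "c \<noteq> 0"
    "\<And>(f :: real^'n \<Rightarrow> real) x. fractional_integral \<gamma> f x
        = c * (LINT z|lborel. kernel_diff (\<gamma> - real CARD('n)) x 0 z * f z)"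
proof -
  define a where "a = \<gamma> - real CARD('n)"
  have a: "a \<noteq> 0" "a < 1"
    using assms by (auto simp: a_def)
  define C where "C = pi powr (real CARD('n) / 2) * 2 powr \<gamma> * Gamma (\<gamma> / 2) / Gamma (real CARD('n) / 2 - \<gamma> / 2)"
  \<comment> \<open>\<open>Gamma\<close> has the value 0 at its poles. Here the argument is
    \<open>- a / 2\<close>, which is nonzero and greater than -1/2, so no pole is met.\<close>
  have "Gamma (real CARD('n) / 2 - \<gamma> / 2) \<noteq> 0"
  proof -
    have "- a / 2 \<notin> \<int>\<^sub>\<le>\<^sub>0"
    proof
      assume "- a / 2 \<in> \<int>\<^sub>\<le>\<^sub>0"
      then obtain n :: nat where "- a / 2 = - real n"
        by (auto elim!: nonpos_Ints_cases')
      then show False using a by (cases n) auto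
    qed
    then show ?thesis
      by (auto simp: a_def Gamma_eq_zero_iff diff_divide_distrib)
  qed
  then have C: "C \<noteq> 0"
    using \<gamma> less_imp_neq[OF Gamma_real_pos[of "\<gamma> / 2"]] by (simp add: C_def)
  have exponent: "- (real CARD('n) - \<gamma>) = a"
    by (simp add: a_def)
  have "riesz_kernel \<gamma> v = a / C * radial_primitive a (norm v)" for v :: "real^'n"
    using a(1) unfolding riesz_kernel_def Let_def C_def[symmetric] exponent
    by (simp add: radial_primitive_def)
  then have "modified_kernel \<gamma> x z = a / C * kernel_diff a x 0 z" for x z :: "real^'n"
    by (simp add: modified_kernel_def kernel_diff_def right_diff_distrib)
  then have "fractional_integral \<gamma> f x = a / C * (LINT z|lborel. kernel_diff a x 0 z * f z)"
    for f :: "real^'n \<Rightarrow> real" and x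
    using assms(3) by (simp add: fractional_integral_def mult.assoc)
  then show ?thesis
    using that[of "a / C"] a C by (simp add: a_def)
qed

text \<open>The ball about \<open>x\<close> of radius a quarter of \<open>r = norm (x - y)\<close>
  already suffices: its points are at distance at least \<open>3 / 4 * r\<close> from
  \<open>y\<close>, so by monotonicity and scaling the difference is at least
  \<open>r powr a * k\<close> there. Its square times a volume of order \<open>r ^ d\<close> gives
  the stated power.\<close>

lemma kernel_diff_L2_lower_bound:
  assumes a: "- real CARD('n) / 2 < a" "a < 1 - real CARD('n) / 2"
  obtains c where "0 < c"
    "\<And>x y :: real^'n. x \<noteq> y \<Longrightarrow>
       c * norm (x - y) powr (2 * a + real CARD('n)) \<le> L2_inner (kernel_diff a x y) (kernel_diff a x y)"
proof -
  let ?d = "CARD('n)"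
  define k where "k = radial_primitive a (3/4) - radial_primitive a (1/4)"
  have k: "0 < k"
    unfolding k_def using radial_primitive_less[of "1/4" "3/4" a] by simp
  define c where "c = k\<^sup>2 * (unit_ball_vol (real ?d) * (1/4) ^ ?d)"
  have "0 < c" using k by (simp add: c_def)
  moreover have "c * norm (x - y) powr (2 * a + real ?d) \<le> L2_inner (kernel_diff a x y) (kernel_diff a x y)"
    if "x \<noteq> y" for x y :: "real^'n"
  proof -
    define r where "r = norm (x - y)"
    have r: "0 < r" using that by (simp add: r_def)
    have int: "integrable lborel (\<lambda>z. kernel_diff a x y z * kernel_diff a x y z)"
      using a by (intro L2_imp_integrable_mult kernel_diff_L2)
    have lower: "r powr a * k \<le> \<bar>kernel_diff a x y z\<bar>" if z: "z \<noteq> x" "z \<in> ball x (r / 4)" for z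
    proof -
      have 1: "0 < norm (x - z)" "norm (x - z) \<le> r * (1/4)"
        using z by (auto simp: dist_norm)
      have 2: "r * (3/4) \<le> norm (y - z)"
        using 1 norm_triangle_ineq[of "y - z" "z - x"] by (simp add: r_def norm_minus_commute)
      have "r powr a * k = radial_primitive a (r * (3/4)) - radial_primitive a (r * (1/4))"
        unfolding k_def using r by (intro radial_primitive_scale[symmetric]) auto
      also have "\<dots> \<le> radial_primitive a (norm (y - z)) - radial_primitive a (norm (x - z))"
        using 1 2 r by (intro diff_mono radial_primitive_le) auto
      finally show ?thesis by (simp add: kernel_diff_def)
    qed
    have "ennreal (c * r powr (2 * a + real ?d)) = ennreal ((r powr a * k)\<^sup>2) * emeasure lborel (ball x (r / 4))"
    proof -
      have "r powr (2 * a + real ?d) = (r powr a)\<^sup>2 * r ^ ?d"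
        using r by (simp only: powr_add powr_realpow power2_eq_square mult_2)
      then have "c * r powr (2 * a + real ?d) = (r powr a * k)\<^sup>2 * (unit_ball_vol (real ?d) * (r / 4) ^ ?d)"
        by (simp add: c_def power_mult_distrib power_divide)
      then show ?thesis
        using r by (simp add: emeasure_ball ennreal_mult)
    qed
    also have "\<dots> = (\<integral>\<^sup>+z. ennreal ((r powr a * k)\<^sup>2) * indicator (ball x (r / 4)) z \<partial>lborel)"
      by (simp add: nn_integral_cmult_indicator)
    also have "\<dots> \<le> (\<integral>\<^sup>+z. ennreal (kernel_diff a x y z * kernel_diff a x y z) \<partial>lborel)"
    proof (rule nn_integral_mono_AE)
      have "AE z in lborel. z \<noteq> x" by (simp add: AE_lborel_singleton)
      then show "AE z in lborel. ennreal ((r powr a * k)\<^sup>2) * indicator (ball x (r / 4)) z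
          \<le> ennreal (kernel_diff a x y z * kernel_diff a x y z)"
      proof eventually_elim
        case (elim z)
        have "(r powr a * k)\<^sup>2 \<le> (kernel_diff a x y z)\<^sup>2" if "z \<in> ball x (r / 4)"
          using lower[OF elim that] k by (intro abs_le_square_iff[THEN iffD1]) (auto simp: abs_mult)
        then show ?case
          by (auto simp: indicator_def power2_eq_square intro: ennreal_leI)
      qed
    qed
    also have "\<dots> = ennreal (L2_inner (kernel_diff a x y) (kernel_diff a x y))"
      unfolding L2_inner_def using int by (intro nn_integral_eq_integral) auto
    finally show ?thesis
      unfolding r_def[symmetric] by (subst (asm) ennreal_le_iff) (auto simp: L2_inner_def)
  qed
  ultimately show ?thesis using that by blast
qed

section \<open>The logarithmic kernel\<close>

lemma frullani_cos:
  fixes a b N :: real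
  assumes a: "0 < a" "a \<le> b" and N: "0 \<le> N"
  shows "integral {0..N} (\<lambda>s. (cos (a * s) - cos (b * s)) / s) = integral {a..b} (\<lambda>u. (1 - cos (u * N)) / u)"
proof -
  \<comment> \<open>Both sides are the iterated integrals of \<open>sin (s * u)\<close> over \<open>{0..N} \<times> {a..b}\<close>.\<close>
  have inner1: "integral {a..b} (\<lambda>u. sin (s * u)) = (cos (a * s) - cos (b * s)) / s" if "s \<noteq> 0" for s
  proof -
    have "((\<lambda>u. sin (s * u)) has_integral (- cos (s * b) / s - - cos (s * a) / s)) {a..b}"
      using a that by (intro fundamental_theorem_of_calculus)
        (auto intro!: derivative_eq_intros simp: has_real_derivative_iff_has_vector_derivative[symmetric])
    from integral_unique[OF this] show ?thesis
      using that by (simp add: field_simps)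
  qed
  have inner2: "integral {0..N} (\<lambda>s. sin (s * u)) = (1 - cos (u * N)) / u" if "u \<in> {a..b}" for u
  proof -
    have "u \<noteq> 0" using that a by auto
    then have "((\<lambda>s. sin (s * u)) has_integral (- cos (N * u) / u - - cos (0 * u) / u)) {0..N}"
      using N by (intro fundamental_theorem_of_calculus)
        (auto intro!: derivative_eq_intros simp: has_real_derivative_iff_has_vector_derivative[symmetric])
    from integral_unique[OF this] show ?thesis
      using \<open>u \<noteq> 0\<close> by (simp add: field_simps)
  qed
  have "integral {0..N} (\<lambda>s. (cos (a * s) - cos (b * s)) / s) = integral {0..N} (\<lambda>s. integral {a..b} (\<lambda>u. sin (s * u)))"
    by (rule integral_spike[where S = "{0}"]) (auto simp: inner1)
  also have "\<dots> = integral {a..b} (\<lambda>u. integral {0..N} (\<lambda>s. sin (s * u)))"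
    using integral_swap_continuous[of 0 a N b "\<lambda>s u. sin (s * u)"]
    by (simp add: case_prod_unfold continuous_intros)
  also have "\<dots> = integral {a..b} (\<lambda>u. (1 - cos (u * N)) / u)"
    by (rule integral_cong) (rule inner2)
  finally show ?thesis .
qed

lemma frullani_cos_swap:
  fixes a b N :: real
  shows "integral {0..N} (\<lambda>s. (cos (b * s) - cos (a * s)) / s) = - integral {0..N} (\<lambda>s. (cos (a * s) - cos (b * s)) / s)"
  unfolding integral_neg[symmetric] by (simp add: diff_divide_distrib)

lemma has_integral_inverse_real:
  fixes a b :: real
  assumes "0 < a" "a \<le> b"
  shows "((\<lambda>u. 1 / u) has_integral (ln b - ln a)) {a..b}"
  using assms by (intro fundamental_theorem_of_calculus)
    (auto intro!: derivative_eq_intros simp: has_real_derivative_iff_has_vector_derivative[symmetric])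

text \<open>Uniformity in \<open>N\<close> is the point: the bound serves as the dominating function
  when a frequency cutoff is removed. The factor 2 bounds \<open>1 - cos (u * N)\<close>.\<close>

lemma frullani_cos_bound:
  fixes a b N :: real
  assumes a: "0 < a" "0 < b" and N: "0 \<le> N"
  shows "\<bar>integral {0..N} (\<lambda>s. (cos (a * s) - cos (b * s)) / s)\<bar> \<le> 2 * \<bar>ln b - ln a\<bar>"
proof -
  have *: "\<bar>integral {0..N} (\<lambda>s. (cos (a * s) - cos (b * s)) / s)\<bar> \<le> 2 * (ln b - ln a)"
    if ab: "0 < a" "a \<le> b" for a b
  proof -
    have "norm (integral {a..b} (\<lambda>u. (1 - cos (u * N)) / u)) \<le> integral {a..b} (\<lambda>u. 2 * (1 / u))"
    proof (rule integral_norm_bound_integral)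
      show "(\<lambda>u. (1 - cos (u * N)) / u) integrable_on {a..b}"
        using ab by (intro integrable_continuous_interval continuous_intros) auto
      show "(\<lambda>u. 2 * (1 / u)) integrable_on {a..b}"
        using ab by (intro integrable_continuous_interval continuous_intros) auto
      fix u assume "u \<in> {a..b}"
      moreover have "\<bar>1 - cos (u * N)\<bar> \<le> 2"
        using cos_ge_minus_one[of "u * N"] cos_le_one[of "u * N"] by linarith
      ultimately show "norm ((1 - cos (u * N)) / u) \<le> 2 * (1 / u)"
        using ab by (auto simp: abs_divide divide_right_mono)
    qed
    also have "\<dots> = 2 * (ln b - ln a)"
      using integral_unique[OF has_integral_mult_right[OF has_integral_inverse_real[OF ab], of 2]] .
    finally show ?thesis
      using frullani_cos[OF ab N] by simp
  qed
  show ?thesis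
    using *[of a b] *[of b a] a frullani_cos_swap[of N b a] by (cases "a \<le> b") auto
qed

lemma frullani_cos_tendsto:
  fixes a b :: real
  assumes a: "0 < a" "0 < b"
  shows "(\<lambda>n::nat. integral {0..real n} (\<lambda>s. (cos (a * s) - cos (b * s)) / s)) \<longlonglongrightarrow> ln b - ln a"
proof -
  have *: "(\<lambda>n::nat. integral {0..real n} (\<lambda>s. (cos (a * s) - cos (b * s)) / s)) \<longlonglongrightarrow> ln b - ln a"
    if ab: "0 < a" "a \<le> b" for a b :: real
  proof (rule Lim_transform_eventually)
    \<comment> \<open>For \<open>n > 0\<close>, \<open>r n\<close> is the integral of
      \<open>cos (u * real n) / u\<close> over \<open>{a..b}\<close> after one integration by parts,
      which makes the factor \<open>1 / real n\<close> visible.\<close>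
    define r where "r n = (sin (b * real n) / (real n * b) - sin (a * real n) / (real n * a))
      + integral {a..b} (\<lambda>u. sin (u * real n) / (real n * u\<^sup>2))" for n :: nat
    have "\<forall>\<^sub>F n in sequentially. norm (r n) \<le> (1 / b + 1 / a + (b - a) / a\<^sup>2) / real n"
      using eventually_gt_at_top[of 0]
    proof eventually_elim
      case (elim n)
      have "norm (integral {a..b} (\<lambda>u. sin (u * real n) / (real n * u\<^sup>2))) \<le> 1 / (real n * a\<^sup>2) * (b - a)"
      proof (rule integral_bound)
        show "continuous_on {a..b} (\<lambda>u. sin (u * real n) / (real n * u\<^sup>2))"
          using ab elim by (intro continuous_intros) auto
        fix u assume u: "u \<in> {a..b}"
        have "\<bar>sin (u * real n)\<bar> / (real n * u\<^sup>2) \<le> 1 / (real n * a\<^sup>2)"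
          using u ab elim by (intro frac_le mult_left_mono power_mono) auto
        then show "norm (sin (u * real n) / (real n * u\<^sup>2)) \<le> 1 / (real n * a\<^sup>2)"
          by (simp add: abs_mult)
      qed (use ab in auto)
      moreover have "\<bar>sin (c * real n) / (real n * c)\<bar> \<le> 1 / (real n * c)" if "0 < c" for c
        using that elim by (simp add: abs_mult divide_right_mono)
      from this[of a] this[of b] have
        "\<bar>sin (b * real n) / (real n * b) - sin (a * real n) / (real n * a)\<bar> \<le> 1 / (real n * b) + 1 / (real n * a)"
        using ab by linarith
      ultimately have "\<bar>r n\<bar> \<le> 1 / (real n * b) + 1 / (real n * a) + 1 / (real n * a\<^sup>2) * (b - a)"
        unfolding r_def real_norm_def by linarith
      also have "\<dots> = (1 / b + 1 / a + (b - a) / a\<^sup>2) / real n"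
        using elim by (simp add: add_divide_distrib mult.commute)
      finally show ?case by simp
    qed
    then have "r \<longlonglongrightarrow> 0"
      by (rule Lim_null_comparison) (intro lim_const_over_n)
    from tendsto_diff[OF tendsto_const[of "ln b - ln a"] this]
    show "(\<lambda>n. ln b - ln a - r n) \<longlonglongrightarrow> ln b - ln a"
      by simp
    show "\<forall>\<^sub>F n in sequentially. ln b - ln a - r n = integral {0..real n} (\<lambda>s. (cos (a * s) - cos (b * s)) / s)"
      using eventually_gt_at_top[of 0]
    proof eventually_elim
      case (elim n)
      have "((\<lambda>u. cos (u * real n) / u - sin (u * real n) / (real n * u\<^sup>2)) has_integral
          (sin (b * real n) / (real n * b) - sin (a * real n) / (real n * a))) {a..b}"
        using ab elim by (intro fundamental_theorem_of_calculus)
          (auto intro!: derivative_eq_intros simp: has_real_derivative_iff_has_vector_derivative[symmetric]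
             field_simps power2_eq_square)
      moreover have "(\<lambda>u. sin (u * real n) / (real n * u\<^sup>2)) integrable_on {a..b}"
        using ab elim by (intro integrable_continuous_interval continuous_intros) auto
      ultimately have "((\<lambda>u. (cos (u * real n) / u - sin (u * real n) / (real n * u\<^sup>2)) + sin (u * real n) / (real n * u\<^sup>2))
          has_integral r n) {a..b}"
        unfolding r_def by (intro has_integral_add) (auto simp: integrable_integral)
      then have "((\<lambda>u. cos (u * real n) / u) has_integral r n) {a..b}"
        by simp
      from has_integral_diff[OF has_integral_inverse_real[OF ab] this]
      have "integral {a..b} (\<lambda>u. (1 - cos (u * real n)) / u) = ln b - ln a - r n"
        by (simp add: diff_divide_distrib integral_unique)
      then show ?case
        using frullani_cos[OF ab, of "real n"] by simp
    qed
  qed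
  show ?thesis
    using *[of a b] tendsto_minus[OF *[of b a]] a frullani_cos_swap[of _ b a] by (cases "a \<le> b") auto
qed

section \<open>Pairing the kernel with a function on the frequency side\<close>

lemma norm_cis_diff_one_le: "cmod (cis t - 1) \<le> \<bar>t\<bar>"
proof -
  have "cmod (iexp t - (\<Sum>k\<le>0. (\<i> * t) ^ k / fact k)) \<le> \<bar>t\<bar> ^ Suc 0 / fact (Suc 0)"
    by (rule iexp_approx1)
  then show ?thesis
    by (simp add: cis_conv_exp mult.commute)
qed

lemma integrable_if_bounded_by_inverse_square:
  fixes f :: "real \<Rightarrow> complex"
  assumes [measurable]: "f \<in> borel_measurable borel"
    and near: "\<And>s. \<bar>s\<bar> \<le> 1 \<Longrightarrow> cmod (f s) \<le> A" and far: "\<And>s. 1 \<le> \<bar>s\<bar> \<Longrightarrow> cmod (f s) \<le> B / s\<^sup>2"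
  shows "integrable lborel f"
proof (rule Bochner_Integration.integrable_bound)
  have AB: "0 \<le> A" "0 \<le> B"
    using order_trans[OF norm_ge_zero near[of 0]] order_trans[OF norm_ge_zero far[of 1]] by auto
  have "set_integrable lborel (einterval (- \<infinity>) \<infinity>) (\<lambda>x::real. inverse (1 + x\<^sup>2))"
    by (rule integrable_inverse_1_plus_square)
  then show "integrable lborel (\<lambda>s::real. 2 * (A + B) * inverse (1 + s\<^sup>2))"
    by (simp add: set_integrable_def einterval_def)
  show "AE s in lborel. norm (f s) \<le> norm (2 * (A + B) * inverse (1 + s\<^sup>2))"
  proof (rule AE_I2)
    fix s :: real
    have pos: "0 < 1 + s\<^sup>2" by (simp add: add_pos_nonneg)
    have "cmod (f s) * (1 + s\<^sup>2) \<le> 2 * (A + B)"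
    proof (cases "\<bar>s\<bar> \<le> 1")
      case True
      then have "1 + s\<^sup>2 \<le> 2" by (simp add: abs_square_le_1)
      then have "cmod (f s) * (1 + s\<^sup>2) \<le> A * 2"
        using near[OF True] AB by (intro mult_mono) auto
      then show ?thesis using AB by simp
    next
      case False
      then have "1\<^sup>2 \<le> \<bar>s\<bar>\<^sup>2" by (intro power_mono) auto
      then have s: "1 \<le> s\<^sup>2" by simp
      have "cmod (f s) * (1 + s\<^sup>2) \<le> B / s\<^sup>2 * (2 * s\<^sup>2)"
        using far[of s] False AB s by (intro mult_mono) auto
      then show ?thesis using AB s by (auto split: if_splits)
    qed
    then have "cmod (f s) \<le> 2 * (A + B) * inverse (1 + s\<^sup>2)"
      using pos by (simp add: field_simps)
    then show "norm (f s) \<le> norm (2 * (A + B) * inverse (1 + s\<^sup>2))"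
      using AB pos by simp
  qed
qed simp

text \<open>With frequencies cut off to \<open>{- real n..real n}\<close> the order of integration
  can be exchanged, and the inner integral over \<open>s\<close> becomes a truncated Frullani
  integral, which tends to a multiple of the logarithmic kernel and is dominated by it. The decay of
  \<open>G\<close> makes the cutoff removable on the frequency side, integrability of
  \<open>ln_g\<close> on the other side.\<close>

lemma log_kernel_pairing:
  fixes g :: "real \<Rightarrow> real" and x :: real
  defines "G \<equiv> \<lambda>s. CLINT t|lborel. of_real (g t) * cis (2 * pi * (s * t))"
    and "m \<equiv> \<lambda>s. of_real (1 / (2 * pi)) * (cis (- 2 * pi * (s * x)) - 1) / of_real \<bar>s\<bar>"
  assumes g: "integrable lborel g"
    and G: "\<And>s. 1 \<le> \<bar>s\<bar> \<Longrightarrow> cmod (G s) \<le> C / \<bar>s\<bar>"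
    and ln_g: "integrable lborel (\<lambda>t. (ln \<bar>x - t\<bar> - ln \<bar>t\<bar>) * g t)"
  shows "Re (CLINT s|lborel. m s * G s) = - (1 / pi) * (LINT t|lborel. (ln \<bar>x - t\<bar> - ln \<bar>t\<bar>) * g t)"
proof -
  have [measurable]: "g \<in> borel_measurable borel"
    using g by auto
  have [measurable]: "G \<in> borel_measurable borel" "m \<in> borel_measurable borel"
    unfolding G_def m_def cis_conv_exp by measurable
  have m_le: "cmod (m s) \<le> \<bar>x\<bar>" for s
  proof (cases "s = 0")
    case False
    have "cmod (cis (- 2 * pi * (s * x)) - 1) \<le> 2 * pi * (\<bar>s\<bar> * \<bar>x\<bar>)"
      using norm_cis_diff_one_le[of "- 2 * pi * (s * x)"] by (simp add: abs_mult)
    then show ?thesis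
      using False by (simp add: m_def norm_mult norm_divide field_simps)
  qed (simp add: m_def)
  have m_le': "cmod (m s) \<le> 1 / \<bar>s\<bar>" for s
  proof -
    have "cmod (cis (- 2 * pi * (s * x)) - 1) \<le> 2"
      using norm_triangle_ineq4[of "cis (- 2 * pi * (s * x))" 1] by simp
    moreover have "2 \<le> 2 * pi" using pi_gt3 by simp
    ultimately have "cmod (cis (- 2 * pi * (s * x)) - 1) \<le> 2 * pi" by linarith
    then have "cmod (cis (- 2 * pi * (s * x)) - 1) / (2 * pi) / \<bar>s\<bar> \<le> 1 / \<bar>s\<bar>"
      by (intro divide_right_mono) auto
    then show ?thesis
      by (simp add: m_def norm_mult norm_divide)
  qed
  define A where "A = (LINT t|lborel. \<bar>g t\<bar>)"
  have G_le: "cmod (G s) \<le> A" for s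
  proof -
    have "cmod (G s) \<le> (LINT t|lborel. cmod (of_real (g t) * cis (2 * pi * (s * t))))"
      unfolding G_def by (rule integral_norm_bound)
    then show ?thesis by (simp add: A_def norm_mult)
  qed
  have int_mG: "integrable lborel (\<lambda>s. m s * G s)"
  proof (rule integrable_if_bounded_by_inverse_square)
    fix s :: real
    show "cmod (m s * G s) \<le> \<bar>x\<bar> * A"
      unfolding norm_mult by (intro mult_mono m_le G_le) auto
    assume "1 \<le> \<bar>s\<bar>"
    then have "cmod (m s * G s) \<le> 1 / \<bar>s\<bar> * (C / \<bar>s\<bar>)"
      unfolding norm_mult by (intro mult_mono m_le' G) auto
    also have "\<dots> = C / s\<^sup>2"
      by (simp add: power2_eq_square)
    finally show "cmod (m s * G s) \<le> C / s\<^sup>2" .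
  qed measurable
  \<comment> \<open>\<open>\<phi> t s\<close> is \<open>2 * pi\<close> times the real part of
    \<open>m s * cis (2 * pi * (s * t))\<close>. The absolute values, harmless by evenness of the
    cosine, put it into the form of Frullani's integrand.\<close>
  define \<phi> where "\<phi> t s = (cos (2 * pi * \<bar>x - t\<bar> * s) - cos (2 * pi * \<bar>t\<bar> * s)) / \<bar>s\<bar>" for t s :: real
  have cos_abs: "cos (2 * pi * v * s) = cos (2 * pi * \<bar>v\<bar> * s)" for v s
    using cos_minus[of "2 * pi * v * s"] by (cases "0 \<le> v") simp_all
  have Re_m: "Re (m s * cis (2 * pi * (s * t))) = \<phi> t s / (2 * pi)" for s t
  proof -
    have "m s * cis (2 * pi * (s * t))
        = of_real (1 / (2 * pi)) * (cis (2 * pi * (s * t) - 2 * pi * (s * x)) - cis (2 * pi * (s * t))) / of_real \<bar>s\<bar>"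
      by (simp add: m_def algebra_simps cis_mult flip: cis_divide)
    also have "Re \<dots> = (cos (2 * pi * (s * t) - 2 * pi * (s * x)) - cos (2 * pi * (s * t))) / (2 * pi) / \<bar>s\<bar>"
      by (simp del: of_real_mult of_real_divide add: Re_divide_of_real flip: of_real_mult of_real_divide)
    also have "2 * pi * (s * t) - 2 * pi * (s * x) = 2 * pi * (t - x) * s"
      by (simp add: algebra_simps)
    also have "cos (2 * pi * (t - x) * s) = cos (2 * pi * \<bar>x - t\<bar> * s)"
      using cos_abs[of "t - x" s] by (simp add: abs_minus_commute)
    also have "cos (2 * pi * (s * t)) = cos (2 * pi * \<bar>t\<bar> * s)"
      using cos_abs[of t s] by (simp add: ac_simps)
    finally show ?thesis by (simp add: \<phi>_def)
  qed
  have \<phi>_bound: "\<bar>\<phi> t s\<bar> \<le> 2 * pi * \<bar>x\<bar>" for s t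
  proof -
    have "\<bar>\<phi> t s / (2 * pi)\<bar> \<le> cmod (m s)"
      unfolding Re_m[symmetric] using abs_Re_le_cmod[of "m s * cis (2 * pi * (s * t))"] by (simp add: norm_mult)
    also note m_le
    finally show ?thesis by (simp add: abs_divide field_simps)
  qed
  have [measurable]: "(\<lambda>(t, s). \<phi> t s) \<in> borel_measurable (borel \<Otimes>\<^sub>M borel)" "\<phi> t \<in> borel_measurable borel" for t
    unfolding \<phi>_def[abs_def] by measurable
  define L where "L n t = (LINT s|lborel. indicator {- real n..real n} s * \<phi> t s)" for n :: nat and t
  have [measurable]: "L n \<in> borel_measurable borel" for n
    unfolding L_def[abs_def] by measurable
  have int_\<phi>: "integrable lborel (\<lambda>s. indicator {u..v} s * \<phi> t s)" for u v t
  proof (rule Bochner_Integration.integrable_bound)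
    show "integrable lborel (\<lambda>s. indicator {u..v} s * (2 * pi * \<bar>x\<bar>))"
      by (intro integrable_mult_left) (simp add: integrable_indicator_iff emeasure_lborel_Icc_eq)
    show "AE s in lborel. norm (indicator {u..v} s * \<phi> t s) \<le> norm (indicator {u..v} s * (2 * pi * \<bar>x\<bar>))"
      using \<phi>_bound by (intro AE_I2) (auto simp: indicator_def abs_mult)
  qed measurable
  have L_eq: "L n t = 2 * integral {0..real n} (\<lambda>s. (cos (2 * pi * \<bar>x - t\<bar> * s) - cos (2 * pi * \<bar>t\<bar> * s)) / s)" for n t
  proof -
    have "L n t = (LINT s|lborel. indicator {0..real n} s * \<phi> t s + indicator {- real n..0} s * \<phi> t s)"
      unfolding L_def by (rule Bochner_Integration.integral_cong) (auto simp: indicator_def \<phi>_def)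
    also have "\<dots> = (LINT s|lborel. indicator {0..real n} s * \<phi> t s) + (LINT s|lborel. indicator {- real n..0} s * \<phi> t s)"
      by (intro Bochner_Integration.integral_add int_\<phi>)
    also have "(LINT s|lborel. indicator {- real n..0} s * \<phi> t s) = (LINT s|lborel. indicator {0..real n} s * \<phi> t s)"
    proof -
      have "indicator {- real n..0} (0 + - 1 * s) * \<phi> t (0 + - 1 * s) = indicator {0..real n} s * \<phi> t s" for s
        by (auto simp: indicator_def \<phi>_def)
      then show ?thesis
        by (subst lborel_integral_real_affine[where c = "-1" and t = 0]) simp_all
    qed
    also have "(LINT s|lborel. indicator {0..real n} s * \<phi> t s) = integral {0..real n} (\<phi> t)"
      using set_borel_integral_eq_integral(2)[of "{0..real n}" "\<phi> t"] int_\<phi>[of 0 "real n" t]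
      by (simp add: set_integrable_def set_lebesgue_integral_def)
    also have "\<dots> = integral {0..real n} (\<lambda>s. (cos (2 * pi * \<bar>x - t\<bar> * s) - cos (2 * pi * \<bar>t\<bar> * s)) / s)"
      by (rule integral_cong) (auto simp: \<phi>_def)
    finally show ?thesis by simp
  qed
  have log_eq: "ln (2 * pi * \<bar>t\<bar>) - ln (2 * pi * \<bar>x - t\<bar>) = - (ln \<bar>x - t\<bar> - ln \<bar>t\<bar>)" if "t \<noteq> 0" "t \<noteq> x" for t
    using that by (simp add: ln_mult)
  have L_bound: "\<bar>L n t\<bar> \<le> 4 * \<bar>ln \<bar>x - t\<bar> - ln \<bar>t\<bar>\<bar>" if "t \<noteq> 0" "t \<noteq> x" for n t
    using frullani_cos_bound[of "2 * pi * \<bar>x - t\<bar>" "2 * pi * \<bar>t\<bar>" "real n"] that log_eq[OF that]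
    unfolding L_eq abs_mult abs_minus_commute[of "ln \<bar>x - t\<bar>"] by simp
  have L_lim: "(\<lambda>n. L n t) \<longlonglongrightarrow> - 2 * (ln \<bar>x - t\<bar> - ln \<bar>t\<bar>)" if "t \<noteq> 0" "t \<noteq> x" for t
    using tendsto_mult_left[OF frullani_cos_tendsto[of "2 * pi * \<bar>x - t\<bar>" "2 * pi * \<bar>t\<bar>"], of 2] that log_eq[OF that]
    unfolding L_eq by simp
  have AE_t: "AE t in lborel. t \<noteq> 0 \<and> t \<noteq> x"
    using AE_lborel_singleton[of 0] AE_lborel_singleton[of x] by eventually_elim simp
  have trunc: "Re (CLINT s|lborel. indicator {- real n..real n} s *\<^sub>R (m s * G s)) = (LINT t|lborel. g t * (L n t / (2 * pi)))" for n
  proof -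
    define f where "f s t = indicator {- real n..real n} s *\<^sub>R (m s * (of_real (g t) * cis (2 * pi * (s * t))))" for s t
    have [measurable]: "(\<lambda>(s, t). f s t) \<in> borel_measurable (borel \<Otimes>\<^sub>M borel)"
      unfolding f_def cis_conv_exp by measurable
    \<comment> \<open>The majorant \<open>\<bar>x\<bar> * \<bar>g t\<bar>\<close> is constant in
      \<open>s\<close>, so the exchange of integrals depends on the cutoff.\<close>
    have int_f: "integrable (lborel \<Otimes>\<^sub>M lborel) (\<lambda>(s, t). f s t)"
    proof (rule Bochner_Integration.integrable_bound)
      show "integrable (lborel \<Otimes>\<^sub>M lborel) (\<lambda>(s, t). (indicator {- real n..real n} s * \<bar>x\<bar>) * g t)"
      proof (rule lborel_pair.Fubini_integrable)
        have "integrable lborel (\<lambda>s. (indicator {- real n..real n} s * \<bar>x\<bar>) * A)"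
          by (intro integrable_mult_left) (simp add: integrable_indicator_iff emeasure_lborel_Icc_eq)
        then show "integrable lborel (\<lambda>s. LINT t|lborel.
            norm (case (s, t) of (s, t) \<Rightarrow> indicator {- real n..real n} s * \<bar>x\<bar> * g t))"
          by (simp add: A_def abs_mult)
        show "AE s in lborel. integrable lborel (\<lambda>t. case (s, t) of (s, t) \<Rightarrow> indicator {- real n..real n} s * \<bar>x\<bar> * g t)"
          using g by simp
      qed measurable
      show "AE z in lborel \<Otimes>\<^sub>M lborel. norm (case z of (s, t) \<Rightarrow> f s t)
          \<le> norm (case z of (s, t) \<Rightarrow> indicator {- real n..real n} s * \<bar>x\<bar> * g t)"
        using m_le by (intro AE_I2) (auto simp: f_def norm_mult abs_mult indicator_def intro!: mult_right_mono)
    qed measurable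
    have "(CLINT s|lborel. indicator {- real n..real n} s *\<^sub>R (m s * G s)) = (CLINT s|lborel. (CLINT t|lborel. f s t))"
      by (simp add: f_def G_def)
    also have "\<dots> = (CLINT t|lborel. (CLINT s|lborel. f s t))"
      by (rule lborel_pair.Fubini_integral[symmetric]) (rule int_f)
    also have "Re \<dots> = (LINT t|lborel. Re (CLINT s|lborel. f s t))"
      by (rule integral_Re[symmetric]) (rule lborel_pair.integrable_snd[OF int_f])
    also have "\<dots> = (LINT t|lborel. g t * (L n t / (2 * pi)))"
    proof (rule Bochner_Integration.integral_cong_AE)
      have "AE t in lborel. integrable lborel (\<lambda>s. f s t)"
        using lborel_pair.AE_integrable_snd[OF int_f] .
      then show "AE t in lborel. Re (CLINT s|lborel. f s t) = g t * (L n t / (2 * pi))"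
      proof eventually_elim
        case (elim t)
        have "Re (CLINT s|lborel. f s t) = (LINT s|lborel. Re (f s t))"
          by (rule integral_Re[symmetric]) (rule elim)
        also have "\<dots> = (LINT s|lborel. g t / (2 * pi) * (indicator {- real n..real n} s * \<phi> t s))"
        proof (rule Bochner_Integration.integral_cong[OF refl])
          fix s
          have "f s t = of_real (indicator {- real n..real n} s * g t) * (m s * cis (2 * pi * (s * t)))"
            by (simp add: f_def scaleR_conv_of_real algebra_simps)
          then have "Re (f s t) = indicator {- real n..real n} s * g t * Re (m s * cis (2 * pi * (s * t)))"
            by (simp only: Re_complex_of_real Im_complex_of_real times_complex.sel mult_zero_left diff_zero)
          then show "Re (f s t) = g t / (2 * pi) * (indicator {- real n..real n} s * \<phi> t s)"
            unfolding Re_m by simp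
        qed
        also have "\<dots> = g t / (2 * pi) * L n t"
          unfolding L_def by (rule integral_mult_right_zero)
        finally show ?case by simp
      qed
    qed measurable
    finally show ?thesis .
  qed
  have "(\<lambda>n. CLINT s|lborel. indicator {- real n..real n} s *\<^sub>R (m s * G s)) \<longlonglongrightarrow> (CLINT s|lborel. m s * G s)"
  proof (rule integral_dominated_convergence[where w = "\<lambda>s. cmod (m s * G s)"])
    show "integrable lborel (\<lambda>s. cmod (m s * G s))"
      using int_mG by (rule integrable_norm)
    show "AE s in lborel. (\<lambda>n. indicator {- real n..real n} s *\<^sub>R (m s * G s)) \<longlonglongrightarrow> m s * G s"
    proof (rule AE_I2)
      fix s :: real
      have "\<forall>\<^sub>F n in sequentially. indicator {- real n..real n} s *\<^sub>R (m s * G s) = m s * G s"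
        using eventually_ge_at_top[of "nat \<lceil>\<bar>s\<bar>\<rceil>"]
        by eventually_elim (auto simp: indicator_def nat_ceiling_le_eq)
      then show "(\<lambda>n. indicator {- real n..real n} s *\<^sub>R (m s * G s)) \<longlonglongrightarrow> m s * G s"
        by (rule tendsto_eventually)
    qed
    show "AE s in lborel. norm (indicator {- real n..real n} s *\<^sub>R (m s * G s)) \<le> cmod (m s * G s)" for n
      by (intro AE_I2) (auto simp: indicator_def)
  qed measurable
  then have 1: "(\<lambda>n. LINT t|lborel. g t * (L n t / (2 * pi))) \<longlonglongrightarrow> Re (CLINT s|lborel. m s * G s)"
    unfolding trunc[symmetric] by (rule tendsto_Re)
  have 2: "(\<lambda>n. LINT t|lborel. g t * (L n t / (2 * pi))) \<longlonglongrightarrow> (LINT t|lborel. - (1 / pi) * ((ln \<bar>x - t\<bar> - ln \<bar>t\<bar>) * g t))"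
  proof (rule integral_dominated_convergence[where w = "\<lambda>t. 2 / pi * \<bar>(ln \<bar>x - t\<bar> - ln \<bar>t\<bar>) * g t\<bar>"])
    show "integrable lborel (\<lambda>t. 2 / pi * \<bar>(ln \<bar>x - t\<bar> - ln \<bar>t\<bar>) * g t\<bar>)"
      using ln_g by (intro integrable_mult_right integrable_abs)
    show "AE t in lborel. (\<lambda>n. g t * (L n t / (2 * pi))) \<longlonglongrightarrow> - (1 / pi) * ((ln \<bar>x - t\<bar> - ln \<bar>t\<bar>) * g t)"
      using AE_t
    proof eventually_elim
      case (elim t)
      have "(\<lambda>n. g t / (2 * pi) * L n t) \<longlonglongrightarrow> g t / (2 * pi) * (- 2 * (ln \<bar>x - t\<bar> - ln \<bar>t\<bar>))"
        using elim by (intro tendsto_mult_left L_lim) auto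
      then show ?case by (simp add: algebra_simps diff_divide_distrib)
    qed
    show "AE t in lborel. norm (g t * (L n t / (2 * pi))) \<le> 2 / pi * \<bar>(ln \<bar>x - t\<bar> - ln \<bar>t\<bar>) * g t\<bar>" for n
      using AE_t
    proof eventually_elim
      case (elim t)
      have "\<bar>g t\<bar> / (2 * pi) * \<bar>L n t\<bar> \<le> \<bar>g t\<bar> / (2 * pi) * (4 * \<bar>ln \<bar>x - t\<bar> - ln \<bar>t\<bar>\<bar>)"
        using elim by (intro mult_left_mono L_bound) auto
      then show ?case by (simp add: abs_mult mult.commute)
    qed
  qed measurable
  show ?thesis
    using LIMSEQ_unique[OF 1 2] by simp
qed

text \<open>Integration by parts: the derivative of
  \<open>of_real (g t) * cis (2 * pi * (s * t))\<close> has integral 0 because \<open>g\<close>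
  vanishes at both ends, so \<open>2 * pi * \<bar>s\<bar>\<close> times the transform of
  \<open>g\<close> is bounded by the L1 norm of \<open>g'\<close>.\<close>

lemma fourier_integral_decay:
  fixes g g' :: "real \<Rightarrow> real"
  assumes deriv: "\<And>t. (g has_real_derivative g' t) (at t)" and cont: "\<And>t. isCont g' t"
    and g: "integrable lborel g" and g': "integrable lborel g'"
    and lim: "(g \<longlongrightarrow> 0) at_top" "(g \<longlongrightarrow> 0) at_bot"
  obtains C where "\<And>s. s \<noteq> 0 \<Longrightarrow> cmod (CLINT t|lborel. of_real (g t) * cis (2 * pi * (s * t))) \<le> C / \<bar>s\<bar>"
proof -
  have "cmod (CLINT t|lborel. of_real (g t) * cis (2 * pi * (s * t))) \<le> (LINT t|lborel. \<bar>g' t\<bar>) / (2 * pi) / \<bar>s\<bar>"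
    if s: "s \<noteq> 0" for s
  proof -
    define e where "e t = cis (2 * pi * (s * t))" for t
    have [measurable]: "e \<in> borel_measurable borel"
      unfolding e_def[abs_def] cis_conv_exp by measurable
    have [measurable]: "g \<in> borel_measurable borel" "g' \<in> borel_measurable borel"
      using g g' by auto
    have e': "(e has_vector_derivative \<i> * of_real (2 * pi * s) * e t) (at t)" for t
      unfolding e_def has_vector_derivative_complex_iff
      by (auto intro!: derivative_eq_intros simp: algebra_simps)
    have norm_e: "cmod (e t) = 1" for t
      by (simp add: e_def)
    have cont_e: "isCont e t" for t
      using e' by (rule has_vector_derivative_continuous)
    have int_g: "integrable lborel (\<lambda>t. of_real (g t) * e t)"
      by (rule Bochner_Integration.integrable_bound[OF g]) (auto simp: norm_mult norm_e)
    have int_g': "integrable lborel (\<lambda>t. of_real (g' t) * e t)"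
      by (rule Bochner_Integration.integrable_bound[OF g']) (auto simp: norm_mult norm_e)
    define F where "F t = of_real (g t) * e t" for t
    define f where "f t = of_real (g' t) * e t + \<i> * of_real (2 * pi * s) * (of_real (g t) * e t)" for t
    have int_f: "integrable lborel f"
      unfolding f_def[abs_def] using int_g int_g' by auto
    have F_lim: "(F \<longlongrightarrow> 0) FF" if "(g \<longlongrightarrow> 0) FF" for FF
      using that by (intro tendsto_norm_zero_cancel[of F]) (simp add: F_def norm_mult norm_e tendsto_rabs_zero)
    have "(LBINT t=-\<infinity>..\<infinity>. f t) = 0 - 0"
    proof (rule interval_integral_FTC_integrable)
      show "(F has_vector_derivative f t) (at t)" for t
      proof -
        have "((\<lambda>t. of_real (g t)) has_vector_derivative complex_of_real (g' t)) (at t)"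
          using deriv[of t] by (rule has_vector_derivative_of_real)
        from has_vector_derivative_mult[OF this e'[of t]] show ?thesis
          unfolding F_def[abs_def] f_def by (simp add: algebra_simps)
      qed
      show "isCont f t" for t
        unfolding f_def using cont cont_e DERIV_isCont[OF deriv]
        by (intro continuous_intros isCont_of_real) auto
      show "set_integrable lborel (einterval (-\<infinity>) \<infinity>) f"
        using int_f by (simp add: set_integrable_def einterval_def)
      show "((F \<circ> real_of_ereal) \<longlongrightarrow> 0) (at_right (-\<infinity>))" "((F \<circ> real_of_ereal) \<longlongrightarrow> 0) (at_left \<infinity>)"
        unfolding ereal_tendsto_simps using F_lim lim by auto
    qed auto
    then have "(CLINT t|lborel. f t) = 0"
      by (simp add: interval_lebesgue_integral_def set_lebesgue_integral_def einterval_def)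
    then have "(CLINT t|lborel. of_real (g' t) * e t) + \<i> * of_real (2 * pi * s) * (CLINT t|lborel. of_real (g t) * e t) = 0"
      unfolding f_def using int_g int_g' by simp
    then have "cmod (CLINT t|lborel. of_real (g' t) * e t) = cmod (\<i> * of_real (2 * pi * s) * (CLINT t|lborel. of_real (g t) * e t))"
      by (metis add_eq_0_iff norm_minus_cancel)
    also have "\<dots> = 2 * pi * \<bar>s\<bar> * cmod (CLINT t|lborel. of_real (g t) * e t)"
      by (simp add: norm_mult)
    finally have "2 * pi * \<bar>s\<bar> * cmod (CLINT t|lborel. of_real (g t) * e t) \<le> (LINT t|lborel. cmod (of_real (g' t) * e t))"
      using integral_norm_bound[of lborel "\<lambda>t. of_real (g' t) * e t"] by simp
    then show ?thesis
      unfolding e_def[symmetric] using s by (simp add: norm_mult norm_e field_simps)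
  qed
  then show ?thesis by (rule that)
qed

text \<open>Carries integrals over \<open>real^'n\<close> with a single coordinate to integrals over
  \<open>real\<close>. The only basis vector is \<open>axis i 1\<close>, so boxes pull back to
  intervals of the same length.\<close>

lemma lborel_eq_distr_axis:
  assumes "CARD('n) = 1"
  shows "(lborel :: (real^'n) measure) = distr lborel borel (\<lambda>t. t *\<^sub>R axis i 1)"
proof (rule lborel_eqI)
  have U: "(UNIV :: 'n set) = {i}"
    using assms by (metis UNIV_I card_1_singletonE singletonD)
  have B: "(Basis :: (real^'n) set) = {axis i 1}"
    by (simp add: Basis_vec_def U)
  have comp: "v \<bullet> axis i 1 = v $ i" for v :: "real^'n"
    by (simp add: inner_axis)
  fix l u :: "real^'n" assume le: "\<And>b. b \<in> Basis \<Longrightarrow> l \<bullet> b \<le> u \<bullet> b"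
  have "(\<lambda>t. t *\<^sub>R axis i 1) -` box l u = {l $ i<..<u $ i}"
    by (auto simp: box_def B comp)
  moreover have "l $ i \<le> u $ i" using le[of "axis i 1"] by (simp add: B comp)
  ultimately show "emeasure (distr lborel borel (\<lambda>t. t *\<^sub>R axis i 1)) (box l u) = (\<Prod>b\<in>Basis. (u - l) \<bullet> b)"
    by (subst emeasure_distr) (auto simp: B comp)
qed simp

lemma integral_dim_one:
  fixes f :: "real^'n \<Rightarrow> 'b::{banach, second_countable_topology}"
  assumes "CARD('n) = 1" and [measurable]: "f \<in> borel_measurable borel"
  shows "integral\<^sup>L lborel f = (LINT t|lborel. f (t *\<^sub>R axis i 1))"
  by (subst lborel_eq_distr_axis[OF assms(1), of i], subst integral_distr) auto

lemma integrable_dim_one: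
  fixes f :: "real^'n \<Rightarrow> 'b::{banach, second_countable_topology}"
  assumes "CARD('n) = 1" and [measurable]: "f \<in> borel_measurable borel"
  shows "integrable lborel f \<longleftrightarrow> integrable lborel (\<lambda>t. f (t *\<^sub>R axis i 1))"
  by (subst lborel_eq_distr_axis[OF assms(1), of i], subst integrable_distr_eq) auto

lemma fractional_integral_dim_one:
  fixes f :: "real^'n \<Rightarrow> real" and i :: 'n
  assumes d: "CARD('n) = 1" and [measurable]: "f \<in> borel_measurable borel"
    and deriv: "\<And>t. ((\<lambda>t. f (t *\<^sub>R axis i 1)) has_real_derivative g' t) (at t)" and cont: "\<And>t. isCont g' t"
    and g: "integrable lborel (\<lambda>t. f (t *\<^sub>R axis i 1))" and g': "integrable lborel g'"
    and lim: "((\<lambda>t. f (t *\<^sub>R axis i 1)) \<longlongrightarrow> 0) at_top" "((\<lambda>t. f (t *\<^sub>R axis i 1)) \<longlongrightarrow> 0) at_bot"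
    and int: "integrable lborel (\<lambda>z. kernel_diff 0 x 0 z * f z)"
  shows "fractional_integral 1 f x = - (1 / pi) * (LINT z|lborel. kernel_diff 0 x 0 z * f z)"
proof -
  let ?u = "axis i 1 :: real^'n"
  have U: "(UNIV :: 'n set) = {i}"
    using d by (metis UNIV_I card_1_singletonE singletonD)
  have x: "x = (x $ i) *\<^sub>R ?u"
    using U by (auto simp: vec_eq_iff axis_def)
  have uu: "?u \<bullet> ?u = 1" by (simp add: inner_axis_axis)
  have norm_u: "norm (s *\<^sub>R ?u) = \<bar>s\<bar>" for s by simp
  have [measurable]: "inverse_fourier f \<in> borel_measurable borel"
    unfolding inverse_fourier_def[abs_def] cis_conv_exp by measurable
  have [measurable]: "modified_kernel_fourier 1 x \<in> borel_measurable borel"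
    unfolding modified_kernel_fourier_def[abs_def] cis_conv_exp by measurable
  have ift: "inverse_fourier f (s *\<^sub>R ?u) = (CLINT t|lborel. of_real (f (t *\<^sub>R ?u)) * cis (2 * pi * (s * t)))" for s
  proof -
    have "(\<lambda>y. complex_of_real (f y) * cis (2 * pi * (s *\<^sub>R ?u \<bullet> y))) \<in> borel_measurable borel"
      unfolding cis_conv_exp by measurable
    then show ?thesis
      unfolding inverse_fourier_def by (subst integral_dim_one[OF d, of _ i]) (simp_all add: uu mult.commute[of _ s])
  qed
  have kd: "kernel_diff 0 x 0 (t *\<^sub>R ?u) = ln \<bar>x $ i - t\<bar> - ln \<bar>t\<bar>" for t
    by (subst x) (simp add: kernel_diff_def radial_primitive_def norm_u flip: scaleR_left_diff_distrib)
  obtain C where C: "\<And>s. s \<noteq> 0 \<Longrightarrow>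
      cmod (CLINT t|lborel. of_real (f (t *\<^sub>R ?u)) * cis (2 * pi * (s * t))) \<le> C / \<bar>s\<bar>"
    using fourier_integral_decay[OF deriv cont g g' lim] by blast
  have mk: "modified_kernel_fourier 1 x (s *\<^sub>R ?u)
      = of_real (1 / (2 * pi)) * (cis (- 2 * pi * (s * (x $ i))) - 1) / of_real \<bar>s\<bar>" for s
    by (subst x) (simp add: modified_kernel_fourier_def uu powr_minus_divide mult.commute[of s])
  have "fractional_integral 1 f x = Re (CLINT \<xi>|lborel. modified_kernel_fourier 1 x \<xi> * inverse_fourier f \<xi>)"
    using d by (simp add: fractional_integral_def)
  also have "(CLINT \<xi>|lborel. modified_kernel_fourier 1 x \<xi> * inverse_fourier f \<xi>)
      = (CLINT s|lborel. modified_kernel_fourier 1 x (s *\<^sub>R ?u) * inverse_fourier f (s *\<^sub>R ?u))"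
    by (rule integral_dim_one[OF d]) measurable
  also have "Re \<dots> = - (1 / pi) * (LINT t|lborel. (ln \<bar>x $ i - t\<bar> - ln \<bar>t\<bar>) * f (t *\<^sub>R ?u))"
    unfolding ift mk
  proof (rule log_kernel_pairing)
    show "integrable lborel (\<lambda>t. (ln \<bar>x $ i - t\<bar> - ln \<bar>t\<bar>) * f (t *\<^sub>R ?u))"
      using int by (subst (asm) integrable_dim_one[OF d, of _ i]) (simp_all add: kd)
    show "cmod (CLINT t|lborel. of_real (f (t *\<^sub>R ?u)) * cis (2 * pi * (s * t))) \<le> C / \<bar>s\<bar>"
      if "1 \<le> \<bar>s\<bar>" for s
      using C[of s] that by auto
  qed (rule g)
  also have "(LINT t|lborel. (ln \<bar>x $ i - t\<bar> - ln \<bar>t\<bar>) * f (t *\<^sub>R ?u)) = (LINT z|lborel. kernel_diff 0 x 0 z * f z)"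
    by (subst integral_dim_one[OF d, of _ i]) (simp_all add: kd)
  finally show ?thesis .
qed

section \<open>Wavelet coefficients of the kernel\<close>

lemma regular_decay:
  assumes "regular r f"
  obtains C where "\<And>x. \<bar>f x\<bar> \<le> C / (1 + norm x) ^ m"
  using assms unfolding regular_def by (metis le0 sum.neutral_const)

lemma wavelet_in_L2:
  assumes "regular_orthonormal_wavelet_basis r \<psi>" "e \<in> wavelet_types"
  shows "wavelet \<psi> j k e \<in> L2"
  using assms unfolding regular_orthonormal_wavelet_basis_def orthonormal_basis_of_def total_in_def by force

lemma wavelet_eq_affine:
  "wavelet \<psi> j k e = (\<lambda>x. 2 powr (real CARD('n) * real_of_int j / 2)
     * \<psi> e (- real_vec k + 2 powr real_of_int j *\<^sub>R (x :: real^'n)))"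
  by (simp add: fun_eq_iff wavelet_def)

lemma mother_wavelet_measurable:
  fixes \<psi> :: "int^'n \<Rightarrow> real^'n \<Rightarrow> real"
  assumes "regular_orthonormal_wavelet_basis r \<psi>" "e \<in> wavelet_types"
  shows "\<psi> e \<in> borel_measurable borel"
proof -
  have "real_vec (0 :: int^'n) = 0"
    by (simp add: real_vec_def vec_eq_iff)
  then have "wavelet \<psi> 0 0 e = \<psi> e"
    by (simp add: fun_eq_iff wavelet_def)
  then show ?thesis
    using wavelet_in_L2[OF assms, of 0 0] by (simp add: L2_imp_measurable)
qed

lemma wavelet_bounded:
  fixes \<psi> :: "int^'n \<Rightarrow> real^'n \<Rightarrow> real"
  assumes "regular_orthonormal_wavelet_basis r \<psi>" "e \<in> wavelet_types"
  obtains B where "\<And>x. \<bar>wavelet \<psi> j k e x\<bar> \<le> B"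
proof -
  have "regular r (\<psi> e)"
    using assms by (auto simp: regular_orthonormal_wavelet_basis_def)
  then obtain C where C: "\<And>x. \<bar>\<psi> e x\<bar> \<le> C / (1 + norm x) ^ 0"
    using regular_decay[of r "\<psi> e" 0] by blast
  have "\<bar>wavelet \<psi> j k e x\<bar> \<le> 2 powr (real CARD('n) * real_of_int j / 2) * C" for x
    using C unfolding wavelet_eq_affine abs_mult by (auto intro!: mult_mono)
  then show ?thesis by (rule that)
qed

text \<open>Membership in \<open>L2\<close> alone does not give this; decay of the mother wavelet of
  order \<open>d + 1\<close> does, and a change of variables passes it on to dilates and
  translates.\<close>

lemma wavelet_integrable:
  fixes \<psi> :: "int^'n \<Rightarrow> real^'n \<Rightarrow> real"
  assumes \<psi>: "regular_orthonormal_wavelet_basis r \<psi>" and e: "e \<in> wavelet_types"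
  shows "integrable lborel (wavelet \<psi> j k e)"
proof -
  let ?d = "CARD('n)"
  have [measurable]: "\<psi> e \<in> borel_measurable borel"
    using assms by (rule mother_wavelet_measurable)
  have "regular r (\<psi> e)"
    using assms by (auto simp: regular_orthonormal_wavelet_basis_def)
  then obtain C where C: "\<And>x. \<bar>\<psi> e x\<bar> \<le> C / (1 + norm x) ^ (?d + 1)"
    using regular_decay[of r "\<psi> e" "?d + 1"] by blast
  have "0 \<le> C" using order_trans[OF abs_ge_zero C[of 0]] by simp
  let ?out = "\<lambda>x :: real^'n. ennreal (norm x powr - real (?d + 1)) * indicator (- ball 0 1) x"
  have "(\<integral>\<^sup>+x. ennreal \<bar>\<psi> e x\<bar> \<partial>lborel) \<le> (\<integral>\<^sup>+x. ennreal C * indicator (ball 0 1) x + ennreal C * ?out x \<partial>lborel)"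
  proof (rule nn_integral_mono)
    fix x :: "real^'n"
    show "ennreal \<bar>\<psi> e x\<bar> \<le> ennreal C * indicator (ball 0 1) x + ennreal C * ?out x"
    proof (cases "norm x < 1")
      case True
      have "C / (1 + norm x) ^ (?d + 1) \<le> C / 1"
        using \<open>0 \<le> C\<close> by (intro divide_left_mono one_le_power mult_pos_pos zero_less_power) (auto intro: add_pos_nonneg)
      with C[of x] have "\<bar>\<psi> e x\<bar> \<le> C" by linarith
      then show ?thesis using True by (simp add: ennreal_leI)
    next
      case False
      have "C / (1 + norm x) ^ (?d + 1) \<le> C / norm x ^ (?d + 1)"
        using \<open>0 \<le> C\<close> False by (intro divide_left_mono power_mono mult_pos_pos zero_less_power) auto
      also have "\<dots> = C * norm x powr - real (?d + 1)"
        using False powr_realpow[of "norm x" "?d + 1"] by (simp only: powr_minus_divide) simp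
      finally have "\<bar>\<psi> e x\<bar> \<le> C * norm x powr - real (?d + 1)"
        using C[of x] by linarith
      then show ?thesis using False \<open>0 \<le> C\<close> by (simp add: ennreal_mult[symmetric] ennreal_leI)
    qed
  qed
  also have "\<dots> = ennreal C * emeasure lborel (ball (0::real^'n) 1) + ennreal C * (\<integral>\<^sup>+x. ?out x \<partial>lborel)"
    by (subst nn_integral_add) (simp_all add: nn_integral_cmult)
  also have "\<dots> < \<infinity>"
  proof -
    have "(\<integral>\<^sup>+x. ?out x \<partial>lborel) < \<infinity>"
      by (rule nn_integral_powr_outside_ball_finite) auto
    then show ?thesis
      by (simp add: ennreal_mult_less_top emeasure_ball)
  qed
  finally have fin: "(\<integral>\<^sup>+x. ennreal \<bar>\<psi> e x\<bar> \<partial>lborel) < \<infinity>" .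
  let ?c = "2 powr real_of_int j" and ?t = "- real_vec k :: real^'n"
  have "ennreal (\<bar>?c\<bar> ^ DIM(real^'n)) * (\<integral>\<^sup>+x. ennreal \<bar>\<psi> e (?t + ?c *\<^sub>R x)\<bar> \<partial>lborel) < \<infinity>"
    using fin nn_integral_affine[of "\<lambda>x. ennreal \<bar>\<psi> e x\<bar>" ?c ?t] by simp
  then have "(\<integral>\<^sup>+x. ennreal \<bar>\<psi> e (?t + ?c *\<^sub>R x)\<bar> \<partial>lborel) < \<infinity>"
    by (auto simp: ennreal_mult_less_top)
  then have "integrable lborel (\<lambda>x. \<psi> e (?t + ?c *\<^sub>R x))"
    by (intro integrableI_bounded) auto
  then show ?thesis
    unfolding wavelet_eq_affine by (rule integrable_mult_right)
qed

lemma integrable_if_bounded_by_decay: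
  fixes f :: "real \<Rightarrow> real"
  assumes [measurable]: "f \<in> borel_measurable borel" and C: "\<And>s. \<bar>f s\<bar> \<le> C / (1 + \<bar>s\<bar>) ^ 2"
  shows "integrable lborel f"
proof -
  have C0: "0 \<le> C" using order_trans[OF abs_ge_zero C[of 0]] by simp
  have "integrable lborel (\<lambda>s. complex_of_real (f s))"
  proof (rule integrable_if_bounded_by_inverse_square)
    fix s :: real
    have "C / (1 + \<bar>s\<bar>) ^ 2 \<le> C / 1"
      using C0 by (intro divide_left_mono one_le_power) auto
    then show "cmod (of_real (f s)) \<le> C" using C[of s] by simp
    assume "1 \<le> \<bar>s\<bar>"
    then have "C / (1 + \<bar>s\<bar>) ^ 2 \<le> C / \<bar>s\<bar> ^ 2"
      using C0 by (intro divide_left_mono power_mono mult_pos_pos zero_less_power) auto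
    then show "cmod (of_real (f s)) \<le> C / s\<^sup>2" using C[of s] by simp
  qed measurable
  from integrable_Re[OF this] show ?thesis by simp
qed

lemma wavelet_fractional_integral_dim_one:
  fixes \<psi> :: "int^'n \<Rightarrow> real^'n \<Rightarrow> real"
  assumes \<psi>: "regular_orthonormal_wavelet_basis r \<psi>" and e: "e \<in> wavelet_types"
    and d: "CARD('n) = 1" and r: "2 \<le> r"
  shows "fractional_integral 1 (wavelet \<psi> j k e) x = - (1 / pi) * (LINT z|lborel. kernel_diff 0 x 0 z * wavelet \<psi> j k e z)"
proof -
  obtain i where U: "(UNIV :: 'n set) = {i}"
    using d by (metis card_1_singletonE)
  let ?u = "axis i 1 :: real^'n"
  have "regular r (\<psi> e)"
    using \<psi> e by (auto simp: regular_orthonormal_wavelet_basis_def)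
  then obtain D where D0: "D (\<lambda>_. 0) = \<psi> e"
    and D: "\<And>\<alpha> i x. (\<Sum>l\<in>UNIV. \<alpha> l) < r \<Longrightarrow>
           ((\<lambda>t. D \<alpha> (x + t *\<^sub>R axis i 1)) has_real_derivative D (\<alpha>(i := Suc (\<alpha> i))) x) (at 0)"
    and bound: "\<And>\<alpha> m. (\<Sum>l\<in>UNIV. \<alpha> l) \<le> r \<Longrightarrow> \<exists>C. \<forall>x. \<bar>D \<alpha> x\<bar> \<le> C / (1 + norm x) ^ (m::nat)"
    unfolding regular_def by blast
  define \<alpha> where "\<alpha> = (\<lambda>_::'n. 0::nat)(i := Suc 0)"
  have D_shift: "((\<lambda>t. D \<beta> (t *\<^sub>R ?u)) has_real_derivative D (\<beta>(i := Suc (\<beta> i))) (t *\<^sub>R ?u)) (at t)"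
    if "(\<Sum>l\<in>UNIV. \<beta> l) < r" for \<beta> t
    using D[OF that, of "t *\<^sub>R ?u" i] DERIV_shift[of "\<lambda>t. D \<beta> (t *\<^sub>R ?u)" _ 0 t]
    by (simp add: scaleR_left_distrib add.commute)
  define h where "h t = \<psi> e (t *\<^sub>R ?u)" for t
  define h' where "h' t = D \<alpha> (t *\<^sub>R ?u)" for t
  have sum_\<alpha>: "(\<Sum>l\<in>UNIV. \<alpha> l) = 1" by (simp add: U \<alpha>_def)
  have h: "(h has_real_derivative h' t) (at t)" for t
    using D_shift[of "\<lambda>_. 0" t] r by (simp add: h_def[abs_def] h'_def D0 \<alpha>_def)
  \<comment> \<open>Continuity of the first derivative is drawn from the existence of the second,
    which is where \<open>2 \<le> r\<close> enters.\<close>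
  have h'_cont: "isCont h' t" for t
    unfolding h'_def[abs_def] using D_shift[of \<alpha> t] r sum_\<alpha> by (intro DERIV_isCont) auto
  have h_cont: "isCont h t" for t
    using h by (rule DERIV_isCont)
  have [measurable]: "h \<in> borel_measurable borel" "h' \<in> borel_measurable borel"
    using h_cont h'_cont by (auto intro!: borel_measurable_continuous_onI continuous_at_imp_continuous_on)
  have "\<exists>C. \<forall>x. \<bar>\<psi> e x\<bar> \<le> C / (1 + norm x) ^ 2"
    using bound[of "\<lambda>_. 0" 2] by (simp add: D0)
  then obtain C where "\<bar>\<psi> e x\<bar> \<le> C / (1 + norm x) ^ 2" for x
    by blast
  from this[of "_ *\<^sub>R ?u"] have C: "\<bar>h t\<bar> \<le> C / (1 + \<bar>t\<bar>) ^ 2" for t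
    by (simp add: h_def)
  have "\<exists>C. \<forall>x. \<bar>D \<alpha> x\<bar> \<le> C / (1 + norm x) ^ 2"
    using bound[of \<alpha> 2] r by (simp add: sum_\<alpha>)
  then obtain C' where "\<bar>D \<alpha> x\<bar> \<le> C' / (1 + norm x) ^ 2" for x
    by blast
  from this[of "_ *\<^sub>R ?u"] have C': "\<bar>h' t\<bar> \<le> C' / (1 + \<bar>t\<bar>) ^ 2" for t
    by (simp add: h'_def)
  have int: "integrable lborel h" "integrable lborel h'"
    using C C' by (auto intro!: integrable_if_bounded_by_decay)
  define l where "l = 2 powr real_of_int j"
  have l: "0 < l" by (simp add: l_def)
  define c where "c = 2 powr (real CARD('n) * real_of_int j / 2)"
  define \<kappa> where "\<kappa> = - real_of_int (k $ i)"
  have k: "- real_vec k = \<kappa> *\<^sub>R ?u"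
    using U by (auto simp: vec_eq_iff axis_def \<kappa>_def real_vec_def)
  have w: "wavelet \<psi> j k e (t *\<^sub>R ?u) = c * h (\<kappa> + l * t)" for t
    unfolding wavelet_eq_affine k h_def c_def l_def by (simp add: scaleR_left_distrib)
  have abs_lim: "filterlim (\<lambda>t. \<bar>\<kappa> + l * t\<bar>) at_top at_top" "filterlim (\<lambda>t. \<bar>\<kappa> + l * t\<bar>) at_top at_bot"
  proof -
    have "filterlim (\<lambda>t. norm (\<kappa> + l * t)) at_top at_top"
      by (intro filterlim_at_infinity_imp_norm_at_top filterlim_at_top_imp_at_infinity
          filterlim_tendsto_add_at_top[OF tendsto_const]
          filterlim_tendsto_pos_mult_at_top[OF tendsto_const l] filterlim_ident)
    then show "filterlim (\<lambda>t. \<bar>\<kappa> + l * t\<bar>) at_top at_top" by simp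
    have "filterlim (\<lambda>t. norm (\<kappa> + l * t)) at_top at_bot"
      by (intro filterlim_at_infinity_imp_norm_at_top filterlim_at_bot_imp_at_infinity
          filterlim_tendsto_add_at_bot_iff[OF tendsto_const, THEN iffD2]
          filterlim_tendsto_pos_mult_at_bot[OF tendsto_const l] filterlim_ident)
    then show "filterlim (\<lambda>t. \<bar>\<kappa> + l * t\<bar>) at_top at_bot" by simp
  qed
  have f_L2: "wavelet \<psi> j k e \<in> L2"
    using \<psi> e by (rule wavelet_in_L2)
  have lim: "((\<lambda>t. c * h (\<kappa> + l * t)) \<longlongrightarrow> 0) FF" if "filterlim (\<lambda>t. \<bar>\<kappa> + l * t\<bar>) at_top FF" for FF
  proof -
    have "((\<lambda>t. h (\<kappa> + l * t)) \<longlongrightarrow> 0) FF"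
    proof (rule Lim_null_comparison)
      show "\<forall>\<^sub>F t in FF. norm (h (\<kappa> + l * t)) \<le> C / (1 + \<bar>\<kappa> + l * t\<bar>) ^ 2"
        using C by simp
      show "((\<lambda>t. C / (1 + \<bar>\<kappa> + l * t\<bar>) ^ 2) \<longlongrightarrow> 0) FF"
        by (intro real_tendsto_divide_at_top[OF tendsto_const] filterlim_pow_at_top
            filterlim_tendsto_add_at_top[OF tendsto_const that]) simp
    qed
    from tendsto_mult_right_zero[OF this, of c] show ?thesis .
  qed
  show ?thesis
  proof (rule fractional_integral_dim_one[OF d, where i = i and g' = "\<lambda>t. c * (h' (\<kappa> + l * t) * l)"])
    show "wavelet \<psi> j k e \<in> borel_measurable borel"
      using f_L2 by (rule L2_imp_measurable)
    show "((\<lambda>t. wavelet \<psi> j k e (t *\<^sub>R ?u)) has_real_derivative c * (h' (\<kappa> + l * t) * l)) (at t)" for t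
      unfolding w by (intro DERIV_cmult DERIV_chain2[OF h]) (auto intro!: derivative_eq_intros)
    show "isCont (\<lambda>t. c * (h' (\<kappa> + l * t) * l)) t" for t
      by (intro continuous_intros isCont_o2[OF _ h'_cont])
    show "integrable lborel (\<lambda>t. wavelet \<psi> j k e (t *\<^sub>R ?u))"
      unfolding w using l by (intro integrable_mult_right lborel_integrable_real_affine int) auto
    show "integrable lborel (\<lambda>t. c * (h' (\<kappa> + l * t) * l))"
      using l by (intro integrable_mult_right integrable_mult_left lborel_integrable_real_affine int) auto
    show "((\<lambda>t. wavelet \<psi> j k e (t *\<^sub>R ?u)) \<longlongrightarrow> 0) at_top" "((\<lambda>t. wavelet \<psi> j k e (t *\<^sub>R ?u)) \<longlongrightarrow> 0) at_bot"
      unfolding w by (intro lim abs_lim)+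
    show "integrable lborel (\<lambda>z. kernel_diff 0 x 0 z * wavelet \<psi> j k e z)"
      using d by (intro L2_imp_integrable_mult f_L2 kernel_diff_L2) auto
  qed
qed

section \<open>Energy of random graphs\<close>

text \<open>Cutting down to the unit ball makes the reference measure finite; a lower bound for the
  dimension of this piece is one for the whole graph.\<close>

definition graph_energy :: "real \<Rightarrow> ('a::euclidean_space \<Rightarrow> real) \<Rightarrow> ennreal" where
  "graph_energy t g =
     (\<integral>\<^sup>+x. (\<integral>\<^sup>+y. ennreal (dist (x, g x) (y, g y) powr - t) * indicator (ball 0 1) y \<partial>lborel)
        * indicator (ball 0 1) x \<partial>lborel)"

lemma hausdorff_dim_graph_ge:
  fixes g :: "'a::euclidean_space \<Rightarrow> real"
  assumes [measurable]: "g \<in> borel_measurable borel"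
    and energy: "\<And>s. 0 \<le> s \<Longrightarrow> s < \<beta> \<Longrightarrow> \<exists>t\<ge>s. 0 < t \<and> graph_energy t g < \<infinity>"
  shows "ereal \<beta> \<le> hausdorff_dim (range (\<lambda>x. (x, g x)))"
proof (rule hausdorff_dim_ge)
  fix s assume s: "0 \<le> s" "s < \<beta>"
  then obtain t where t: "s \<le> t" "0 < t" "graph_energy t g < \<infinity>"
    using energy by blast
  show "hausdorff_measure s (range (\<lambda>x. (x, g x))) \<noteq> 0"
  proof (rule hausdorff_measure_nonzero_if_finite_energy[where t = t and B = "ball 0 1"])
    show "(\<lambda>x. (x, g x)) \<in> borel \<rightarrow>\<^sub>M borel"
      by (subst borel_prod[symmetric]) measurable
    show "inj (\<lambda>x. (x, g x))" by (auto simp: inj_def)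
    show "emeasure lborel (ball 0 1 :: 'a set) \<noteq> 0"
      by (simp add: emeasure_ball less_imp_neq[OF unit_ball_vol_pos, symmetric])
  qed (use s t in \<open>auto simp: graph_energy_def\<close>)
qed

text \<open>For \<open>x\<close> and \<open>y\<close> in the unit ball the difference stays in the
  ball of radius 2, so one constant bounds the inner integral for all \<open>x\<close>.\<close>

lemma riesz_energy_finite:
  fixes a :: real
  assumes a: "0 \<le> a" "a < real DIM('a::euclidean_space)"
  shows "(\<integral>\<^sup>+x. (\<integral>\<^sup>+y. ennreal (norm (x - y :: 'a) powr - a) * indicator (ball 0 1) y \<partial>lborel)
    * indicator (ball 0 1) x \<partial>lborel) < \<infinity>"
proof -
  define f where "f w = ennreal (norm w powr - a) * indicator (ball 0 2) w" for w :: 'a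
  have [measurable]: "f \<in> borel_measurable borel"
    unfolding f_def[abs_def] by measurable
  have fin: "(\<integral>\<^sup>+w. f w \<partial>lborel) < \<infinity>"
    unfolding f_def using a by (intro nn_integral_powr_ball_finite) auto
  have "(\<integral>\<^sup>+x. (\<integral>\<^sup>+y. ennreal (norm (x - y :: 'a) powr - a) * indicator (ball 0 1) y \<partial>lborel)
      * indicator (ball 0 1) x \<partial>lborel)
    \<le> (\<integral>\<^sup>+x. (\<integral>\<^sup>+w. f w \<partial>lborel) * indicator (ball (0::'a) 1) x \<partial>lborel)"
  proof (rule nn_integral_mono)
    fix x :: 'a
    show "(\<integral>\<^sup>+y. ennreal (norm (x - y) powr - a) * indicator (ball 0 1) y \<partial>lborel) * indicator (ball 0 1) x
        \<le> (\<integral>\<^sup>+w. f w \<partial>lborel) * indicator (ball 0 1) x"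
    proof (cases "x \<in> ball 0 1")
      case True
      have "(\<integral>\<^sup>+y. ennreal (norm (x - y) powr - a) * indicator (ball 0 1) y \<partial>lborel) \<le> (\<integral>\<^sup>+y. f (x - y) \<partial>lborel)"
      proof (rule nn_integral_mono)
        fix y :: 'a
        have "norm (x - y) < 2" if "norm y < 1"
          using that True norm_triangle_ineq4[of x y] by simp
        then show "ennreal (norm (x - y) powr - a) * indicator (ball 0 1) y \<le> f (x - y)"
          by (auto simp: f_def indicator_def)
      qed
      then show ?thesis using True by (simp add: nn_integral_reflect)
    qed auto
  qed
  also have "\<dots> = (\<integral>\<^sup>+w. f w \<partial>lborel) * emeasure lborel (ball (0::'a) 1)"
    by (simp add: nn_integral_cmult)
  also have "\<dots> < \<infinity>"
    using fin by (simp add: ennreal_mult_less_top emeasure_ball)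
  finally show ?thesis .
qed

lemma dist_graph_ge:
  fixes x y :: "'a::metric_space" and a b :: real
  shows "dist x y \<le> dist (x, a) (y, b)" "\<bar>a - b\<bar> \<le> dist (x, a) (y, b)"
  using dist_fst_le[of "(x, a)" "(y, b)"] dist_snd_le[of "(x, a)" "(y, b)"] by (auto simp: dist_real_def)

text \<open>Distances in the graph dominate those in the domain, so the energy is at most a Riesz
  energy, whatever the function \<open>g\<close> is.\<close>

lemma graph_energy_finite_below_dimension:
  fixes g :: "'a::euclidean_space \<Rightarrow> real"
  assumes t: "0 < t" "t < real DIM('a)"
  shows "graph_energy t g < \<infinity>"
proof -
  have "graph_energy t g \<le> (\<integral>\<^sup>+x. (\<integral>\<^sup>+y. ennreal (norm (x - y :: 'a) powr - t) * indicator (ball 0 1) y \<partial>lborel)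
    * indicator (ball 0 1) x \<partial>lborel)"
    unfolding graph_energy_def
  proof (intro nn_integral_mono mult_right_mono)
    fix x y :: 'a
    show "ennreal (dist (x, g x) (y, g y) powr - t) \<le> ennreal (norm (x - y) powr - t)"
    proof (cases "x = y")
      case False
      then show ?thesis
        using t dist_graph_ge(1)[of x y "g x" "g y"]
        by (intro ennreal_leI powr_mono2') (auto simp: dist_norm)
    qed auto
  qed auto
  also have "\<dots> < \<infinity>"
    using t by (intro riesz_energy_finite) auto
  finally show ?thesis .
qed

lemma hausdorff_dim_graph_ge_dimension:
  fixes g :: "'a::euclidean_space \<Rightarrow> real"
  assumes "g \<in> borel_measurable borel"
  shows "ereal (real DIM('a)) \<le> hausdorff_dim (range (\<lambda>x. (x, g x)))"
proof (rule hausdorff_dim_graph_ge[OF assms])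
  fix s :: real assume s: "0 \<le> s" "s < real DIM('a)"
  then obtain t where "s < t" "t < real DIM('a)"
    using dense by blast
  with s graph_energy_finite_below_dimension[of t g]
  show "\<exists>t\<ge>s. 0 < t \<and> graph_energy t g < \<infinity>"
    by (intro exI[of _ t]) auto
qed

section \<open>Expected energy of a random graph\<close>

lemma measurable_uncurry_compose:
  assumes "(\<lambda>(x, \<omega>). Y x \<omega>) \<in> borel_measurable (borel \<Otimes>\<^sub>M M)" "f \<in> N \<rightarrow>\<^sub>M borel" "g \<in> N \<rightarrow>\<^sub>M M"
  shows "(\<lambda>w. Y (f w) (g w)) \<in> borel_measurable N"
  using measurable_compose[OF measurable_Pair[OF assms(2,3)] assms(1)] by simp

text \<open>After exchanging expectation and integrals, the expected kernel contributes the exponent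
  \<open>1 - t\<close> from the distance and \<open>- h\<close> from the scale of the increment,
  which leaves a Riesz energy of exponent \<open>t + h - 1 < d\<close>.\<close>

lemma (in prob_space) AE_graph_energy_finite:
  fixes Y :: "'b::euclidean_space \<Rightarrow> 'a \<Rightarrow> real"
  assumes Y: "(\<lambda>(x, \<omega>). Y x \<omega>) \<in> borel_measurable (borel \<Otimes>\<^sub>M M)"
    and char: "\<And>x y \<xi>. x \<noteq> y \<Longrightarrow> cmod (CLINT \<omega>|M. iexp (\<xi> * (Y x \<omega> - Y y \<omega>)))
                  \<le> exp 1 * exp (- (c * norm (x - y) powr h * \<bar>\<xi>\<bar>))"
    and c: "0 < c" and h: "0 \<le> h" and t: "1 < t" "t + h < real DIM('b) + 1"
  shows "AE \<omega> in M. graph_energy t (\<lambda>x. Y x \<omega>) < \<infinity>"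
proof -
  interpret L: pair_sigma_finite M "lborel :: 'b measure" ..
  note Y_meas [measurable (raw)] = measurable_uncurry_compose[OF Y]
  let ?B = "ball (0::'b) 1"
  define D where "D x y \<omega> = ennreal (sqrt ((dist x y)\<^sup>2 + (Y x \<omega> - Y y \<omega>)\<^sup>2) powr - t)" for x y \<omega>
  have energy_eq: "graph_energy t (\<lambda>x. Y x \<omega>)
      = (\<integral>\<^sup>+x. (\<integral>\<^sup>+y. D x y \<omega> * indicator ?B y \<partial>lborel) * indicator ?B x \<partial>lborel)" for \<omega>
    by (simp add: graph_energy_def D_def dist_Pair_Pair dist_real_def)
  define a where "a = t + h - 1"
  define K where "K = 2 * exp 3 / (1 - 2 powr (1 - t)) / c"
  have K: "0 \<le> K"
    using c t by (simp add: K_def powr_le_one_le less_imp_le powr_less_one)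
  have pointwise: "(\<integral>\<^sup>+\<omega>. D x y \<omega> \<partial>M) \<le> ennreal K * ennreal (norm (x - y) powr - a)" if "x \<noteq> y" for x y
  proof -
    have [measurable]: "Y x \<in> borel_measurable M" for x
      by (rule Y_meas) auto
    have pos: "0 < norm (x - y)" using that by simp
    have "(\<integral>\<^sup>+\<omega>. D x y \<omega> \<partial>M)
        \<le> ennreal (2 * exp 3 / (1 - 2 powr (1 - t)) * norm (x - y) powr (1 - t) / (c * norm (x - y) powr h))"
      unfolding D_def
    proof (rule nn_integral_powr_distance_le[where X = "\<lambda>\<omega>. Y x \<omega> - Y y \<omega>" and a = "norm (x - y)"
        and D = "\<lambda>\<omega>. sqrt ((dist x y)\<^sup>2 + (Y x \<omega> - Y y \<omega>)\<^sup>2)" and c = "c * norm (x - y) powr h"])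
      show "norm (x - y) \<le> sqrt ((dist x y)\<^sup>2 + (Y x \<omega> - Y y \<omega>)\<^sup>2)" for \<omega>
        by (intro real_le_rsqrt) (simp add: dist_norm)
      show "\<bar>Y x \<omega> - Y y \<omega>\<bar> \<le> sqrt ((dist x y)\<^sup>2 + (Y x \<omega> - Y y \<omega>)\<^sup>2)" for \<omega>
        by (intro real_le_rsqrt) simp
    qed (use c t pos char[OF that] in auto)
    also have "2 * exp 3 / (1 - 2 powr (1 - t)) * norm (x - y) powr (1 - t) / (c * norm (x - y) powr h)
        = K * norm (x - y) powr - a"
      using pos by (simp add: K_def a_def powr_diff powr_add powr_minus field_simps)
    finally show ?thesis using K by (simp add: ennreal_mult)
  qed
  have "(\<integral>\<^sup>+\<omega>. graph_energy t (\<lambda>x. Y x \<omega>) \<partial>M)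
      = (\<integral>\<^sup>+x. (\<integral>\<^sup>+\<omega>. (\<integral>\<^sup>+y. D x y \<omega> * indicator ?B y \<partial>lborel) * indicator ?B x \<partial>M) \<partial>lborel)"
    unfolding energy_eq D_def by (rule L.Fubini'[symmetric]) measurable
  also have "\<dots> = (\<integral>\<^sup>+x. (\<integral>\<^sup>+\<omega>. (\<integral>\<^sup>+y. D x y \<omega> * indicator ?B y \<partial>lborel) \<partial>M) * indicator ?B x \<partial>lborel)"
    unfolding D_def by (intro nn_integral_cong nn_integral_multc) measurable
  also have "\<dots> = (\<integral>\<^sup>+x. (\<integral>\<^sup>+y. (\<integral>\<^sup>+\<omega>. D x y \<omega> * indicator ?B y \<partial>M) \<partial>lborel) * indicator ?B x \<partial>lborel)"
    unfolding D_def by (intro nn_integral_cong arg_cong2[where f = "(*)"] L.Fubini'[symmetric] refl) measurable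
  also have "\<dots> = (\<integral>\<^sup>+x. (\<integral>\<^sup>+y. (\<integral>\<^sup>+\<omega>. D x y \<omega> \<partial>M) * indicator ?B y \<partial>lborel) * indicator ?B x \<partial>lborel)"
    unfolding D_def by (intro nn_integral_cong arg_cong2[where f = "(*)"] nn_integral_multc refl) measurable
  also have "\<dots> \<le> (\<integral>\<^sup>+x. (\<integral>\<^sup>+y. ennreal K * (ennreal (norm (x - y) powr - a) * indicator ?B y) \<partial>lborel) * indicator ?B x \<partial>lborel)"
  proof (rule nn_integral_mono, rule mult_right_mono, rule nn_integral_mono_AE)
    fix x :: 'b
    have "AE y in lborel. y \<noteq> x" by (simp add: AE_lborel_singleton)
    then show "AE y in lborel. (\<integral>\<^sup>+\<omega>. D x y \<omega> \<partial>M) * indicator ?B y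
        \<le> ennreal K * (ennreal (norm (x - y) powr - a) * indicator ?B y)"
      by eventually_elim (auto simp: indicator_def pointwise)
  qed auto
  also have "\<dots> = ennreal K * (\<integral>\<^sup>+x. (\<integral>\<^sup>+y. ennreal (norm (x - y) powr - a) * indicator ?B y \<partial>lborel) * indicator ?B x \<partial>lborel)"
    by (simp add: nn_integral_cmult mult.assoc)
  also have "\<dots> < \<infinity>"
    using riesz_energy_finite[where 'a = 'b, of a] t h by (simp add: a_def ennreal_mult_less_top)
  finally have "(\<integral>\<^sup>+\<omega>. graph_energy t (\<lambda>x. Y x \<omega>) \<partial>M) \<noteq> \<infinity>"
    by simp
  then have "AE \<omega> in M. graph_energy t (\<lambda>x. Y x \<omega>) \<noteq> \<infinity>"
    unfolding energy_eq D_def by (intro nn_integral_noteq_infinite) measurable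
  then show ?thesis
    by eventually_elim (simp add: less_top)
qed

section \<open>The subcritical case\<close>

definition wavelet_index :: "(int \<times> (int^'n) \<times> (int^'n)) set" where
  "wavelet_index = UNIV \<times> UNIV \<times> wavelet_types"

text \<open>A single \<open>n\<close> bounds both \<open>j\<close> and \<open>k\<close>: this is the
  diagonal of the double limit, so the partial sums run along one increasing sequence of finite
  index sets.\<close>

definition wavelet_box :: "nat \<Rightarrow> (int \<times> (int^'n) \<times> (int^'n)) set" where
  "wavelet_box n = {j. \<bar>j\<bar> \<le> int n} \<times> {k. norm (real_vec k) \<le> real n} \<times> wavelet_types"

definition wavelet_family :: "(int^'n \<Rightarrow> real^'n \<Rightarrow> real) \<Rightarrow> int \<times> (int^'n) \<times> (int^'n) \<Rightarrow> real^'n \<Rightarrow> real" where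
  "wavelet_family \<psi> = (\<lambda>(j, k, e). wavelet \<psi> j k e)"

section \<open>Finite exhaustion of the wavelet indices\<close>

lemma finite_int_vec_bounded: "finite {k :: int^'n. \<forall>i. k $ i \<in> {- m..m}}"
proof (rule finite_subset)
  show "{k :: int^'n. \<forall>i. k $ i \<in> {- m..m}} \<subseteq> vec_lambda ` (UNIV \<rightarrow>\<^sub>E {- m..m})"
  proof
    fix k :: "int^'n" assume "k \<in> {k. \<forall>i. k $ i \<in> {- m..m}}"
    then show "k \<in> vec_lambda ` (UNIV \<rightarrow>\<^sub>E {- m..m})"
      by (intro image_eqI[of _ _ "\<lambda>i. k $ i"]) (auto simp: PiE_def)
  qed
  show "finite ((vec_lambda ` (UNIV \<rightarrow>\<^sub>E {- m..m})) :: (int^'n) set)"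
    by (intro finite_imageI finite_PiE) auto
qed

lemma finite_wavelet_types: "finite (wavelet_types :: (int^'n) set)"
proof (rule finite_subset[OF _ finite_int_vec_bounded[of 1]])
  show "wavelet_types \<subseteq> {k :: int^'n. \<forall>i. k $ i \<in> {- 1..1}}"
  proof
    fix e :: "int^'n" assume "e \<in> wavelet_types"
    then have "e $ i = 0 \<or> e $ i = 1" for i
      by (auto simp: wavelet_types_def)
    then have "e $ i \<in> {- 1..1}" for i
      by (metis atLeastAtMost_iff le_minus_one_simps(1) order_refl zero_le_one neg_le_0_iff_le order_trans)
    then show "e \<in> {k. \<forall>i. k $ i \<in> {- 1..1}}" by blast
  qed
qed

lemma finite_lattice_ball: "finite {k :: int^'n. norm (real_vec k) \<le> real n}"
proof (rule finite_subset[OF _ finite_int_vec_bounded[of "int n"]])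
  show "{k :: int^'n. norm (real_vec k) \<le> real n} \<subseteq> {k. \<forall>i. k $ i \<in> {- int n..int n}}"
  proof (intro subsetI CollectI allI)
    fix k :: "int^'n" and i assume "k \<in> {k. norm (real_vec k) \<le> real n}"
    then have "\<bar>real_of_int (k $ i)\<bar> \<le> real n"
      using component_le_norm_cart[of "real_vec k" i] by (simp add: real_vec_def)
    then show "k $ i \<in> {- int n..int n}" by auto
  qed
qed

lemma finite_wavelet_box: "finite (wavelet_box n)"
  unfolding wavelet_box_def
proof (intro finite_cartesian_product finite_lattice_ball finite_wavelet_types)
  have "{j. \<bar>j\<bar> \<le> int n} = {- int n..int n}" by auto
  then show "finite {j. \<bar>j\<bar> \<le> int n}" by simp
qed

lemma wavelet_box_subset: "wavelet_box n \<subseteq> wavelet_index"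
  by (auto simp: wavelet_box_def wavelet_index_def)

lemma wavelet_box_mono: "m \<le> n \<Longrightarrow> wavelet_box m \<subseteq> wavelet_box n"
  by (auto simp: wavelet_box_def intro: order_trans)

lemma eventually_subset_wavelet_box:
  assumes "finite G" "G \<subseteq> wavelet_index"
  shows "\<forall>\<^sub>F n in sequentially. G \<subseteq> wavelet_box n"
  using assms
proof (induction G)
  case (insert i G)
  obtain j k e where i: "i = (j, k, e)" "e \<in> wavelet_types"
    using insert.prems by (auto simp: wavelet_index_def)
  have "\<forall>\<^sub>F n in sequentially. \<bar>j\<bar> \<le> int n"
    using eventually_ge_at_top[of "nat \<bar>j\<bar>"] by eventually_elim auto
  moreover have "\<forall>\<^sub>F n in sequentially. norm (real_vec k) \<le> real n"
    using eventually_ge_at_top[of "nat \<lceil>norm (real_vec k)\<rceil>"]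
    by eventually_elim (simp add: nat_ceiling_le_eq)
  moreover have "\<forall>\<^sub>F n in sequentially. G \<subseteq> wavelet_box n"
    using insert by auto
  ultimately show ?case
    by eventually_elim (use i in \<open>auto simp: wavelet_box_def\<close>)
qed simp

lemma wavelet_partial_sum_diagonal:
  "wavelet_partial_sum \<gamma> \<psi> \<eta> n n x \<omega>
    = (\<Sum>i\<in>wavelet_box n. (\<lambda>(j, k, e). \<eta> j k e) i \<omega> * fractional_integral \<gamma> (wavelet_family \<psi> i) x)"
  unfolding wavelet_partial_sum_def wavelet_box_def
  by (simp add: sum.cartesian_product wavelet_family_def case_prod_unfold)

lemma wavelet_family_basis:
  assumes "regular_orthonormal_wavelet_basis r \<psi>"
  shows "orthonormal_basis_of L2 wavelet_index (wavelet_family \<psi>)"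
  using assms unfolding regular_orthonormal_wavelet_basis_def wavelet_index_def wavelet_family_def by blast

lemma fractional_integral_wavelet:
  fixes \<psi> :: "int^'n \<Rightarrow> real^'n \<Rightarrow> real"
  assumes \<psi>: "regular_orthonormal_wavelet_basis r \<psi>" and r: "\<gamma> < real r"
    and \<gamma>: "real CARD('n) / 2 \<le> \<gamma>" "\<gamma> < real CARD('n) / 2 + 1"
  obtains c where "c \<noteq> 0" "\<And>i x. i \<in> wavelet_index \<Longrightarrow> fractional_integral \<gamma> (wavelet_family \<psi> i) x
    = c * (LINT z|lborel. kernel_diff (\<gamma> - real CARD('n)) x 0 z * wavelet_family \<psi> i z)"
proof (cases "\<gamma> = real CARD('n)")
  case True
  \<comment> \<open>From \<open>d = \<gamma> < d / 2 + 1\<close>. With \<open>d = 1\<close> the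
    hypothesis \<open>\<gamma> < r\<close> gives \<open>2 \<le> r\<close>, the smoothness that the
    logarithmic kernel asks for.\<close>
  then have "CARD('n) < 2" using \<gamma> by simp
  moreover have "0 < CARD('n)" by simp
  ultimately have d: "CARD('n) = 1" by linarith
  have "2 \<le> r" using r True d by simp
  then have "fractional_integral \<gamma> (wavelet_family \<psi> i) x
      = - (1 / pi) * (LINT z|lborel. kernel_diff (\<gamma> - real CARD('n)) x 0 z * wavelet_family \<psi> i z)"
    if "i \<in> wavelet_index" for i x
    using that wavelet_fractional_integral_dim_one[OF \<psi> _ d] True d
    by (auto simp: wavelet_index_def wavelet_family_def)
  then show ?thesis by (intro that[of "- (1 / pi)"]) auto
next
  case False
  have "0 < \<gamma>" "\<gamma> < real CARD('n) + 1"
    by (rule less_le_trans[OF _ \<gamma>(1)], simp, rule less_le_trans[OF \<gamma>(2)], simp)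
  from fractional_integral_eq_kernel_diff[OF this False] show ?thesis
    using that by metis
qed

text \<open>The increment coefficients are multiples of the coefficients of one L2 function,
  \<open>kernel_diff a x y\<close>, because the normalising term at 0 cancels. A finite set of
  wavelets captures half of its energy, and the passage to exponent \<open>p\<close> takes place on
  that finite set.\<close>

lemma wavelet_coefficients_lower_bound:
  fixes \<psi> :: "int^'n \<Rightarrow> real^'n \<Rightarrow> real"
  assumes \<psi>: "regular_orthonormal_wavelet_basis r \<psi>" and r: "\<gamma> < real r"
    and \<gamma>: "real CARD('n) / 2 < \<gamma>" "\<gamma> < real CARD('n) / 2 + 1" and p: "0 < p" "p \<le> 2"
  obtains c where "0 < c"
    "\<And>x y. x \<noteq> y \<Longrightarrow> \<exists>F. finite F \<and> F \<subseteq> wavelet_index \<and>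
       (c * norm (x - y) powr (\<gamma> - real CARD('n) / 2)) powr p
       \<le> (\<Sum>i\<in>F. \<bar>fractional_integral \<gamma> (wavelet_family \<psi> i) x - fractional_integral \<gamma> (wavelet_family \<psi> i) y\<bar> powr p)"
proof -
  let ?d = "real CARD('n)"
  define a where "a = \<gamma> - ?d"
  have a: "- ?d / 2 < a" "a < 1 - ?d / 2"
    using \<gamma> by (auto simp: a_def)
  obtain c0 where c0: "c0 \<noteq> 0" and coeff: "\<And>i x. i \<in> wavelet_index \<Longrightarrow> fractional_integral \<gamma> (wavelet_family \<psi> i) x
      = c0 * (LINT z|lborel. kernel_diff a x 0 z * wavelet_family \<psi> i z)"
    using fractional_integral_wavelet[OF \<psi> r less_imp_le[OF \<gamma>(1)] \<gamma>(2)] unfolding a_def by metis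
  obtain c1 where c1: "0 < c1" and lower: "\<And>x y :: real^'n. x \<noteq> y \<Longrightarrow>
      c1 * norm (x - y) powr (2 * a + ?d) \<le> L2_inner (kernel_diff a x y) (kernel_diff a x y)"
    using kernel_diff_L2_lower_bound[OF a] by metis
  \<comment> \<open>\<open>c0\<close> converts kernel coefficients into fractional integrals,
    \<open>c1\<close> is the constant of the L2 lower bound, and 1/2 is the share of the energy kept
    by the finite set \<open>F\<close>.\<close>
  define c where "c = sqrt (c0\<^sup>2 * c1 / 2)"
  have "0 < c" using c0 c1 by (simp add: c_def)
  moreover have "\<exists>F. finite F \<and> F \<subseteq> wavelet_index \<and> (c * norm (x - y) powr (\<gamma> - ?d / 2)) powr p
      \<le> (\<Sum>i\<in>F. \<bar>fractional_integral \<gamma> (wavelet_family \<psi> i) x - fractional_integral \<gamma> (wavelet_family \<psi> i) y\<bar> powr p)"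
    if xy: "x \<noteq> y" for x y :: "real^'n"
  proof -
    let ?f = "kernel_diff a x y"
    let ?A = "\<lambda>i. fractional_integral \<gamma> (wavelet_family \<psi> i) x - fractional_integral \<gamma> (wavelet_family \<psi> i) y"
    define N where "N = c1 * norm (x - y) powr (2 * a + ?d)"
    have N: "0 < N" "N \<le> L2_inner ?f ?f"
      using c1 xy lower[OF xy] by (auto simp: N_def)
    obtain F where F: "finite F" "F \<subseteq> wavelet_index"
      and sum: "L2_inner ?f ?f - N / 2 < (\<Sum>i\<in>F. (L2_inner ?f (wavelet_family \<psi> i))\<^sup>2)"
      using parseval_lower_bound[OF wavelet_family_basis[OF \<psi>] kernel_diff_L2[OF a, of x y], of "N / 2"] N by auto
    have A: "?A i = c0 * L2_inner ?f (wavelet_family \<psi> i)" if i: "i \<in> F" for i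
    proof -
      have "wavelet_family \<psi> i \<in> L2"
        using i F \<psi> by (auto simp: wavelet_index_def wavelet_family_def intro: wavelet_in_L2)
      then have int: "integrable lborel (\<lambda>z. kernel_diff a v 0 z * wavelet_family \<psi> i z)" for v
        by (intro L2_imp_integrable_mult kernel_diff_L2[OF a])
      have "L2_inner ?f (wavelet_family \<psi> i)
          = (LINT z|lborel. kernel_diff a x 0 z * wavelet_family \<psi> i z - kernel_diff a y 0 z * wavelet_family \<psi> i z)"
        unfolding L2_inner_def by (intro Bochner_Integration.integral_cong) (auto simp: kernel_diff_def algebra_simps)
      also have "\<dots> = (LINT z|lborel. kernel_diff a x 0 z * wavelet_family \<psi> i z)
          - (LINT z|lborel. kernel_diff a y 0 z * wavelet_family \<psi> i z)"
        using int by (intro Bochner_Integration.integral_diff)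
      finally show ?thesis
        using coeff[OF subsetD[OF F(2) i]] by (simp add: right_diff_distrib)
    qed
    have "c * norm (x - y) powr (\<gamma> - ?d / 2) = (c0\<^sup>2 * (N / 2)) powr (1 / 2)"
    proof -
      have "(norm (x - y) powr (2 * a + ?d)) powr (1 / 2) = norm (x - y) powr (\<gamma> - ?d / 2)"
        by (simp add: powr_powr a_def field_simps)
      moreover have "c = (c0\<^sup>2 * c1 / 2) powr (1 / 2)"
        using c1 by (simp add: c_def powr_half_sqrt)
      moreover have "(c0\<^sup>2 * (N / 2)) powr (1 / 2)
          = ((c0\<^sup>2 * c1 / 2) * norm (x - y) powr (2 * a + ?d)) powr (1 / 2)"
        by (simp add: N_def mult.assoc)
      moreover have "\<dots> = (c0\<^sup>2 * c1 / 2) powr (1 / 2) * (norm (x - y) powr (2 * a + ?d)) powr (1 / 2)"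
        by (rule powr_mult)
      ultimately show ?thesis by (simp only:)
    qed
    then have "(c * norm (x - y) powr (\<gamma> - ?d / 2)) powr p = (c0\<^sup>2 * (N / 2)) powr (p / 2)"
      by (simp add: powr_powr)
    also have "\<dots> \<le> (\<Sum>i\<in>F. (?A i)\<^sup>2) powr (p / 2)"
    proof (rule powr_mono2)
      have "N / 2 \<le> (\<Sum>i\<in>F. (L2_inner ?f (wavelet_family \<psi> i))\<^sup>2)"
        using sum N by linarith
      then have "c0\<^sup>2 * (N / 2) \<le> c0\<^sup>2 * (\<Sum>i\<in>F. (L2_inner ?f (wavelet_family \<psi> i))\<^sup>2)"
        by (rule mult_left_mono) simp
      also have "\<dots> = (\<Sum>i\<in>F. (?A i)\<^sup>2)"
        unfolding sum_distrib_left by (rule sum.cong) (simp_all add: A power_mult_distrib)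
      finally show "c0\<^sup>2 * (N / 2) \<le> (\<Sum>i\<in>F. (?A i)\<^sup>2)" .
    qed (use p N in auto)
    also have "\<dots> \<le> (\<Sum>i\<in>F. \<bar>?A i\<bar> powr p)"
      by (rule sum_squares_powr_le_sum_abs_powr[OF F(1) p])
    finally show ?thesis using F by blast
  qed
  ultimately show ?thesis by (rule that)
qed

text \<open>Convergence as both cutoffs tend to infinity independently implies convergence along the
  diagonal.\<close>

lemma AE_diagonal_limit:
  assumes lim: "AE \<omega> in M. ((\<lambda>(N, K). wavelet_partial_sum \<gamma> \<psi> \<eta> N K x \<omega>) \<longlongrightarrow> Y x \<omega>) (sequentially \<times>\<^sub>F sequentially)"
    and version: "AE \<omega> in M. Y' x \<omega> = Y x \<omega>"
  shows "AE \<omega> in M. (\<lambda>n. \<Sum>i\<in>wavelet_box n. (\<lambda>(j, k, e). \<eta> j k e) i \<omega> * fractional_integral \<gamma> (wavelet_family \<psi> i) x)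
    \<longlonglongrightarrow> Y' x \<omega>"
  using lim version
proof eventually_elim
  case (elim \<omega>)
  have "filterlim (\<lambda>n. (n, n)) (sequentially \<times>\<^sub>F sequentially) sequentially"
    by (intro filterlim_Pair filterlim_ident)
  from filterlim_compose[OF elim(1) this] show ?case
    using elim(2) by (simp add: wavelet_partial_sum_diagonal)
qed

lemma hausdorff_dim_wavelet_series_graph:
  fixes \<psi> :: "int^'n \<Rightarrow> real^'n \<Rightarrow> real" and Y :: "real^'n \<Rightarrow> 'w \<Rightarrow> real"
  assumes "prob_space M"
    and \<psi>: "regular_orthonormal_wavelet_basis r \<psi>" and r: "\<gamma> < real r"
    and p: "1 \<le> p" "p \<le> 2"
    and \<gamma>: "real CARD('n) / 2 < \<gamma>" "\<gamma> < real CARD('n) / 2 + 1"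
    and indep: "prob_space.indep_vars M (\<lambda>_. borel) \<eta> wavelet_index"
    and stable: "\<And>i. i \<in> wavelet_index \<Longrightarrow> symmetric_stable M p \<sigma> (\<eta> i)" and \<sigma>: "0 < \<sigma>"
    and Y: "(\<lambda>(x, \<omega>). Y x \<omega>) \<in> borel_measurable (borel \<Otimes>\<^sub>M M)"
    and lim: "\<And>x. AE \<omega> in M. (\<lambda>n. \<Sum>i\<in>wavelet_box n. \<eta> i \<omega> * fractional_integral \<gamma> (wavelet_family \<psi> i) x)
      \<longlonglongrightarrow> Y x \<omega>"
  shows "AE \<omega> in M. ereal (3 * real CARD('n) / 2 - \<gamma> + 1) \<le> hausdorff_dim (range (\<lambda>x. (x, Y x \<omega>)))"
proof -
  interpret prob_space M by fact
  let ?d = "real CARD('n)"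
  let ?A = "\<lambda>i. fractional_integral \<gamma> (wavelet_family \<psi> i)"
  define h where "h = \<gamma> - ?d / 2"
  define \<beta> where "\<beta> = 3 * ?d / 2 - \<gamma> + 1"
  obtain D where D: "D = ?d" by simp
  \<comment> \<open>Needed for \<open>1 < \<beta>\<close>, which follows from
    \<open>h < 1 \<le> d\<close> and leaves room for energy exponents strictly between 1 and
    \<open>\<beta>\<close>.\<close>
  have "1 \<le> D" unfolding D by (simp add: Suc_le_eq)
  then have \<beta>: "1 < \<beta>" and h: "0 \<le> h" and \<beta>h: "\<beta> = ?d + 1 - h"
    using \<gamma> unfolding \<beta>_def h_def D[symmetric] by - linarith+
  obtain c where c: "0 < c" and coeff: "\<And>x y. x \<noteq> y \<Longrightarrow> \<exists>F. finite F \<and> F \<subseteq> wavelet_index \<and>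
       (c * norm (x - y) powr h) powr p \<le> (\<Sum>i\<in>F. \<bar>?A i x - ?A i y\<bar> powr p)"
    using wavelet_coefficients_lower_bound[OF \<psi> r \<gamma>, of p] p unfolding h_def by auto
  have Yx [measurable]: "Y x \<in> borel_measurable M" for x
    by (rule measurable_uncurry_compose[OF Y]) auto
  have char: "cmod (CLINT \<omega>|M. iexp (\<xi> * (Y x \<omega> - Y y \<omega>))) \<le> exp 1 * exp (- (\<sigma> * c * norm (x - y) powr h * \<bar>\<xi>\<bar>))"
    if xy: "x \<noteq> y" for x y \<xi>
  proof -
    obtain F where F: "finite F" "F \<subseteq> wavelet_index"
      and le: "(c * norm (x - y) powr h) powr p \<le> (\<Sum>i\<in>F. \<bar>?A i x - ?A i y\<bar> powr p)"
      using coeff[OF xy] by blast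
    have "\<forall>\<^sub>F n in sequentially. (c * norm (x - y) powr h) powr p \<le> (\<Sum>i\<in>wavelet_box n. \<bar>?A i x - ?A i y\<bar> powr p)"
      using eventually_subset_wavelet_box[OF F]
    proof eventually_elim
      case (elim n)
      have "(\<Sum>i\<in>F. \<bar>?A i x - ?A i y\<bar> powr p) \<le> (\<Sum>i\<in>wavelet_box n. \<bar>?A i x - ?A i y\<bar> powr p)"
        by (rule sum_mono2[OF finite_wavelet_box elim]) simp
      with le show ?case by linarith
    qed
    moreover have "AE \<omega> in M. (\<lambda>n. \<Sum>i\<in>wavelet_box n. \<eta> i \<omega> * (?A i x - ?A i y)) \<longlonglongrightarrow> Y x \<omega> - Y y \<omega>"
      using lim[of x] lim[of y]
      by eventually_elim (auto simp: right_diff_distrib sum_subtractf intro: tendsto_diff)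
    ultimately have "cmod (CLINT \<omega>|M. iexp (\<xi> * (Y x \<omega> - Y y \<omega>)))
        \<le> exp (- (\<sigma> powr p * \<bar>\<xi>\<bar> powr p * (c * norm (x - y) powr h) powr p))"
      by (intro charfun_limit_le[OF finite_wavelet_box wavelet_box_subset indep stable]) auto
    also have "\<sigma> powr p * \<bar>\<xi>\<bar> powr p * (c * norm (x - y) powr h) powr p = (\<sigma> * \<bar>\<xi>\<bar> * (c * norm (x - y) powr h)) powr p"
      using \<sigma> c by (simp add: powr_mult)
    also have "exp (- ((\<sigma> * \<bar>\<xi>\<bar> * (c * norm (x - y) powr h)) powr p)) \<le> exp 1 * exp (- (\<sigma> * \<bar>\<xi>\<bar> * (c * norm (x - y) powr h)))"
      using \<sigma> c p by (intro exp_neg_powr_le) auto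
    finally show ?thesis by (simp add: ac_simps)
  qed
  \<comment> \<open>Countably many exponents tending to \<open>\<beta>\<close>, so that one null set
    serves all \<open>s < \<beta>\<close>. The denominator \<open>n + 2\<close> keeps
    \<open>1 < t n\<close> for \<open>n = 0\<close> as well.\<close>
  define t where "t n = \<beta> - (\<beta> - 1) / real (n + 2)" for n
  have t: "1 < t n" "t n < \<beta>" for n
  proof -
    define q where "q = (\<beta> - 1) / real (n + 2)"
    have "q < (\<beta> - 1) / 1"
      unfolding q_def using \<beta> by (intro divide_strict_left_mono) auto
    moreover have "0 < q"
      using \<beta> by (simp add: q_def)
    ultimately show "1 < t n" "t n < \<beta>"
      unfolding t_def q_def[symmetric] by simp_all
  qed
  have "AE \<omega> in M. graph_energy (t n) (\<lambda>x. Y x \<omega>) < \<infinity>" for n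
    using AE_graph_energy_finite[OF Y char, of "t n"] \<sigma> c h t[of n] \<beta>h by simp
  then have "AE \<omega> in M. \<forall>n. graph_energy (t n) (\<lambda>x. Y x \<omega>) < \<infinity>"
    by (simp add: AE_all_countable)
  moreover have "AE \<omega> in M. \<omega> \<in> space M" by simp
  ultimately show ?thesis
  proof eventually_elim
    case (elim \<omega>)
    show ?case unfolding \<beta>_def[symmetric]
    proof (rule hausdorff_dim_graph_ge)
      show "(\<lambda>x. Y x \<omega>) \<in> borel_measurable borel"
        using elim(2) by (intro measurable_uncurry_compose[OF Y]) auto
      fix s assume "0 \<le> s" "s < \<beta>"
      moreover have "t \<longlonglongrightarrow> \<beta> - 0"
        unfolding t_def[abs_def] by (intro tendsto_diff tendsto_const LIMSEQ_ignore_initial_segment[OF lim_const_over_n])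
      ultimately have "\<forall>\<^sub>F n in sequentially. s < t n"
        by (intro order_tendstoD) auto
      then obtain n where "s < t n" by (auto simp: eventually_sequentially)
      then show "\<exists>t\<ge>s. 0 < t \<and> graph_energy t (\<lambda>x. Y x \<omega>) < \<infinity>"
        using elim(1) t[of n] by (intro exI[of _ "t n"]) auto
    qed
  qed
qed

section \<open>The critical Gaussian case\<close>

lemma nn_integral_powr_critical_ball_infinite:
  fixes r :: real
  assumes r: "0 < r"
  shows "(\<integral>\<^sup>+w. ennreal (norm w powr - real DIM('a)) * indicator (ball 0 r) w \<partial>(lborel :: 'a::euclidean_space measure)) = \<infinity>"
proof (rule ccontr)
  let ?d = "real DIM('a)"
  let ?f = "\<lambda>w::'a. ennreal (norm w powr - ?d)"
  define J where "J = (\<integral>\<^sup>+w. ?f w * indicator (ball 0 r) w \<partial>lborel)"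
  assume "\<not> ?thesis"
  then have fin: "J \<noteq> \<infinity>" by (simp add: J_def)
  \<comment> \<open>The integrand is invariant under dilations, so the shell between radii \<open>r / 2\<close> and \<open>r\<close> would carry no mass.\<close>
  have half: "(\<integral>\<^sup>+w. ?f w * indicator (ball 0 (r / 2)) w \<partial>lborel) = J"
  proof -
    have "(\<integral>\<^sup>+w. ?f w * indicator (ball 0 (r / 2)) w \<partial>lborel)
        = ennreal ((1 / 2) ^ DIM('a)) * (\<integral>\<^sup>+w. ?f ((1/2) *\<^sub>R w) * indicator (ball 0 (r / 2)) ((1/2) *\<^sub>R w) \<partial>lborel)"
      by (subst nn_integral_affine[where c = "1/2" and t = 0]) auto
    also have "(\<integral>\<^sup>+w. ?f ((1/2) *\<^sub>R w) * indicator (ball 0 (r / 2)) ((1/2) *\<^sub>R w) \<partial>lborel)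
        = (\<integral>\<^sup>+w. ennreal (2 ^ DIM('a)) * (?f w * indicator (ball 0 r) w) \<partial>lborel)"
    proof (rule nn_integral_cong)
      fix w :: 'a
      have "(norm w / 2) powr - ?d = 2 ^ DIM('a) * norm w powr - ?d"
        using powr_realpow[of "2::real" "DIM('a)"] by (simp only: powr_divide powr_minus_divide) simp
      then show "?f ((1/2) *\<^sub>R w) * indicator (ball 0 (r / 2)) ((1/2) *\<^sub>R w)
          = ennreal (2 ^ DIM('a)) * (?f w * indicator (ball 0 r) w)"
        by (auto simp: indicator_def ennreal_mult)
    qed
    also have "\<dots> = ennreal (2 ^ DIM('a)) * J"
      unfolding J_def by (rule nn_integral_cmult) measurable
    also have "ennreal ((1 / 2) ^ DIM('a)) * (ennreal (2 ^ DIM('a)) * J) = J"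
      by (simp add: mult.assoc[symmetric] ennreal_mult[symmetric] power_mult_distrib[symmetric])
    finally show ?thesis .
  qed
  define s where "s = (\<integral>\<^sup>+w. ?f w * indicator (ball 0 r - ball 0 (r / 2)) w \<partial>lborel)"
  have "J = (\<integral>\<^sup>+w. ?f w * indicator (ball 0 (r / 2)) w + ?f w * indicator (ball 0 r - ball 0 (r / 2)) w \<partial>lborel)"
    unfolding J_def using r by (intro nn_integral_cong) (auto simp: indicator_def)
  also have "\<dots> = J + s"
    unfolding s_def by (subst nn_integral_add) (auto simp: half)
  finally have "J = J + s" .
  then have "s = 0"
    using fin by (metis ennreal_add_left_cancel add.right_neutral infinity_ennreal_def)
  moreover have "0 < s"
  proof -
    have "0 < unit_ball_vol ?d * (r ^ DIM('a) - (r / 2) ^ DIM('a))"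
      using r by (intro mult_pos_pos) (auto intro!: power_strict_mono)
    then have "0 < r powr - ?d * (unit_ball_vol ?d * r ^ DIM('a) - unit_ball_vol ?d * (r / 2) ^ DIM('a))"
      using r by (simp add: right_diff_distrib)
    then have "0 < ennreal (r powr - ?d) * emeasure lborel (ball (0::'a) r - ball 0 (r / 2))"
      using r by (subst emeasure_Diff)
        (auto simp: emeasure_ball ennreal_minus ennreal_mult[symmetric] ennreal_less_zero_iff intro!: subset_ball)
    also have "\<dots> = (\<integral>\<^sup>+w. ennreal (r powr - ?d) * indicator (ball (0::'a) r - ball 0 (r / 2)) w \<partial>lborel)"
      by (simp add: nn_integral_cmult_indicator)
    also have "\<dots> \<le> s"
      unfolding s_def
    proof (rule nn_integral_mono)
      fix w :: 'a
      have "r powr - ?d \<le> norm w powr - ?d" if "r / 2 \<le> norm w" "norm w < r"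
        using that r by (intro powr_mono2') auto
      then show "ennreal (r powr - ?d) * indicator (ball 0 r - ball 0 (r / 2)) w
          \<le> ?f w * indicator (ball 0 r - ball 0 (r / 2)) w"
        by (auto simp: indicator_def intro: ennreal_leI)
    qed
    finally show ?thesis .
  qed
  ultimately show False by simp
qed

text \<open>Countably many balls of radius \<delta>, centred in a dense set, cover \<open>X\<close>;
  if all of them met \<open>X\<close> in a null set, \<open>X\<close> would be null.\<close>

lemma nonnull_intersection_small_ball:
  fixes X :: "'a::euclidean_space set"
  assumes [measurable]: "X \<in> sets borel" and X: "emeasure lborel X \<noteq> 0" and \<delta>: "0 < \<delta>"
  obtains q where "emeasure lborel (X \<inter> ball q \<delta>) \<noteq> 0"
proof (rule ccontr)
  assume "\<not> thesis"
  then have null: "X \<inter> ball q \<delta> \<in> null_sets lborel" for q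
    using that by (auto simp: null_sets_def)
  obtain D :: "'a set" where D: "countable D" "\<And>U. open U \<Longrightarrow> U \<noteq> {} \<Longrightarrow> \<exists>d\<in>D. d \<in> U"
    using countable_dense_setE by blast
  have "X \<subseteq> (\<Union>q\<in>D. X \<inter> ball q \<delta>)"
  proof
    fix x assume "x \<in> X"
    obtain q where "q \<in> D" "q \<in> ball x \<delta>"
      using D(2)[of "ball x \<delta>"] \<delta> by auto
    then show "x \<in> (\<Union>q\<in>D. X \<inter> ball q \<delta>)"
      using \<open>x \<in> X\<close> by (auto simp: dist_commute)
  qed
  moreover have "(\<Union>q\<in>D. X \<inter> ball q \<delta>) \<in> null_sets lborel"
    using D(1) null by (intro null_sets_UN') auto
  ultimately have "X \<in> null_sets lborel"
    using null_sets_subset[of "\<Union>q\<in>D. X \<inter> ball q \<delta>" lborel X] by simp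
  with X show False by auto
qed

text \<open>The critical kernel is not locally square integrable, but its average over a set of
  positive finite measure is bounded, which makes it usable as a test function.\<close>

definition mean_potential :: "real \<Rightarrow> 'a::euclidean_space set \<Rightarrow> 'a \<Rightarrow> real" where
  "mean_potential a S z = (LINT x|lborel. indicator S x * norm (x - z) powr a) / measure lborel S"

lemma mean_potential_measurable [measurable]:
  fixes S :: "'a::euclidean_space set"
  assumes [measurable]: "S \<in> sets borel"
  shows "mean_potential a S \<in> borel_measurable borel"
  unfolding mean_potential_def[abs_def] by measurable

lemma abs_mean_le:
  fixes S :: "'a::euclidean_space set" and f :: "'a \<Rightarrow> real"
  assumes [measurable]: "S \<in> sets borel" and S: "emeasure lborel S < \<infinity>" "0 < measure lborel S"
    and f: "integrable lborel (\<lambda>x. indicator S x * f x)" and bound: "\<And>x. x \<in> S \<Longrightarrow> \<bar>f x\<bar> \<le> M"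
  shows "\<bar>(LINT x|lborel. indicator S x * f x) / measure lborel S\<bar> \<le> M"
proof -
  have "\<bar>LINT x|lborel. indicator S x * f x\<bar> \<le> (LINT x|lborel. \<bar>indicator S x * f x\<bar>)"
    by (rule integral_abs_bound)
  also have "\<dots> \<le> (LINT x|lborel. indicator S x * M)"
  proof (rule integral_mono)
    show "integrable lborel (\<lambda>x. indicator S x * M)"
      using S by (intro integrable_mult_left) (simp add: integrable_indicator_iff)
    show "\<bar>indicator S x * f x\<bar> \<le> indicator S x * M" for x
      using bound by (simp add: indicator_def)
  qed (use f in simp)
  also have "\<dots> = measure lborel S * M"
    by simp
  finally show ?thesis
    using S by (simp add: abs_divide divide_le_eq mult.commute)
qed

section \<open>Averages of potentials with an integrable singularity\<close>

context
  fixes a E :: real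
  assumes a: "a < 0" and E: "0 \<le> E"
    and local_mass: "(\<integral>\<^sup>+w. ennreal (norm (w::'a::euclidean_space) powr a) * indicator (ball 0 4) w \<partial>lborel) = ennreal E"
begin

lemma powr_le_local_plus_one:
  "ennreal (norm w powr a) \<le> ennreal (norm w powr a) * indicator (ball 0 4) (w :: 'a) + 1"
proof (cases "norm w < 4")
  case False
  have "norm w powr a \<le> 1"
    using False a powr_mono2'[of a 1 "norm w"] by simp
  then show ?thesis using False by (simp add: ennreal_le_1)
qed simp

text \<open>The kernel is split into its singular part, of mass \<open>E\<close> wherever it is
  centred, and a remainder of size at most 1. The first is paired with the supremum of
  \<open>f\<close>, the second with its integral.\<close>

lemma nn_integral_potential_le:
  assumes [measurable]: "f \<in> borel_measurable borel" and f: "\<And>x. 0 \<le> f x" "\<And>x. f x \<le> B"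
  shows "(\<integral>\<^sup>+x. ennreal (norm (x - z :: 'a) powr a * f x) \<partial>lborel)
    \<le> ennreal B * ennreal (E) + (\<integral>\<^sup>+x. ennreal (f x) \<partial>lborel)"
proof -
  let ?g = "\<lambda>w::'a. ennreal (norm w powr a) * indicator (ball 0 4) w"
  have "(\<integral>\<^sup>+x. ennreal (norm (x - z) powr a * f x) \<partial>lborel)
      \<le> (\<integral>\<^sup>+x. ennreal B * ?g (- z + x) + ennreal (f x) \<partial>lborel)"
  proof (rule nn_integral_mono)
    fix x :: 'a
    have "ennreal (norm (x - z) powr a * f x) = ennreal (norm (x - z) powr a) * ennreal (f x)"
      using f by (simp add: ennreal_mult)
    also have "\<dots> \<le> (?g (x - z) + 1) * ennreal (f x)"
      by (intro mult_right_mono powr_le_local_plus_one) auto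
    also have "\<dots> = ennreal (f x) * ?g (x - z) + ennreal (f x)"
      by (subst distrib_right) (simp add: ac_simps)
    also have "\<dots> \<le> ennreal B * ?g (x - z) + ennreal (f x)"
      using f by (intro add_right_mono mult_right_mono ennreal_leI) auto
    finally show "ennreal (norm (x - z) powr a * f x) \<le> ennreal B * ?g (- z + x) + ennreal (f x)"
      by simp
  qed
  also have "\<dots> = ennreal B * (\<integral>\<^sup>+x. ?g (- z + x) \<partial>lborel) + (\<integral>\<^sup>+x. ennreal (f x) \<partial>lborel)"
    by (simp add: nn_integral_add nn_integral_cmult)
  also have "(\<integral>\<^sup>+x. ?g (- z + x) \<partial>lborel) = ennreal (E)"
    using nn_integral_affine[of ?g 1 "- z"] by (simp add: local_mass)
  finally show ?thesis .
qed

lemma integrable_potential: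
  fixes S :: "'a set"
  assumes [measurable]: "S \<in> sets borel" and S: "emeasure lborel S < \<infinity>"
  shows "integrable lborel (\<lambda>x. indicator S x * norm (x - z) powr a)"
    and "(LINT x|lborel. indicator S x * norm (x - z) powr a) \<le> E + measure lborel S"
proof -
  have bound: "(\<integral>\<^sup>+x. ennreal (indicator S x * norm (x - z) powr a) \<partial>lborel) \<le> ennreal (E + measure lborel S)"
    using nn_integral_potential_le[of "indicator S" 1 z] S E
    by (simp add: mult.commute indicator_le_1 ennreal_indicator emeasure_eq_ennreal_measure ennreal_plus less_top)
  show int: "integrable lborel (\<lambda>x. indicator S x * norm (x - z) powr a)"
    using bound by (intro integrableI_nonneg) (auto intro: le_less_trans)
  have "ennreal (LINT x|lborel. indicator S x * norm (x - z) powr a) \<le> ennreal (E + measure lborel S)"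
    using bound nn_integral_eq_integral[OF int] by simp
  then show "(LINT x|lborel. indicator S x * norm (x - z) powr a) \<le> E + measure lborel S"
    using E by (subst (asm) ennreal_le_iff) auto
qed


lemma mean_potential_bounds:
  fixes S :: "'a set"
  assumes [measurable]: "S \<in> sets borel" and S: "emeasure lborel S < \<infinity>" "0 < measure lborel S"
  shows "0 \<le> mean_potential a S z" "mean_potential a S z \<le> (E + measure lborel S) / measure lborel S"
  unfolding mean_potential_def using S integrable_potential[of S z]
  by (auto intro!: divide_right_mono divide_nonneg_nonneg integral_nonneg_AE)

lemma mean_potential_diff_eq:
  fixes S :: "'a set"
  assumes [measurable]: "S \<in> sets borel" and S: "emeasure lborel S < \<infinity>" "0 < measure lborel S"
  shows "integrable lborel (\<lambda>x. indicator S x * (norm (x - z) powr a - norm z powr a))"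
    and "mean_potential a S z - norm z powr a
      = (LINT x|lborel. indicator S x * (norm (x - z) powr a - norm z powr a)) / measure lborel S"
proof -
  have 1: "integrable lborel (\<lambda>x. indicator S x * norm z powr a)"
    using S by (intro integrable_mult_left) (simp add: integrable_indicator_iff)
  show "integrable lborel (\<lambda>x. indicator S x * (norm (x - z) powr a - norm z powr a))"
    using Bochner_Integration.integrable_diff[OF integrable_potential(1)[OF assms(1) S(1)] 1]
    by (simp add: right_diff_distrib)
  have "(LINT x|lborel. indicator S x * (norm (x - z) powr a - norm z powr a))
      = (LINT x|lborel. indicator S x * norm (x - z) powr a) - (LINT x|lborel. indicator S x * norm z powr a)"
    using Bochner_Integration.integral_diff[OF integrable_potential(1)[OF assms(1) S(1)] 1]
    by (simp add: right_diff_distrib)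
  also have "(LINT x|lborel. indicator S x * norm z powr a) = measure lborel S * norm z powr a"
    by simp
  finally show "mean_potential a S z - norm z powr a
      = (LINT x|lborel. indicator S x * (norm (x - z) powr a - norm z powr a)) / measure lborel S"
    using S by (simp add: mean_potential_def diff_divide_distrib)
qed

text \<open>The term of comparison \<open>norm z powr a\<close> does not depend on \<open>S\<close>,
  so it drops out when two means are subtracted, and the difference decays with the better exponent
  \<open>a - 1\<close>.\<close>

lemma mean_potential_far_bound:
  fixes S :: "'a set"
  assumes [measurable]: "S \<in> sets borel" and S: "emeasure lborel S < \<infinity>" "0 < measure lborel S"
    and ball: "S \<subseteq> ball 0 1" and z: "2 \<le> norm z"
  shows "\<bar>mean_potential a S z - norm z powr a\<bar> \<le> \<bar>a\<bar> * (2 * 2 powr (1 - a)) * norm z powr (a - 1)"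
  unfolding mean_potential_diff_eq(2)[OF assms(1-3)]
proof (rule abs_mean_le[OF assms(1-3) mean_potential_diff_eq(1)[OF assms(1-3)]])
  fix x assume "x \<in> S"
  then have "\<bar>kernel_diff a x 0 z\<bar> \<le> 2 * 1 * 2 powr (1 - a) * norm z powr (a - 1)"
    using ball z a by (intro kernel_diff_far_bound) auto
  then have "\<bar>a\<bar> * \<bar>kernel_diff a x 0 z\<bar> \<le> \<bar>a\<bar> * (2 * 1 * 2 powr (1 - a) * norm z powr (a - 1))"
    by (rule mult_left_mono) simp
  moreover have "norm (x - z) powr a - norm z powr a = a * kernel_diff a x 0 z"
    using a by (simp add: kernel_diff_def radial_primitive_def diff_divide_distrib[symmetric])
  ultimately show "\<bar>norm (x - z) powr a - norm z powr a\<bar> \<le> \<bar>a\<bar> * (2 * 2 powr (1 - a)) * norm z powr (a - 1)"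
    by (simp add: abs_mult mult.assoc)
qed

text \<open>On the ball of radius 2 both means are bounded; outside it their difference has exponent
  \<open>a - 1\<close>, and the hypothesis \<open>d\<close> makes its square integrable at
  infinity.\<close>

lemma nn_integral_mean_potential_diff_square:
  fixes S X :: "'a set"
  assumes [measurable]: "S \<in> sets borel" and S: "emeasure lborel S < \<infinity>" "0 < measure lborel S" "S \<subseteq> ball 0 1"
    and [measurable]: "X \<in> sets borel" and X: "emeasure lborel X < \<infinity>" "0 < measure lborel X" "X \<subseteq> ball 0 1"
    and d: "real DIM('a) < 2 * (1 - a)"
  shows "(\<integral>\<^sup>+z. ennreal ((mean_potential a S z - mean_potential a X z)\<^sup>2) \<partial>lborel) < \<infinity>"
proof -
  define C where "C = (E + measure lborel S) / measure lborel S + (E + measure lborel X) / measure lborel X"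
  define K where "K = 2 * (\<bar>a\<bar> * (2 * 2 powr (1 - a)))"
  let ?g = "\<lambda>z. mean_potential a S z - mean_potential a X z"
  let ?out = "\<lambda>z::'a. ennreal (norm z powr - (2 * (1 - a))) * indicator (- ball 0 2) z"
  have "(\<integral>\<^sup>+z. ennreal ((?g z)\<^sup>2) \<partial>lborel) \<le> (\<integral>\<^sup>+z. ennreal (C\<^sup>2) * indicator (ball 0 2) z + ennreal (K\<^sup>2) * ?out z \<partial>lborel)"
  proof (rule nn_integral_mono)
    fix z :: 'a
    show "ennreal ((?g z)\<^sup>2) \<le> ennreal (C\<^sup>2) * indicator (ball 0 2) z + ennreal (K\<^sup>2) * ?out z"
    proof (cases "2 \<le> norm z")
      case True
      have "\<bar>?g z\<bar> \<le> K * norm z powr (a - 1)"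
        using mean_potential_far_bound[OF assms(1) S True] mean_potential_far_bound[OF assms(5) X True]
        unfolding K_def by linarith
      then have "(?g z)\<^sup>2 \<le> (K * norm z powr (a - 1))\<^sup>2"
        by (intro abs_le_square_iff[THEN iffD1]) simp
      also have "\<dots> = K\<^sup>2 * norm z powr - (2 * (1 - a))"
        by (simp add: power_mult_distrib power2_eq_square[of "_ powr _"] powr_add[symmetric])
      finally have "ennreal ((?g z)\<^sup>2) \<le> ennreal (K\<^sup>2) * ennreal (norm z powr - (2 * (1 - a)))"
        by (simp add: ennreal_mult[symmetric] ennreal_leI)
      then show ?thesis using True by simp
    next
      case False
      have "\<bar>?g z\<bar> \<le> C"
        using mean_potential_bounds[OF assms(1) S(1,2), of z] mean_potential_bounds[OF assms(5) X(1,2), of z]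
        unfolding C_def by linarith
      then have "(?g z)\<^sup>2 \<le> C\<^sup>2"
        by (intro abs_le_square_iff[THEN iffD1]) simp
      then show ?thesis using False by (simp add: ennreal_leI)
    qed
  qed
  also have "\<dots> = ennreal (C\<^sup>2) * emeasure lborel (ball (0::'a) 2) + ennreal (K\<^sup>2) * (\<integral>\<^sup>+z. ?out z \<partial>lborel)"
    by (subst nn_integral_add) (simp_all add: nn_integral_cmult)
  also have "\<dots> < \<infinity>"
  proof -
    have "(\<integral>\<^sup>+z. ?out z \<partial>lborel) < \<infinity>"
      using d by (intro nn_integral_powr_outside_ball_finite) auto
    then show ?thesis
      by (simp add: ennreal_mult_less_top emeasure_ball)
  qed
  finally show ?thesis .
qed

text \<open>Fubini: pairing the averaged kernel with \<open>u\<close> averages the coefficient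
  \<open>T\<close> over \<open>S\<close>. Boundedness of \<open>u\<close> controls the moving
  singularity at \<open>x\<close> and integrability of \<open>u\<close> the rest, with a constant
  \<open>W\<close> independent of \<open>x\<close>.\<close>

lemma potential_pairing:
  fixes S :: "'a set" and u :: "'a \<Rightarrow> real"
  assumes [measurable]: "S \<in> sets borel" and S: "emeasure lborel S < \<infinity>" "0 < measure lborel S"
    and u: "integrable lborel u" and B: "\<And>z. \<bar>u z\<bar> \<le> B"
  defines "T \<equiv> \<lambda>x. LINT z|lborel. (norm (x - z) powr a - norm z powr a) * u z"
  shows "integrable lborel (\<lambda>z. (mean_potential a S z - norm z powr a) * u z)"
    and "integrable lborel (\<lambda>x. indicator S x * T x)"
    and "(LINT z|lborel. (mean_potential a S z - norm z powr a) * u z)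
      = (LINT x|lborel. indicator S x * T x) / measure lborel S"
proof -
  have [measurable]: "u \<in> borel_measurable borel" using u by auto
  let ?k = "\<lambda>x z. norm (x - z) powr a - norm z powr a"
  define W where "W = B * E + (LINT z|lborel. \<bar>u z\<bar>)"
  have B0: "0 \<le> B" using order_trans[OF abs_ge_zero B[of 0]] .
  have pot: "integrable lborel (\<lambda>z. norm (x - z) powr a * \<bar>u z\<bar>)" "(LINT z|lborel. norm (x - z) powr a * \<bar>u z\<bar>) \<le> W" for x
  proof -
    have W: "0 \<le> W" using B0 E by (simp add: W_def)
    have "(\<integral>\<^sup>+z. ennreal (norm (z - x) powr a * \<bar>u z\<bar>) \<partial>lborel) \<le> ennreal B * ennreal E + (\<integral>\<^sup>+z. ennreal \<bar>u z\<bar> \<partial>lborel)"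
      using B by (intro nn_integral_potential_le) auto
    also have "(\<integral>\<^sup>+z. ennreal \<bar>u z\<bar> \<partial>lborel) = ennreal (LINT z|lborel. \<bar>u z\<bar>)"
      using u by (intro nn_integral_eq_integral) auto
    also have "ennreal B * ennreal E + \<dots> = ennreal W"
      using B0 E by (simp add: W_def ennreal_mult[symmetric] ennreal_plus[symmetric] del: ennreal_plus)
    finally have le: "(\<integral>\<^sup>+z. ennreal (norm (x - z) powr a * \<bar>u z\<bar>) \<partial>lborel) \<le> ennreal W"
      by (simp add: norm_minus_commute)
    then show int: "integrable lborel (\<lambda>z. norm (x - z) powr a * \<bar>u z\<bar>)"
      by (intro integrableI_nonneg) (auto intro: le_less_trans)
    have "ennreal (LINT z|lborel. norm (x - z) powr a * \<bar>u z\<bar>) \<le> ennreal W"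
      using le nn_integral_eq_integral[OF int] by simp
    then show "(LINT z|lborel. norm (x - z) powr a * \<bar>u z\<bar>) \<le> W"
      using W by (subst (asm) ennreal_le_iff) auto
  qed
  have k_le: "\<bar>?k x z * u z\<bar> \<le> norm (x - z) powr a * \<bar>u z\<bar> + norm (0 - z) powr a * \<bar>u z\<bar>" for x z
  proof -
    have "\<bar>?k x z\<bar> \<le> norm (x - z) powr a + norm z powr a"
      using powr_ge_zero[of "norm (x - z)" a] powr_ge_zero[of "norm z" a] by linarith
    then have "\<bar>?k x z\<bar> * \<bar>u z\<bar> \<le> (norm (x - z) powr a + norm z powr a) * \<bar>u z\<bar>"
      by (rule mult_right_mono) simp
    then show ?thesis by (simp add: abs_mult distrib_right)
  qed
  have k_int: "integrable lborel (\<lambda>z. ?k x z * u z)" for x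
  proof (rule Bochner_Integration.integrable_bound)
    show "integrable lborel (\<lambda>z. norm (x - z) powr a * \<bar>u z\<bar> + norm (0 - z) powr a * \<bar>u z\<bar>)"
      by (intro Bochner_Integration.integrable_add pot)
    show "AE z in lborel. norm (?k x z * u z) \<le> norm (norm (x - z) powr a * \<bar>u z\<bar> + norm (0 - z) powr a * \<bar>u z\<bar>)"
      using k_le by (intro AE_I2) (simp add: order_trans[OF k_le])
  qed measurable
  have k_norm: "(LINT z|lborel. \<bar>?k x z * u z\<bar>) \<le> 2 * W" for x
  proof -
    have "(LINT z|lborel. \<bar>?k x z * u z\<bar>) \<le> (LINT z|lborel. norm (x - z) powr a * \<bar>u z\<bar> + norm (0 - z) powr a * \<bar>u z\<bar>)"
      by (intro integral_mono integrable_abs k_int Bochner_Integration.integrable_add pot k_le)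
    also have "\<dots> = (LINT z|lborel. norm (x - z) powr a * \<bar>u z\<bar>) + (LINT z|lborel. norm (0 - z) powr a * \<bar>u z\<bar>)"
      by (intro Bochner_Integration.integral_add pot)
    also have "\<dots> \<le> 2 * W"
      using pot(2)[of x] pot(2)[of 0] by linarith
    finally show ?thesis .
  qed
  have int: "integrable (lborel \<Otimes>\<^sub>M lborel) (\<lambda>(x, z). indicator S x * (?k x z * u z))"
  proof (rule lborel_pair.Fubini_integrable)
    show "integrable lborel (\<lambda>x. LINT z|lborel. norm (case (x, z) of (x, z) \<Rightarrow> indicator S x * (?k x z * u z)))"
    proof (rule Bochner_Integration.integrable_bound)
      show "integrable lborel (\<lambda>x. indicator S x * (2 * W))"
        using S by (intro integrable_mult_left) (simp add: integrable_indicator_iff)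
      show "AE x in lborel. norm (LINT z|lborel. norm (case (x, z) of (x, z) \<Rightarrow> indicator S x * (?k x z * u z)))
          \<le> norm (indicator S x * (2 * W))"
        using k_norm order_trans[OF integral_nonneg_AE k_norm]
        by (intro AE_I2) (auto simp: indicator_def intro: order_trans[OF k_norm])
    qed measurable
    show "AE x in lborel. integrable lborel (\<lambda>z. case (x, z) of (x, z) \<Rightarrow> indicator S x * (?k x z * u z))"
      using k_int by (intro AE_I2) (simp add: integrable_mult_right)
  qed measurable
  have inner: "(LINT x|lborel. indicator S x * (?k x z * u z)) = measure lborel S * ((mean_potential a S z - norm z powr a) * u z)" for z
  proof -
    have "(LINT x|lborel. indicator S x * (?k x z * u z)) = (LINT x|lborel. (indicator S x * ?k x z) * u z)"
      by (simp add: mult.assoc)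
    also have "\<dots> = (LINT x|lborel. indicator S x * ?k x z) * u z"
      by (rule integral_mult_left_zero)
    finally show ?thesis
      using S unfolding mean_potential_diff_eq(2)[OF assms(1) S] by simp
  qed
  have "integrable lborel (\<lambda>z. measure lborel S * ((mean_potential a S z - norm z powr a) * u z))"
    using lborel_pair.integrable_snd[OF int] unfolding inner .
  then show "integrable lborel (\<lambda>z. (mean_potential a S z - norm z powr a) * u z)"
    using S by simp
  have T_eq: "(LINT z|lborel. indicator S x * (?k x z * u z)) = indicator S x * T x" for x
    by (simp add: T_def)
  show "integrable lborel (\<lambda>x. indicator S x * T x)"
    using lborel_pair.integrable_fst[OF int] unfolding T_eq .
  have "measure lborel S * (LINT z|lborel. (mean_potential a S z - norm z powr a) * u z) = (LINT x|lborel. indicator S x * T x)"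
    using lborel_pair.Fubini_integral[OF int] unfolding inner T_eq by simp
  then show "(LINT z|lborel. (mean_potential a S z - norm z powr a) * u z)
      = (LINT x|lborel. indicator S x * T x) / measure lborel S"
    using S by (simp add: field_simps)
qed

text \<open>Every point of \<open>S\<close> is within \<open>norm (z - q) + \<delta>\<close> of
  \<open>z\<close>, and \<open>a < 0\<close> turns this upper bound on the distance into a lower
  bound on the kernel.\<close>

lemma mean_potential_lower_bound:
  fixes S :: "'a set"
  assumes [measurable]: "S \<in> sets borel" and S: "emeasure lborel S < \<infinity>" "0 < measure lborel S"
    and ball: "S \<subseteq> ball q \<delta>" and \<delta>: "0 < \<delta>"
  shows "(norm (z - q) + \<delta>) powr a \<le> mean_potential a S z"
proof -
  have "measure lborel S * (norm (z - q) + \<delta>) powr a = (LINT x|lborel. indicator S x * (norm (z - q) + \<delta>) powr a)"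
    by simp
  also have "\<dots> \<le> (LINT x|lborel. indicator S x * norm (x - z) powr a)"
  proof (rule integral_mono_AE)
    show "integrable lborel (\<lambda>x. indicator S x * (norm (z - q) + \<delta>) powr a)"
      using S by (intro integrable_mult_left) (simp add: integrable_indicator_iff)
    show "integrable lborel (\<lambda>x. indicator S x * norm (x - z) powr a)"
      using S by (intro integrable_potential) auto
    have "AE x in lborel. x \<noteq> z" by (simp add: AE_lborel_singleton)
    then show "AE x in lborel. indicator S x * (norm (z - q) + \<delta>) powr a \<le> indicator S x * norm (x - z) powr a"
    proof eventually_elim
      case (elim x)
      have "(norm (z - q) + \<delta>) powr a \<le> norm (x - z) powr a" if "x \<in> S"
      proof -
        have "norm (x - q) < \<delta>"
          using that ball by (auto simp: dist_norm norm_minus_commute)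
        then have "norm (x - z) \<le> norm (z - q) + \<delta>"
          using norm_triangle_ineq4[of "x - q" "z - q"] by simp
        then show ?thesis using elim a by (intro powr_mono2') auto
      qed
      then show ?case by (simp add: indicator_def)
    qed
  qed
  finally show ?thesis
    using S by (simp add: mean_potential_def field_simps)
qed

end

text \<open>One factor of the l^2 norm cancels. This is duality with the coefficient vector as its
  own test vector.\<close>

lemma sum_squares_le_if_bounded_functional:
  fixes \<alpha> :: "'i \<Rightarrow> real"
  assumes "0 \<le> B" "(\<Sum>i\<in>F. (\<alpha> i)\<^sup>2) \<le> 2 * (sqrt (\<Sum>i\<in>F. (\<alpha> i)\<^sup>2) * sqrt B)"
  shows "(\<Sum>i\<in>F. (\<alpha> i)\<^sup>2) \<le> 4 * B"
proof -
  define s where "s = sqrt (\<Sum>i\<in>F. (\<alpha> i)\<^sup>2)"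
  have s: "0 \<le> s" "s\<^sup>2 = (\<Sum>i\<in>F. (\<alpha> i)\<^sup>2)"
    by (auto simp: s_def sum_nonneg)
  have "s * s \<le> (2 * sqrt B) * s"
    using assms(2) s(1) unfolding s_def[symmetric] s(2)[symmetric] by (simp add: power2_eq_square ac_simps)
  then have "s \<le> 2 * sqrt B"
    using s(1) assms(1) by (cases "s = 0") auto
  then have "s\<^sup>2 \<le> (2 * sqrt B)\<^sup>2"
    using s(1) by (rule power_mono)
  then show ?thesis using s assms(1) by (simp add: power_mult_distrib)
qed

text \<open>Boundedness at every point yields a uniform bound only on some measurable set of
  positive measure, about which nothing else is known. This is why averages are taken over
  measurable sets rather than over balls.\<close>

lemma critical_coefficients_unbounded:
  fixes u :: "'i \<Rightarrow> real^'n \<Rightarrow> real" and F :: "nat \<Rightarrow> 'i set"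
  defines "T \<equiv> \<lambda>i x. LINT z|lborel. (norm (x - z) powr (- real CARD('n) / 2) - norm z powr (- real CARD('n) / 2)) * u i z"
  assumes basis: "orthonormal_basis_of L2 I u"
    and u: "\<And>i. i \<in> I \<Longrightarrow> integrable lborel (u i)" "\<And>i. i \<in> I \<Longrightarrow> \<exists>B. \<forall>z. \<bar>u i z\<bar> \<le> B"
    and F: "\<And>n. finite (F n)" "\<And>n. F n \<subseteq> I" "\<And>G. finite G \<Longrightarrow> G \<subseteq> I \<Longrightarrow> \<forall>\<^sub>F n in sequentially. G \<subseteq> F n"
  shows "\<exists>x. \<forall>B. \<exists>n. B < (\<Sum>i\<in>F n. (T i x)\<^sup>2)"
proof (rule ccontr)
  assume "\<not> ?thesis"
  then have bounded: "\<exists>B. \<forall>n. (\<Sum>i\<in>F n. (T i x)\<^sup>2) \<le> B" for x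
    by (auto simp: not_less)
  let ?d = "real CARD('n)"
  define a where "a = - ?d / 2"
  have "0 < ?d" by simp
  then have a: "a < 0" "- ?d < a" "?d < 2 * (1 - a)" "2 * a = - ?d"
    by (simp_all add: a_def)
  define E where "E = enn2real (\<integral>\<^sup>+w. ennreal (norm (w::real^'n) powr a) * indicator (ball 0 4) w \<partial>lborel)"
  have E: "0 \<le> E" by (simp add: E_def)
  have mass: "(\<integral>\<^sup>+w. ennreal (norm (w::real^'n) powr a) * indicator (ball 0 4) w \<partial>lborel) = ennreal E"
    unfolding E_def using nn_integral_powr_ball_finite[where 'a = "real^'n", of "- a" 4] a
    by (intro ennreal_enn2real[symmetric]) auto
  note pot = a(1) E mass
  have [measurable]: "u i \<in> borel_measurable borel" if "i \<in> I" for i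
    using u(1)[OF that] by auto
  have T_eq: "T i = (\<lambda>x. LINT z|lborel. (norm (x - z) powr a - norm z powr a) * u i z)" for i
    by (simp add: T_def a_def)
  have [measurable]: "T i \<in> borel_measurable borel" if "i \<in> I" for i
    unfolding T_eq using that by measurable
  have [measurable]: "(\<lambda>x. \<Sum>i\<in>F n. (T i x)\<^sup>2) \<in> borel_measurable borel" for n
    using F(2)[of n] by (intro borel_measurable_sum borel_measurable_power) auto
  define X where "X B = {x \<in> ball 0 1. \<forall>n. (\<Sum>i\<in>F n. (T i x)\<^sup>2) \<le> real B}" for B :: nat
  have [measurable]: "X B \<in> sets borel" for B
    unfolding X_def by measurable
  obtain B where B: "emeasure lborel (X B) \<noteq> 0"
  proof (rule ccontr)
    assume "\<not> thesis"
    then have "X B \<in> null_sets lborel" for B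
      using that by (auto simp: null_sets_def)
    then have "(\<Union>B. X B) \<in> null_sets lborel" by auto
    moreover have "ball 0 1 \<subseteq> (\<Union>B. X B)"
    proof
      fix x :: "real^'n" assume x: "x \<in> ball 0 1"
      obtain b where b: "\<And>n. (\<Sum>i\<in>F n. (T i x)\<^sup>2) \<le> b" using bounded[of x] by blast
      obtain B :: nat where "b \<le> real B" using real_arch_simple by blast
      with b have "\<And>n. (\<Sum>i\<in>F n. (T i x)\<^sup>2) \<le> real B" by (meson order_trans)
      with x show "x \<in> (\<Union>B. X B)" by (auto simp: X_def)
    qed
    ultimately have "ball (0::real^'n) 1 \<in> null_sets lborel"
      using null_sets_subset[of "\<Union>B. X B" lborel "ball 0 1"] by simp
    then show False
      by (auto simp: null_sets_def emeasure_ball less_imp_neq[OF unit_ball_vol_pos, symmetric])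
  qed
  have fin_meas: "emeasure lborel S < \<infinity>" "0 < measure lborel S"
    if "S \<subseteq> ball 0 1" "emeasure lborel S \<noteq> 0" and [measurable]: "S \<in> sets borel" for S :: "(real^'n) set"
  proof -
    have "emeasure lborel S \<le> emeasure lborel (ball (0::real^'n) 1)"
      using that by (intro emeasure_mono) auto
    also have "\<dots> < \<infinity>" by (simp add: emeasure_ball)
    finally show fin: "emeasure lborel S < \<infinity>" .
    show "0 < measure lborel S"
      using that(2) fin by (simp add: measure_def enn2real_positive_iff zero_less_iff_neq_zero less_top)
  qed
  have Xball: "X B \<subseteq> ball 0 1" by (auto simp: X_def)
  note X = fin_meas[OF Xball B]
  define \<delta> where "\<delta> n = 1 / real (Suc n)" for n
  have \<delta>: "0 < \<delta> n" for n by (simp add: \<delta>_def)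
  have "\<exists>q. emeasure lborel (X B \<inter> ball q (\<delta> n)) \<noteq> 0" for n
    by (rule nonnull_intersection_small_ball[OF _ B \<delta>[of n]]) auto
  then obtain q where q: "\<And>n. emeasure lborel (X B \<inter> ball (q n) (\<delta> n)) \<noteq> 0"
    by metis
  define S where "S n = X B \<inter> ball (q n) (\<delta> n)" for n
  have [measurable]: "S n \<in> sets borel" for n unfolding S_def by measurable
  have S: "S n \<subseteq> ball 0 1" "emeasure lborel (S n) < \<infinity>" "0 < measure lborel (S n)" "S n \<subseteq> X B" "S n \<subseteq> ball (q n) (\<delta> n)" for n
    using fin_meas[of "S n"] q[of n] Xball by (auto simp: S_def)
  \<comment> \<open>The first mean concentrates near \<open>q n\<close> as \<open>n\<close> grows.
    Subtracting the fixed mean over \<open>X B\<close> cancels the slow decay at infinity, which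
    would keep a single mean out of \<open>L2\<close>.\<close>
  define g where "g n z = mean_potential a (S n) z - mean_potential a (X B) z" for n z
  have [measurable]: "g n \<in> borel_measurable borel" for n
    unfolding g_def[abs_def] by measurable
  have g_fin: "(\<integral>\<^sup>+z. ennreal ((g n z)\<^sup>2) \<partial>lborel) < \<infinity>" for n
    unfolding g_def using S X Xball a(3) by (intro nn_integral_mean_potential_diff_square[OF pot]) auto
  have g_L2: "g n \<in> L2" for n
    using g_fin[of n] by (auto simp: L2_def integrable_iff_bounded)
  have pairing: "L2_inner (g n) (u i) = (LINT x|lborel. indicator (S n) x * T i x) / measure lborel (S n)
      - (LINT x|lborel. indicator (X B) x * T i x) / measure lborel (X B)" if i: "i \<in> I" for n i
  proof -
    obtain b where b: "\<And>z. \<bar>u i z\<bar> \<le> b" using u(2)[OF i] by blast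
    note pS = potential_pairing[OF pot _ S(2,3)[of n] u(1)[OF i] b, simplified]
    note pX = potential_pairing[OF pot _ X u(1)[OF i] b, simplified]
    have "L2_inner (g n) (u i) = (LINT z|lborel. (mean_potential a (S n) z - norm z powr a) * u i z
        - (mean_potential a (X B) z - norm z powr a) * u i z)"
      unfolding L2_inner_def g_def by (intro Bochner_Integration.integral_cong) (auto simp: algebra_simps)
    also have "\<dots> = (LINT z|lborel. (mean_potential a (S n) z - norm z powr a) * u i z)
        - (LINT z|lborel. (mean_potential a (X B) z - norm z powr a) * u i z)"
      by (intro Bochner_Integration.integral_diff pS(1) pX(1))
    finally show ?thesis
      unfolding pS(3) pX(3) T_eq .
  qed
  have T_int: "integrable lborel (\<lambda>x. indicator S' x * T i x)"
    if i: "i \<in> I" and [measurable]: "S' \<in> sets borel" and S': "emeasure lborel S' < \<infinity>" "0 < measure lborel S'" for i S'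
  proof -
    obtain b where b: "\<And>z. \<bar>u i z\<bar> \<le> b" using u(2)[OF i] by blast
    show ?thesis
      unfolding T_eq by (rule potential_pairing(2)[OF pot that(2) S' u(1)[OF i] b])
  qed
  \<comment> \<open>With \<open>\<alpha>\<close> the coefficients of \<open>g n\<close>, the sum of
    their squares is a difference of two means of the function
    \<open>\<Sum>i\<in>F N. \<alpha> i * T i x\<close>. Cauchy-Schwarz bounds that function on
    \<open>X B\<close>, which contains both sets of averaging.\<close>
  have sum_le: "(\<Sum>i\<in>F N. (L2_inner (g n) (u i))\<^sup>2) \<le> 4 * real B" for n N
  proof (rule sum_squares_le_if_bounded_functional)
    define \<alpha> where "\<alpha> i = L2_inner (g n) (u i)" for i
    define M where "M = sqrt (\<Sum>i\<in>F N. (\<alpha> i)\<^sup>2) * sqrt (real B)"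
    let ?f = "\<lambda>x. \<Sum>i\<in>F N. \<alpha> i * T i x"
    have f_le: "\<bar>?f x\<bar> \<le> M" if "x \<in> X B" for x
    proof -
      have "(?f x)\<^sup>2 \<le> (\<Sum>i\<in>F N. (\<alpha> i)\<^sup>2) * (\<Sum>i\<in>F N. (T i x)\<^sup>2)"
        by (rule Cauchy_Schwarz_ineq_sum)
      also have "\<dots> \<le> (\<Sum>i\<in>F N. (\<alpha> i)\<^sup>2) * real B"
        using that by (intro mult_left_mono sum_nonneg) (auto simp: X_def)
      finally have "sqrt ((?f x)\<^sup>2) \<le> sqrt ((\<Sum>i\<in>F N. (\<alpha> i)\<^sup>2) * real B)"
        by (rule real_sqrt_le_mono)
      then show ?thesis by (simp add: M_def real_sqrt_mult)
    qed
    have mean: "(\<Sum>i\<in>F N. \<alpha> i * ((LINT x|lborel. indicator S' x * T i x) / measure lborel S'))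
        = (LINT x|lborel. indicator S' x * ?f x) / measure lborel S'"
      and f_int: "integrable lborel (\<lambda>x. indicator S' x * ?f x)"
      if S': "S' \<in> sets borel" "emeasure lborel S' < \<infinity>" "0 < measure lborel S'" for S'
    proof -
      have eq: "indicator S' x * ?f x = (\<Sum>i\<in>F N. \<alpha> i * (indicator S' x * T i x))" for x
        by (simp add: sum_distrib_left mult.left_commute)
      have int: "integrable lborel (\<lambda>x. \<alpha> i * (indicator S' x * T i x))" if "i \<in> F N" for i
        using T_int[OF _ S'] that F(2) by (intro integrable_mult_right) auto
      show "integrable lborel (\<lambda>x. indicator S' x * ?f x)"
        unfolding eq by (intro Bochner_Integration.integrable_sum int)
      have "(LINT x|lborel. indicator S' x * ?f x) = (\<Sum>i\<in>F N. \<alpha> i * (LINT x|lborel. indicator S' x * T i x))"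
        unfolding eq by (subst Bochner_Integration.integral_sum[OF int]) simp_all
      then show "(\<Sum>i\<in>F N. \<alpha> i * ((LINT x|lborel. indicator S' x * T i x) / measure lborel S'))
          = (LINT x|lborel. indicator S' x * ?f x) / measure lborel S'"
        by (simp add: sum_divide_distrib)
    qed
    have "(\<Sum>i\<in>F N. (\<alpha> i)\<^sup>2) = (\<Sum>i\<in>F N. \<alpha> i * ((LINT x|lborel. indicator (S n) x * T i x) / measure lborel (S n)))
        - (\<Sum>i\<in>F N. \<alpha> i * ((LINT x|lborel. indicator (X B) x * T i x) / measure lborel (X B)))"
      unfolding sum_subtractf[symmetric] right_diff_distrib[symmetric] power2_eq_square
      using F(2)[of N] pairing[of _ n] by (intro sum.cong refl) (auto simp: \<alpha>_def)
    also have "\<dots> = (LINT x|lborel. indicator (S n) x * ?f x) / measure lborel (S n)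
        - (LINT x|lborel. indicator (X B) x * ?f x) / measure lborel (X B)"
      using S X by (subst (1 2) mean) auto
    also have "\<dots> \<le> M + M"
    proof -
      have "\<bar>(LINT x|lborel. indicator (S n) x * ?f x) / measure lborel (S n)\<bar> \<le> M"
        using S[of n] f_le by (intro abs_mean_le f_int) auto
      moreover have "\<bar>(LINT x|lborel. indicator (X B) x * ?f x) / measure lborel (X B)\<bar> \<le> M"
        using X f_le by (intro abs_mean_le f_int) auto
      ultimately show ?thesis by linarith
    qed
    finally show "(\<Sum>i\<in>F N. (L2_inner (g n) (u i))\<^sup>2) \<le> 2 * (sqrt (\<Sum>i\<in>F N. (L2_inner (g n) (u i))\<^sup>2) * sqrt (real B))"
      unfolding \<alpha>_def M_def by linarith
  qed simp
  have norm_le: "L2_inner (g n) (g n) \<le> 4 * real B + 1" for n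
  proof -
    obtain G where G: "finite G" "G \<subseteq> I" "L2_inner (g n) (g n) - 1 < (\<Sum>i\<in>G. (L2_inner (g n) (u i))\<^sup>2)"
      using parseval_lower_bound[OF basis g_L2, of 1 n] by auto
    obtain N where N: "G \<subseteq> F N"
      using F(3)[OF G(1,2)] by (auto simp: eventually_sequentially)
    have "(\<Sum>i\<in>G. (L2_inner (g n) (u i))\<^sup>2) \<le> (\<Sum>i\<in>F N. (L2_inner (g n) (u i))\<^sup>2)"
      by (rule sum_mono2[OF F(1) N]) simp
    with sum_le[of n N] G show ?thesis by linarith
  qed
  have nn_le: "(\<integral>\<^sup>+z. ennreal ((g n z)\<^sup>2) \<partial>lborel) \<le> ennreal (4 * real B + 1)" for n
  proof -
    have "(\<integral>\<^sup>+z. ennreal ((g n z)\<^sup>2) \<partial>lborel) = ennreal (L2_inner (g n) (g n))"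
      unfolding L2_inner_def power2_eq_square
      by (intro nn_integral_eq_integral L2_imp_integrable_mult g_L2) auto
    also have "\<dots> \<le> ennreal (4 * real B + 1)"
      by (rule ennreal_leI[OF norm_le])
    finally show ?thesis .
  qed
  define C where "C = (E + measure lborel (X B)) / measure lborel (X B)"
  have C: "0 < C" using X E by (auto simp: C_def intro!: divide_pos_pos add_nonneg_pos)
  \<comment> \<open>Chosen so that \<open>(2 * r) powr a = 2 * C\<close>: within distance
    \<open>r\<close> of \<open>q n\<close>, once \<open>\<delta> n < r\<close>, the mean over
    \<open>S n\<close> is at least twice the bound \<open>C\<close> for the mean over
    \<open>X B\<close>, and the subtraction costs at most half of it.\<close>
  define r where "r = (2 * C) powr (1 / a) / 2"
  have r: "0 < r" using C by (simp add: r_def)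
  have r_powr: "(2 * r) powr a = 2 * C"
    using C a by (simp add: r_def powr_powr)
  define f where "f n w = ennreal ((norm w + \<delta> n) powr (2 * a) / 4) * indicator (ball (0::real^'n) r) w" for n w
  have [measurable]: "f n \<in> borel_measurable borel" for n
    unfolding f_def[abs_def] by measurable
  have f_le: "(\<integral>\<^sup>+w. f n w \<partial>lborel) \<le> ennreal (4 * real B + 1)" if n: "\<delta> n < r" for n
  proof -
    \<comment> \<open>Recentring at \<open>q n\<close> puts the lower bounds for all
      \<open>n\<close> on the same ball, so the centres themselves need not converge.\<close>
    have "(\<integral>\<^sup>+w. f n w \<partial>lborel) \<le> (\<integral>\<^sup>+w. ennreal ((g n (q n + 1 *\<^sub>R w))\<^sup>2) \<partial>lborel)"
    proof (rule nn_integral_mono)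
      fix w :: "real^'n"
      show "f n w \<le> ennreal ((g n (q n + 1 *\<^sub>R w))\<^sup>2)"
      proof (cases "norm w < r")
        case True
        let ?p = "(norm w + \<delta> n) powr a"
        have "0 < norm w + \<delta> n" using \<delta>[of n] by (simp add: add_nonneg_pos)
        then have "(2 * r) powr a \<le> ?p"
          using True n a by (intro powr_mono2') auto
        then have "2 * C \<le> ?p" by (simp add: r_powr)
        moreover have "?p \<le> mean_potential a (S n) (q n + w)"
          using mean_potential_lower_bound[OF pot _ S(2,3,5)[of n] \<delta>[of n], of "q n + w"] by simp
        moreover have "mean_potential a (X B) (q n + w) \<le> C"
          unfolding C_def using X by (intro mean_potential_bounds(2)[OF pot]) auto
        ultimately have "?p / 2 \<le> g n (q n + w)"
          unfolding g_def by linarith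
        then have "(?p / 2)\<^sup>2 \<le> (g n (q n + w))\<^sup>2"
          by (rule power_mono) simp
        moreover have "(?p / 2)\<^sup>2 = (norm w + \<delta> n) powr (2 * a) / 4"
          by (simp add: power_divide power2_eq_square[of "_ powr _"] powr_add[symmetric])
        ultimately show ?thesis using True by (simp add: f_def ennreal_leI)
      qed (simp add: f_def)
    qed
    also have "\<dots> = (\<integral>\<^sup>+z. ennreal ((g n z)\<^sup>2) \<partial>lborel)"
      by (subst nn_integral_affine[where c = 1 and t = "q n"]) auto
    also note nn_le
    finally show ?thesis .
  qed
  have \<delta>_lim: "\<delta> \<longlonglongrightarrow> 0"
    unfolding \<delta>_def[abs_def] by (rule LIMSEQ_Suc[OF lim_1_over_n])
  \<comment> \<open>Fatou: as \<open>\<delta> n\<close> tends to 0 the lower bounds converge to a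
    quarter of \<open>norm w powr (- d)\<close> on \<open>ball 0 r\<close>, whose integral is
    infinite, against the bound uniform in \<open>n\<close>.\<close>
  have "(\<integral>\<^sup>+w. liminf (\<lambda>n. f n w) \<partial>lborel) \<le> liminf (\<lambda>n. \<integral>\<^sup>+w. f n w \<partial>lborel)"
    by (rule nn_integral_liminf) simp
  also have "\<dots> \<le> liminf (\<lambda>n. ennreal (4 * real B + 1))"
  proof (rule Liminf_mono)
    have "\<forall>\<^sub>F n in sequentially. \<delta> n < r"
      using \<delta>_lim r by (rule order_tendstoD)
    then show "\<forall>\<^sub>F n in sequentially. (\<integral>\<^sup>+w. f n w \<partial>lborel) \<le> ennreal (4 * real B + 1)"
      by eventually_elim (rule f_le)
  qed
  also have "\<dots> = ennreal (4 * real B + 1)"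
    by (simp add: Liminf_const)
  finally have le: "(\<integral>\<^sup>+w. liminf (\<lambda>n. f n w) \<partial>lborel) \<le> ennreal (4 * real B + 1)" .
  have "ennreal (1 / 4) * (\<integral>\<^sup>+w. ennreal (norm w powr - real DIM(real^'n)) * indicator (ball (0::real^'n) r) w \<partial>lborel)
      = (\<integral>\<^sup>+w. ennreal (1 / 4) * (ennreal (norm w powr - ?d) * indicator (ball (0::real^'n) r) w) \<partial>lborel)"
    by (subst nn_integral_cmult) auto
  also have "\<dots> = (\<integral>\<^sup>+w. liminf (\<lambda>n. f n w) \<partial>lborel)"
  proof (rule nn_integral_cong_AE)
    have "AE w in lborel. w \<noteq> (0::real^'n)" by (simp add: AE_lborel_singleton)
    then show "AE w in lborel. ennreal (1 / 4) * (ennreal (norm w powr - ?d) * indicator (ball (0::real^'n) r) w)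
        = liminf (\<lambda>n. f n w)"
    proof eventually_elim
      case (elim w)
      have "(\<lambda>n. (norm w + \<delta> n) powr (2 * a) / 4) \<longlonglongrightarrow> (norm w + 0) powr (2 * a) / 4"
        using elim by (intro tendsto_intros \<delta>_lim) auto
      then have "(\<lambda>n. ennreal ((norm w + \<delta> n) powr (2 * a) / 4)) \<longlonglongrightarrow> ennreal (norm w powr (2 * a) / 4)"
        by (intro tendsto_ennrealI) simp
      then have "(\<lambda>n. f n w) \<longlonglongrightarrow> ennreal (norm w powr (2 * a) / 4) * indicator (ball 0 r) w"
        unfolding f_def by (cases "norm w < r") auto
      then have "liminf (\<lambda>n. f n w) = ennreal (norm w powr (2 * a) / 4) * indicator (ball 0 r) w"
        by (intro lim_imp_Liminf) auto
      then show ?case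
        unfolding a(4) by (simp add: ennreal_mult[symmetric] mult.assoc[symmetric])
    qed
  qed
  also note le
  finally have "ennreal (1 / 4) * \<infinity> \<le> ennreal (4 * real B + 1)"
    unfolding nn_integral_powr_critical_ball_infinite[OF r] .
  moreover have "ennreal (1 / 4) * \<infinity> = \<infinity>"
    by (simp add: ennreal_mult_top)
  ultimately show False
    by (simp add: top_unique)
qed

section \<open>Assembly of the three ranges of \<open>\<gamma>\<close>\<close>

theorem mainTheorem4:
  fixes \<psi> :: "int^'n \<Rightarrow> real^'n \<Rightarrow> real"
    and r :: nat
    and p \<gamma> \<sigma> :: real
    and M :: "'w measure"
    and \<eta> :: "int \<Rightarrow> int^'n \<Rightarrow> int^'n \<Rightarrow> 'w \<Rightarrow> real"
    and Y Y' :: "real^'n \<Rightarrow> 'w \<Rightarrow> real"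
  assumes "prob_space M"
    and "1 \<le> r"
    and "regular_orthonormal_wavelet_basis r \<psi>"
    and "1 \<le> p" and "p \<le> 2"
    and "\<gamma> < real r"
    and "real CARD('n) / 2 < \<gamma> \<or> p = 2 \<and> \<gamma> = real CARD('n) / 2"
    and "\<gamma> \<le> real CARD('n) * (1 - 1 / p) + 1"
    and "prob_space.indep_vars M (\<lambda>_. borel) (\<lambda>(j, k, e). \<eta> j k e) (UNIV \<times> UNIV \<times> wavelet_types)"
    and "\<And>j k e. e \<in> wavelet_types \<Longrightarrow> symmetric_stable M p \<sigma> (\<eta> j k e)"
    and "\<And>x. AE \<omega> in M.
           ((\<lambda>(N, K). wavelet_partial_sum \<gamma> \<psi> \<eta> N K x \<omega>) \<longlongrightarrow> Y x \<omega>) (sequentially \<times>\<^sub>F sequentially)"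
    and "(\<lambda>(x, \<omega>). Y' x \<omega>) \<in> borel_measurable (borel \<Otimes>\<^sub>M M)"
    and "\<And>x. AE \<omega> in M. Y' x \<omega> = Y x \<omega>"
  shows "AE \<omega> in M.
           ereal (3 * real CARD('n) / 2 - \<gamma> + 1) \<le> hausdorff_dim (range (\<lambda>x. (x, Y' x \<omega>)))"
proof -
  interpret prob_space M by fact
  let ?d = "real CARD('n)"
  let ?\<eta> = "\<lambda>(j, k, e). \<eta> j k e"
  have \<psi>: "regular_orthonormal_wavelet_basis r \<psi>" by fact
  have indep: "indep_vars (\<lambda>_. borel) ?\<eta> wavelet_index"
    using assms(9) by (simp add: wavelet_index_def)
  have stable: "symmetric_stable M p \<sigma> (?\<eta> i)" if "i \<in> wavelet_index" for i
    using that assms(10) by (auto simp: wavelet_index_def)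
  have lim: "AE \<omega> in M. (\<lambda>n. \<Sum>i\<in>wavelet_box n. ?\<eta> i \<omega> * fractional_integral \<gamma> (wavelet_family \<psi> i) x)
      \<longlonglongrightarrow> Y' x \<omega>" for x
    using assms(11,13) by (rule AE_diagonal_limit)
  \<comment> \<open>Positivity of \<open>\<sigma>\<close> is part of
    \<open>symmetric_stable\<close>, so it can be read off once some index is known to
    exist.\<close>
  obtain e :: "int^'n" where e: "e \<in> wavelet_types"
  proof
    show "(\<chi> i. 1) \<in> (wavelet_types :: (int^'n) set)"
      by (auto simp: wavelet_types_def vec_eq_iff)
  qed
  then have \<sigma>: "0 < \<sigma>"
    using assms(10)[of e] by (simp add: symmetric_stable_def)
  \<comment> \<open>\<open>p \<le> 2\<close> makes the factor \<open>1 - 1 / p\<close> at most 1/2,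
    so the upper bound on \<open>\<gamma>\<close> gives h \<le> 1 for every admissible
    \<open>p\<close>.\<close>
  have "?d * (1 - 1 / p) \<le> ?d * (1 / 2)"
    using assms(4,5) by (intro mult_left_mono) (auto simp: field_simps)
  then have \<gamma>_le: "\<gamma> \<le> ?d / 2 + 1"
    using assms(8) by linarith
  consider "\<gamma> = ?d / 2 + 1" | "?d / 2 < \<gamma>" "\<gamma> < ?d / 2 + 1" | "p = 2" "\<gamma> = ?d / 2"
    using assms(7) \<gamma>_le by fastforce
  then show ?thesis
  proof cases
    \<comment> \<open>Here \<open>3 * d / 2 - \<gamma> + 1 = d\<close>, and the bound holds for each
      sample path that is Borel measurable.\<close>
    case 1
    have "AE \<omega> in M. \<omega> \<in> space M" by simp
    then show ?thesis
    proof eventually_elim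
      case (elim \<omega>)
      have "(\<lambda>x. Y' x \<omega>) \<in> borel_measurable borel"
        using elim by (intro measurable_uncurry_compose[OF assms(12)]) auto
      from hausdorff_dim_graph_ge_dimension[OF this] show ?case
        using 1 by simp
    qed
  next
    case 2
    show ?thesis
      by (rule hausdorff_dim_wavelet_series_graph[OF assms(1) \<psi> assms(6,4,5) 2 indep stable \<sigma> assms(12) lim])
  next
    case 3
    have "?d / 2 \<le> \<gamma>" "\<gamma> < ?d / 2 + 1" using 3 by auto
    then obtain c where c: "c \<noteq> 0" and coeff: "\<And>i x. i \<in> wavelet_index \<Longrightarrow> fractional_integral \<gamma> (wavelet_family \<psi> i) x
        = c * (LINT z|lborel. kernel_diff (\<gamma> - ?d) x 0 z * wavelet_family \<psi> i z)"
      using fractional_integral_wavelet[OF \<psi> assms(6)] by metis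
    have Yx [measurable]: "Y' x \<in> borel_measurable M" for x
      by (rule measurable_uncurry_compose[OF assms(12)]) auto
    define T where "T i x = (LINT z|lborel. (norm (x - z) powr (- ?d / 2) - norm z powr (- ?d / 2)) * wavelet_family \<psi> i z)" for i x
    \<comment> \<open>\<open>radial_primitive\<close> divides by its exponent, here
      \<open>- d / 2\<close>; \<open>c'\<close> absorbs that division so that \<open>T\<close> is
      written with the plain powers.\<close>
    define c' where "c' = c / (- ?d / 2)"
    have c': "c' \<noteq> 0" using c by (simp add: c'_def)
    have coeff': "fractional_integral \<gamma> (wavelet_family \<psi> i) x = c' * T i x" if "i \<in> wavelet_index" for i x
    proof -
      have "\<gamma> - ?d = - ?d / 2" using 3 by simp
      then have "kernel_diff (\<gamma> - ?d) x 0 z = (norm (x - z) powr (- ?d / 2) - norm z powr (- ?d / 2)) / (- ?d / 2)" for z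
        by (simp add: kernel_diff_def radial_primitive_def diff_divide_distrib)
      then have "kernel_diff (\<gamma> - ?d) x 0 z * wavelet_family \<psi> i z
          = 1 / (- ?d / 2) * ((norm (x - z) powr (- ?d / 2) - norm z powr (- ?d / 2)) * wavelet_family \<psi> i z)" for z
        by simp
      then show ?thesis
        unfolding coeff[OF that] T_def c'_def by simp
    qed
    have "\<exists>x. \<forall>B. \<exists>n. B < (\<Sum>i\<in>wavelet_box n. (T i x)\<^sup>2)"
      unfolding T_def
    proof (rule critical_coefficients_unbounded[OF wavelet_family_basis[OF \<psi>] _ _ finite_wavelet_box
          wavelet_box_subset eventually_subset_wavelet_box])
      fix i :: "int \<times> (int^'n) \<times> (int^'n)" assume "i \<in> wavelet_index"
      then obtain j k e where i: "i = (j, k, e)" "e \<in> wavelet_types" by (auto simp: wavelet_index_def)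
      show "integrable lborel (wavelet_family \<psi> i)"
        using wavelet_integrable[OF \<psi> i(2)] by (simp add: i wavelet_family_def)
      show "\<exists>B. \<forall>z. \<bar>wavelet_family \<psi> i z\<bar> \<le> B"
        using wavelet_bounded[OF \<psi> i(2), of j k] by (auto simp: i wavelet_family_def)
    qed
    then obtain x where x: "\<And>B. \<exists>n. B < (\<Sum>i\<in>wavelet_box n. (T i x)\<^sup>2)" by blast
    obtain B where B: "\<And>n. (\<Sum>i\<in>wavelet_box n. \<bar>fractional_integral \<gamma> (wavelet_family \<psi> i) x\<bar> powr p) \<le> B"
      using stable_series_coefficients_bounded[OF finite_wavelet_box wavelet_box_subset wavelet_box_mono indep stable \<sigma> Yx lim]
      by blast
    have "(\<Sum>i\<in>wavelet_box n. (T i x)\<^sup>2) \<le> B / c'\<^sup>2" for n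
    proof -
      have "(\<Sum>i\<in>wavelet_box n. \<bar>fractional_integral \<gamma> (wavelet_family \<psi> i) x\<bar> powr p) = (\<Sum>i\<in>wavelet_box n. c'\<^sup>2 * (T i x)\<^sup>2)"
      proof (rule sum.cong[OF refl])
        fix i :: "int \<times> (int^'n) \<times> (int^'n)" assume "i \<in> wavelet_box n"
        then have "fractional_integral \<gamma> (wavelet_family \<psi> i) x = c' * T i x"
          using wavelet_box_subset by (intro coeff') blast
        then show "\<bar>fractional_integral \<gamma> (wavelet_family \<psi> i) x\<bar> powr p = c'\<^sup>2 * (T i x)\<^sup>2"
          using 3(1) by (simp add: power_mult_distrib)
      qed
      with B[of n] c' show ?thesis
        by (simp add: sum_distrib_left[symmetric] field_simps)
    qed
    with x[of "B / c'\<^sup>2"] show ?thesis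
      by (auto simp: not_less[symmetric])
  qed
qed

end
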